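(* Let $\Gamma$ be a finitely generated group with infinitely many ends, let $m$ $(\ge3)$ be the minimum cardinality of a generator set of $\Gamma$, and let $\phi=\frac12(1+\sqrt5)$. (a) If $m\ge4$, then $\mu(G)\ge\sqrt3$ $(>\phi)$ for any Cayley graph $G$ of $\Gamma$. (b) Suppose $m=3$ and $\Gamma$ is an HNN extension. Any Cayley graph $G$ of $\Gamma$ satisfies $\mu(G)\ge\phi$. (c) Suppose $\Gamma=H*_CK$ is an amalgamated product with generator set $S\subseteq H\cup K$ satisfying $|S|=3$. There exists a minimal generator set $S'\subseteq H\cup K$ with $|S'|=3$ whose Cayley graph $G'$ satisfies $\mu(G')\ge\phi$. (d) If $\Gamma=H*_CK$ is an amalgamated product, there exists a minimal generator set $S$ whose Cayley graph $G$ satisfies $\mu(G)\ge\phi$.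
   Context: Generator sets $S$ are finite, symmetric ($S=S^{-1}$), and do not contain the identity; $S$ is minimal if no proper subset of $S$ is a generator set. Cayley graphs are taken in simple form (multiple edges coalesce). The number of ends of a connected graph is the supremum over its finite subgraphs of the number of infinite components remaining after removal of the subgraph; the number of ends of a finitely generated group is that of any of its Cayley graphs. A self-avoiding walk (SAW) is a walk with no repeated vertex; $\sigma_n$ is the number of $n$-step SAWs from a given vertex, and $\mu(G)=\lim_{n\to\infty}\sigma_n^{1/n}$. An HNN extension here means a group of the form $\langle S,t\mid R,\ t^{-1}C_1t=C_2\rangle$ where $H=\langle S\mid R\rangle$ is a group with $|S|<\infty$, $C_1$ and $C_2$ are isomorphic finite subgroups of $H$ (the relation being via a given isomorphism), and $t$ is a new symbol. An amalgamated product $H*_CK$ here means the amalgamated free product of groups $H,K$ over a finite group $C$ injecting into both (identified with its images), with $C\ne H$ and $C\neq K$. *)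

theory Defs
  imports
    Complex_Main
    "HOL-Library.Extended_Nat"
    "HOL-Algebra.Generated_Groups"
    "Graph_Theory.Digraph_Component"
    "Graph_Theory.Vertex_Walk"
begin

section \<open>Generator sets\<close>

definition finitely_generated_group :: "('a, 'b) monoid_scheme \<Rightarrow> bool" where
  "finitely_generated_group G \<longleftrightarrow>
     group G \<and> (\<exists>A. finite A \<and> A \<subseteq> carrier G \<and> generate G A = carrier G)"

definition generator_set :: "('a, 'b) monoid_scheme \<Rightarrow> 'a set \<Rightarrow> bool" where
  "generator_set G S \<longleftrightarrow>
     finite S \<and> S \<subseteq> carrier G \<and> \<one>\<^bsub>G\<^esub> \<notin> S \<and> (\<lambda>s. inv\<^bsub>G\<^esub> s) ` S = S \<and>
     generate G S = carrier G"

definition minimal_generator_set :: "('a, 'b) monoid_scheme \<Rightarrow> 'a set \<Rightarrow> bool" where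
  "minimal_generator_set G S \<longleftrightarrow>
     generator_set G S \<and> (\<forall>T. T \<subset> S \<longrightarrow> \<not> generator_set G T)"

definition min_generator_card :: "('a, 'b) monoid_scheme \<Rightarrow> nat" where
  "min_generator_card G = (LEAST k. \<exists>S. generator_set G S \<and> card S = k)"

section \<open>Cayley graphs, ends, self-avoiding walks\<close>

text \<open>Undirected graphs are symmetric digraphs. The arcs of a Cayley graph are pairs of vertices,
  so there are no parallel edges; the arc set is symmetric because a generator set is.\<close>

definition cayley_graph :: "('a, 'b) monoid_scheme \<Rightarrow> 'a set \<Rightarrow> ('a, 'a \<times> 'a) pre_digraph" where
  "cayley_graph G S =
     \<lparr> verts = carrier G, arcs = {(x, x \<otimes>\<^bsub>G\<^esub> s) | x s. x \<in> carrier G \<and> s \<in> S},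
       tail = fst, head = snd \<rparr>"

definition ecard :: "'a set \<Rightarrow> enat" where
  "ecard A = (if finite A then enat (card A) else \<infinity>)"

text \<open>Vertex sets of the infinite components of \<open>G\<close> after removal of the subgraph \<open>F\<close>, that is,
  of its vertices and all edges incident to them. In a symmetric digraph the strongly connected
  components are the connected components.\<close>

definition infinite_components_off ::
    "('a, 'b) pre_digraph \<Rightarrow> ('a, 'b) pre_digraph \<Rightarrow> 'a set set" where
  "infinite_components_off G F =
     {C \<in> pre_digraph.sccs_verts (G \<restriction> (verts G - verts F)). infinite C}"

definition graph_ends :: "('a, 'b) pre_digraph \<Rightarrow> enat" where
  "graph_ends G =
     (SUP F \<in> {F. subgraph F G \<and> fin_digraph F}. ecard (infinite_components_off G F))"

text \<open>The number of ends does not depend on the chosen Cayley graph.\<close>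

definition group_ends :: "('a, 'b) monoid_scheme \<Rightarrow> enat" where
  "group_ends G = graph_ends (cayley_graph G (SOME S. generator_set G S))"

definition saw_count :: "('a, 'b) pre_digraph \<Rightarrow> 'a \<Rightarrow> nat \<Rightarrow> nat" where
  "saw_count G v n = card {p. vpath p G \<and> hd p = v \<and> vwalk_length p = n}"

definition connective_constant :: "('a, 'b) pre_digraph \<Rightarrow> 'a \<Rightarrow> real" where
  "connective_constant G v = lim (\<lambda>n. root n (real (saw_count G v n)))"

text \<open>Cayley graphs are vertex-transitive, so the base vertex is immaterial.\<close>

definition cayley_connective_constant :: "('a, 'b) monoid_scheme \<Rightarrow> 'a set \<Rightarrow> real" where
  "cayley_connective_constant G S = connective_constant (cayley_graph G S) \<one>\<^bsub>G\<^esub>"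

definition golden_mean :: real where
  "golden_mean = (1 + sqrt 5) / 2"

section \<open>Group presentations\<close>

text \<open>The letter \<open>(x, True)\<close> stands for the generator \<open>x\<close> and \<open>(x, False)\<close> for its formal
  inverse. The group \<open>\<langle>X | R\<rangle>\<close> consists of the words over \<open>X\<close> modulo insertion and
  deletion of pairs of inverse letters and of relators.\<close>

type_synonym 'g word = "('g \<times> bool) list"

definition words :: "'g set \<Rightarrow> 'g word set" where
  "words X = lists (X \<times> UNIV)"

definition word_inv :: "'g word \<Rightarrow> 'g word" where
  "word_inv w = rev (map (map_prod id Not) w)"

inductive pres_eq :: "'g set \<Rightarrow> 'g word set \<Rightarrow> 'g word \<Rightarrow> 'g word \<Rightarrow> bool"
  for X :: "'g set" and R :: "'g word set" where
  refl: "u \<in> words X \<Longrightarrow> pres_eq X R u u"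
| sym: "pres_eq X R u v \<Longrightarrow> pres_eq X R v u"
| trans: "pres_eq X R u v \<Longrightarrow> pres_eq X R v w \<Longrightarrow> pres_eq X R u w"
| cancel: "u \<in> words X \<Longrightarrow> v \<in> words X \<Longrightarrow> x \<in> X \<Longrightarrow>
    pres_eq X R (u @ [(x, b), (x, \<not> b)] @ v) (u @ v)"
| relator: "u \<in> words X \<Longrightarrow> v \<in> words X \<Longrightarrow> r \<in> R \<Longrightarrow> r \<in> words X \<Longrightarrow>
    pres_eq X R (u @ r @ v) (u @ v)"

definition pres_class :: "'g set \<Rightarrow> 'g word set \<Rightarrow> 'g word \<Rightarrow> 'g word set" where
  "pres_class X R u = {v. pres_eq X R u v}"

definition pres_group :: "'g set \<Rightarrow> 'g word set \<Rightarrow> 'g word set monoid" where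
  "pres_group X R =
     \<lparr> carrier = pres_class X R ` words X,
       monoid.mult = (\<lambda>A B. \<Union>u\<in>A. \<Union>v\<in>B. pres_class X R (u @ v)),
       one = pres_class X R [] \<rparr>"

section \<open>HNN extensions\<close>

text \<open>The base group is \<open>\<langle>X | R\<rangle>\<close>, and \<open>f\<close> is the given isomorphism between the finite
  subgroups \<open>C1\<close> and \<open>C2\<close>.\<close>

definition hnn_data ::
    "'g set \<Rightarrow> 'g word set \<Rightarrow> 'g word set set \<Rightarrow> 'g word set set
      \<Rightarrow> ('g word set \<Rightarrow> 'g word set) \<Rightarrow> bool" where
  "hnn_data X R C1 C2 f \<longleftrightarrow>
     finite X \<and> R \<subseteq> words X \<and>
     subgroup C1 (pres_group X R) \<and> finite C1 \<and>
     subgroup C2 (pres_group X R) \<and> finite C2 \<and>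
     f \<in> iso (pres_group X R\<lparr>carrier := C1\<rparr>) (pres_group X R\<lparr>carrier := C2\<rparr>)"

text \<open>The generator \<open>Some x\<close> is the old generator \<open>x\<close>, and \<open>None\<close> is the stable letter \<open>t\<close>.
  The new relators are \<open>t\<^sup>-\<^sup>1 u t v\<^sup>-\<^sup>1\<close> for words \<open>u\<close>, \<open>v\<close> representing some \<open>c \<in> C1\<close> and \<open>f c\<close>.\<close>

definition hnn_lift :: "'g word \<Rightarrow> 'g option word" where
  "hnn_lift w = map (map_prod Some id) w"

definition hnn_relators ::
    "'g set \<Rightarrow> 'g word set \<Rightarrow> 'g word set set \<Rightarrow> ('g word set \<Rightarrow> 'g word set)
      \<Rightarrow> 'g option word set" where
  "hnn_relators X R C1 f =
     hnn_lift ` R \<union>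
     {[(None, False)] @ hnn_lift u @ [(None, True)] @ word_inv (hnn_lift v) | u v.
        u \<in> words X \<and> v \<in> words X \<and> pres_class X R u \<in> C1 \<and>
        pres_class X R v = f (pres_class X R u)}"

definition hnn_group ::
    "'g set \<Rightarrow> 'g word set \<Rightarrow> 'g word set set \<Rightarrow> ('g word set \<Rightarrow> 'g word set)
      \<Rightarrow> 'g option word set monoid" where
  "hnn_group X R C1 f = pres_group (insert None (Some ` X)) (hnn_relators X R C1 f)"

section \<open>Amalgamated free products\<close>

definition amalgam_data ::
    "('h, 'p) monoid_scheme \<Rightarrow> ('k, 'q) monoid_scheme \<Rightarrow> ('c, 'r) monoid_scheme
      \<Rightarrow> ('c \<Rightarrow> 'h) \<Rightarrow> ('c \<Rightarrow> 'k) \<Rightarrow> bool" where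
  "amalgam_data H K C i j \<longleftrightarrow>
     group H \<and> group K \<and> group C \<and> finite (carrier C) \<and>
     i \<in> mon C H \<and> j \<in> mon C K \<and>
     i ` carrier C \<noteq> carrier H \<and> j ` carrier C \<noteq> carrier K"

text \<open>The free product of \<open>H\<close> and \<open>K\<close> is presented by their multiplication tables; the amalgam
  identifies the two images of \<open>C\<close> in it.\<close>

definition amalgam_gens ::
    "('h, 'p) monoid_scheme \<Rightarrow> ('k, 'q) monoid_scheme \<Rightarrow> ('h + 'k) set" where
  "amalgam_gens H K = Inl ` carrier H \<union> Inr ` carrier K"

definition amalgam_relators ::
    "('h, 'p) monoid_scheme \<Rightarrow> ('k, 'q) monoid_scheme \<Rightarrow> ('c, 'r) monoid_scheme
      \<Rightarrow> ('c \<Rightarrow> 'h) \<Rightarrow> ('c \<Rightarrow> 'k) \<Rightarrow> ('h + 'k) word set" where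
  "amalgam_relators H K C i j =
     {[(Inl a, True), (Inl b, True), (Inl (a \<otimes>\<^bsub>H\<^esub> b), False)] | a b.
        a \<in> carrier H \<and> b \<in> carrier H} \<union>
     {[(Inr a, True), (Inr b, True), (Inr (a \<otimes>\<^bsub>K\<^esub> b), False)] | a b.
        a \<in> carrier K \<and> b \<in> carrier K} \<union>
     {[(Inl (i c), True), (Inr (j c), False)] | c. c \<in> carrier C}"

definition amalgam ::
    "('h, 'p) monoid_scheme \<Rightarrow> ('k, 'q) monoid_scheme \<Rightarrow> ('c, 'r) monoid_scheme
      \<Rightarrow> ('c \<Rightarrow> 'h) \<Rightarrow> ('c \<Rightarrow> 'k) \<Rightarrow> ('h + 'k) word set monoid" where
  "amalgam H K C i j = pres_group (amalgam_gens H K) (amalgam_relators H K C i j)"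

text \<open>The union of the images of \<open>H\<close> and \<open>K\<close> in the amalgam.\<close>

definition amalgam_factors ::
    "('h, 'p) monoid_scheme \<Rightarrow> ('k, 'q) monoid_scheme \<Rightarrow> ('c, 'r) monoid_scheme
      \<Rightarrow> ('c \<Rightarrow> 'h) \<Rightarrow> ('c \<Rightarrow> 'k) \<Rightarrow> ('h + 'k) word set set" where
  "amalgam_factors H K C i j =
     (\<lambda>x. pres_class (amalgam_gens H K) (amalgam_relators H K C i j) [(x, True)]) `
       amalgam_gens H K"

end

theory Submission
  imports Defs "HOL-Library.Sublist" "HOL-Analysis.Convex"
begin

text \<open>For a generator set of size at least four, consider the walks whose every vertex lies in an
  infinite component of the complement of the earlier vertices. Along such a walk the unavailable
  continuations are at most as numerous as the unused ones: an edge back to the walk is the reverse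
  of an unused one, and a finite pocket cut off by the walk has, because finite sets have edge
  boundary at least \<open>card S\<close>, at least as many edges to earlier vertices as to the current one.
  Hence the product of the branching numbers along a walk of length \<open>n\<close> is of order at least
  \<open>(card S - 1)\<^bsup>n/2\<^esup>\<close>.

  For a generator set of size three, one exhibits a prefix code all of whose concatenations are
  self-avoiding and whose Kraft sum at the inverse golden mean is at least 1. In an HNN extension the
  exponent of the stable letter is a height, and the code is \<open>a, ba\<close> with \<open>a\<close> ascending and \<open>b\<close>
  horizontal. In an amalgam with letters \<open>x\<close> in \<open>K\<close> and \<open>p, q\<close> in \<open>H\<close> it consists of \<open>px\<close>, \<open>qx\<close> and either
  \<open>pq\<^sup>-\<^sup>1x\<close>, \<open>qp\<^sup>-\<^sup>1x\<close> or, if \<open>pq\<^sup>-\<^sup>1\<close> lies in \<open>C\<close>, \<open>pq\<^sup>-\<^sup>1px\<close>, \<open>qp\<^sup>-\<^sup>1qx\<close>; a third letter \<open>z\<close> in \<open>C\<close> is inserted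
  at will into \<open>px\<close>.\<close>

section \<open>Submultiplicative sequences\<close>

text \<open>For three generators the branching argument yields only \<open>sqrt 2\<close>, below the
  golden mean, so that size needs codes built from the structure of the group; for four or more it
  yields \<open>sqrt 3\<close>, above the golden mean. Parts (b) to (d) thus reduce to sets of
  exactly three generators. Size at most two is impossible: such a group is the union of a cyclic
  subgroup and one of its cosets, and has at most two ends. Branching numbers bound the count
  through a flow: choosing uniformly among the continuations gives each walk the reciprocal of its
  product as probability, and these sum to one. The exponent n/2 reflects the worst branching
  numbers between 1 and \<open>card S - 1\<close> with average \<open>card S / 2\<close>: half of
  them 1, half maximal. For a code, the weight of all k-fold concatenations is the k-th power of the
  Kraft sum, and some length carries a fair share of it. This controls the count at infinitely many
  lengths only; submultiplicativity supplies the limit and closes the gaps.\<close>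

lemma submultiplicative_root_convergent:
  fixes a :: "nat \<Rightarrow> real"
  assumes ge1: "\<And>n. a n \<ge> 1" and sub: "\<And>m n. a (m + n) \<le> a m * a n"
  shows "convergent (\<lambda>n. root n (a n))"
proof -
  define b where "b n = ln (a n)" for n
  have apos: "a n > 0" for n using ge1[of n] by linarith
  have b0: "b n \<ge> 0" for n using ge1[of n] by (simp add: b_def)
  have bsub: "b (m + n) \<le> b m + b n" for m n
    unfolding b_def using sub[of m n] apos[of m] apos[of n] apos[of "m+n"]
    by (metis ln_mult_pos ln_mono)
  \<comment> \<open>Fekete's argument: b n / n is compared with b m / m for one nearly optimal m by
    division with remainder, where the remainder costs only the bounded amount M.\<close>
  have bq: "b (q * m + r) \<le> real q * b m + b r" for q m r
  proof (induction q)
    case (Suc q)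
    have "b (Suc q * m + r) \<le> b m + b (q * m + r)"
      using bsub[of m "q * m + r"] by (simp add: algebra_simps)
    then show ?case using Suc by (simp add: algebra_simps)
  qed simp
  define L where "L = (INF n\<in>{1..}. b n / real n)"
  have bdd: "bdd_below ((\<lambda>n. b n / real n) ` {1..})"
    by (rule bdd_belowI[of _ 0]) (auto simp: b0)
  have "(\<lambda>n. b n / real n) \<longlonglongrightarrow> L"
  proof (rule LIMSEQ_I)
    fix e :: real assume e: "e > 0"
    have "L < L + e / 2" using e by simp
    then obtain m where m: "m \<ge> 1" "b m / real m < L + e / 2"
      unfolding L_def using cInf_lessD[of "(\<lambda>n. b n / real n) ` {1..}"] by fastforce
    define M where "M = (\<Sum>r<m. b r)"
    have M: "b r \<le> M" if "r < m" for r
      unfolding M_def using member_le_sum[of r "{..<m}" b] that b0 by auto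
    have M0: "M \<ge> 0" unfolding M_def by (simp add: sum_nonneg b0)
    obtain N :: nat where N: "real N > 2 * M / e" using reals_Archimedean2 by blast
    show "\<exists>no. \<forall>n\<ge>no. norm (b n / real n - L) < e"
    proof (intro exI allI impI)
      fix n assume n: "n \<ge> Suc N"
      then have n1: "n \<ge> 1" and npos: "real n > 0" by auto
      have "b n \<le> real (n div m) * b m + b (n mod m)"
        using bq[of "n div m" m "n mod m"] by simp
      also have "\<dots> \<le> real (n div m) * b m + M" using M[of "n mod m"] m by simp
      also have "real (n div m) * b m = real (n div m * m) * (b m / real m)" using m by simp
      also have "\<dots> \<le> real n * (b m / real m)"
        by (intro mult_right_mono) (simp_all add: b0 del: of_nat_mult)
      finally have "b n \<le> real n * (b m / real m) + M" by simp
      then have "b n / real n \<le> b m / real m + M / real n"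
        using npos by (simp add: field_simps)
      moreover have "M / real n < e / 2"
      proof -
        have "2 * M / e < real n" using N n by linarith
        then show ?thesis using e npos by (simp add: field_simps)
      qed
      moreover have "L \<le> b n / real n" unfolding L_def using n1 by (intro cINF_lower bdd) auto
      ultimately have "L \<le> b n / real n" "b n / real n < L + e" using m by linarith+
      then show "norm (b n / real n - L) < e" by (simp add: abs_if)
    qed
  qed
  then have "(\<lambda>n. exp (b n / real n)) \<longlonglongrightarrow> exp L" by (rule tendsto_exp)
  moreover have "\<forall>\<^sub>F n in sequentially. exp (b n / real n) = root n (a n)"
    using eventually_gt_at_top[of 0]
  proof eventually_elim
    case (elim n)
    then show ?case using apos[of n] by (simp add: b_def root_powr_inverse powr_def)
  qed
  ultimately have "(\<lambda>n. root n (a n)) \<longlonglongrightarrow> exp L" by (rule Lim_transform_eventually)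
  then show ?thesis by (rule convergentI)
qed

text \<open>\<open>lim\<close> is meaningful only for convergent sequences, so convergence comes
  first; then a bound at arbitrarily large n is enough. The factor C n absorbs losses by pigeonhole
  and vanishes under the n-th root.\<close>

lemma lim_root_submultiplicative_ge:
  fixes a :: "nat \<Rightarrow> nat" and l C :: real
  assumes sub: "\<And>m n. a (m + n) \<le> a m * a n" and l: "l > 0"
    and freq: "\<And>N. \<exists>n\<ge>N. l ^ n \<le> C * real n * real (a n)"
  shows "lim (\<lambda>n. root n (real (a n))) \<ge> l"
proof (rule ccontr)
  \<comment> \<open>A zero value would force zeros at all later indices by submultiplicativity,
    against \<open>freq\<close>.\<close>
  have pos: "a n \<ge> 1" for n
  proof (rule ccontr)
    assume "\<not> a n \<ge> 1"
    then have z: "a n = 0" by simp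
    obtain k where k: "k \<ge> n" "l ^ k \<le> C * real k * real (a k)" using freq by blast
    have "a k = 0" using sub[of n "k - n"] k z by simp
    then show False using k zero_less_power[OF l, of k] by simp
  qed
  let ?L = "lim (\<lambda>n. root n (real (a n)))"
  have "convergent (\<lambda>n. root n (real (a n)))"
  proof (rule submultiplicative_root_convergent)
    show "real (a n) \<ge> 1" for n using pos[of n] by simp
    show "real (a (m + n)) \<le> real (a m) * real (a n)" for m n
      using sub[of m n] by (metis of_nat_le_iff of_nat_mult)
  qed
  then have lim: "(\<lambda>n. root n (real (a n))) \<longlonglongrightarrow> ?L" by (simp add: convergent_LIMSEQ_iff)
  assume "\<not> ?L \<ge> l"
  then obtain r where r: "max ?L 0 < r" "r < l" using l dense[of "max ?L 0" l] by auto
  have "\<forall>\<^sub>F n in sequentially. root n (real (a n)) < r"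
    using lim r by (intro order_tendstoD) auto
  moreover have "(\<lambda>n. C * (real n * (r / l) ^ n)) \<longlonglongrightarrow> C * 0"
    by (intro tendsto_intros powser_times_n_limit_0) (use r l in auto)
  then have "\<forall>\<^sub>F n in sequentially. C * (real n * (r / l) ^ n) < 1"
    by (rule order_tendstoD) simp
  ultimately have "\<forall>\<^sub>F n in sequentially. C * real n * real (a n) < l ^ n"
    using eventually_gt_at_top[of 0]
  proof eventually_elim
    case (elim n)
    have C: "C > 0 \<or> C \<le> 0" by linarith
    have "real (a n) \<le> r ^ n"
      using elim r by (metis less_eq_real_def max_less_iff_conj of_nat_0_le_iff power_mono
          real_root_ge_zero real_root_pow_pos2)
    moreover have "C * real n * r ^ n < l ^ n"
      using elim l by (simp add: power_divide field_simps)
    ultimately show ?case using C l elim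
      by (smt (verit) mult_left_mono mult_nonneg_nonneg mult_nonpos_nonneg of_nat_0_le_iff zero_less_power)
  qed
  then obtain N where "\<And>n. n \<ge> N \<Longrightarrow> C * real n * real (a n) < l ^ n"
    by (auto simp: eventually_sequentially)
  then show False using freq[of N] by (meson not_le)
qed

section \<open>Self-avoiding walks as words\<close>

primrec wprod :: "('a, 'b) monoid_scheme \<Rightarrow> 'a list \<Rightarrow> 'a" where
  "wprod G [] = \<one>\<^bsub>G\<^esub>"
| "wprod G (s # w) = s \<otimes>\<^bsub>G\<^esub> wprod G w"

primrec walk_of :: "('a, 'b) monoid_scheme \<Rightarrow> 'a \<Rightarrow> 'a list \<Rightarrow> 'a list" where
  "walk_of G g [] = [g]"
| "walk_of G g (s # w) = g # walk_of G (g \<otimes>\<^bsub>G\<^esub> s) w"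

text \<open>Unfolded, no nonempty factor of the word multiplies to the identity. A repeated vertex
  of the walk delimits exactly such a factor, and in this form the base vertex has
  disappeared.\<close>

primrec saw_word :: "('a, 'b) monoid_scheme \<Rightarrow> 'a list \<Rightarrow> bool" where
  "saw_word G [] \<longleftrightarrow> True"
| "saw_word G (s # w) \<longleftrightarrow>
     (\<forall>u. prefix u w \<longrightarrow> s \<otimes>\<^bsub>G\<^esub> wprod G u \<noteq> \<one>\<^bsub>G\<^esub>) \<and> saw_word G w"

definition saw_words :: "('a, 'b) monoid_scheme \<Rightarrow> 'a set \<Rightarrow> nat \<Rightarrow> 'a list set" where
  "saw_words G S n = {w \<in> lists S. length w = n \<and> saw_word G w}"

lemma saw_word_append:
  "saw_word G (u @ v) \<Longrightarrow> saw_word G u \<and> saw_word G v"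
  by (induction u) auto

lemma finite_saw_words: "finite S \<Longrightarrow> finite (saw_words G S n)"
  by (rule finite_subset[OF _ finite_lists_length_eq[of S n]]) (auto simp: saw_words_def)

lemma card_saw_words_submultiplicative:
  assumes "finite S"
  shows "card (saw_words G S (m + n)) \<le> card (saw_words G S m) * card (saw_words G S n)"
proof -
  let ?f = "\<lambda>w. (take m w, drop m w)"
  have "card (saw_words G S (m + n)) \<le> card (saw_words G S m \<times> saw_words G S n)"
  proof (rule card_inj_on_le[of ?f])
    show "inj_on ?f (saw_words G S (m + n))"
      by (rule inj_onI) (metis append_take_drop_id prod.inject)
    have "saw_word G (take m w) \<and> saw_word G (drop m w)" if "saw_word G w" for w
      by (rule saw_word_append) (use that in simp)
    then show "?f ` saw_words G S (m + n) \<subseteq> saw_words G S m \<times> saw_words G S n"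
      by (auto simp: saw_words_def dest: in_set_takeD in_set_dropD)
  qed (simp add: assms finite_saw_words)
  then show ?thesis by (simp add: card_cartesian_product)
qed

lemma arcs_ends_cayley:
  "arcs_ends (cayley_graph G S) = {(x, x \<otimes>\<^bsub>G\<^esub> s) | x s. x \<in> carrier G \<and> s \<in> S}"
  by (auto simp: cayley_graph_def arcs_ends_def arc_to_ends_def)

lemma walk_of_nonempty [simp]: "walk_of G g w \<noteq> []"
  by (cases w) auto

lemma hd_walk_of [simp]: "hd (walk_of G g w) = g"
  by (cases w) auto

lemma length_walk_of [simp]: "length (walk_of G g w) = Suc (length w)"
  by (induction w arbitrary: g) auto

context group
begin

lemma wprod_closed [simp, intro]: "set w \<subseteq> carrier G \<Longrightarrow> wprod G w \<in> carrier G"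
  by (induction w) auto

lemma wprod_append:
  "set u \<subseteq> carrier G \<Longrightarrow> set v \<subseteq> carrier G \<Longrightarrow> wprod G (u @ v) = wprod G u \<otimes> wprod G v"
  by (induction u) (auto simp: m_assoc)

lemma set_walk_of:
  "g \<in> carrier G \<Longrightarrow> set w \<subseteq> carrier G \<Longrightarrow>
    set (walk_of G g w) = (\<lambda>u. g \<otimes> wprod G u) ` {u. prefix u w}"
proof (induction w arbitrary: g)
  case (Cons s w)
  have pre: "{u. prefix u (s # w)} = insert [] ((#) s ` {u. prefix u w})"
    by (auto simp: prefix_Cons)
  have "g \<otimes> s \<otimes> wprod G u = g \<otimes> wprod G (s # u)" if "prefix u w" for u
  proof -
    have "set u \<subseteq> carrier G" using set_mono_prefix[OF that] Cons.prems by auto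
    then show ?thesis using Cons.prems by (simp add: m_assoc)
  qed
  then have "(\<lambda>u. g \<otimes> s \<otimes> wprod G u) ` {u. prefix u w} = (\<lambda>u. g \<otimes> wprod G (s # u)) ` {u. prefix u w}"
    by (intro image_cong) auto
  then show ?case unfolding pre using Cons by (simp add: image_image)
qed simp

lemma distinct_walk_of:
  "g \<in> carrier G \<Longrightarrow> set w \<subseteq> carrier G \<Longrightarrow> distinct (walk_of G g w) \<longleftrightarrow> saw_word G w"
proof (induction w arbitrary: g)
  case (Cons s w)
  have "g \<notin> set (walk_of G (g \<otimes> s) w) \<longleftrightarrow> (\<forall>u. prefix u w \<longrightarrow> s \<otimes> wprod G u \<noteq> \<one>)"
  proof -
    have "g = g \<otimes> s \<otimes> wprod G u \<longleftrightarrow> s \<otimes> wprod G u = \<one>" if "prefix u w" for u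
    proof -
      have "set u \<subseteq> carrier G" using set_mono_prefix[OF that] Cons.prems by auto
      then show ?thesis using Cons.prems by (simp add: m_assoc l_cancel_one')
    qed
    then show ?thesis using Cons.prems by (auto simp: set_walk_of)
  qed
  then show ?case using Cons by simp
qed simp

lemma walk_of_inj:
  "g \<in> carrier G \<Longrightarrow> set v \<subseteq> carrier G \<Longrightarrow> set w \<subseteq> carrier G \<Longrightarrow>
    walk_of G g v = walk_of G g w \<Longrightarrow> v = w"
proof (induction v arbitrary: g w)
  case Nil
  then have "length [g] = length (walk_of G g w)" by (metis walk_of.simps(1))
  then show ?case by simp
next
  case (Cons s v)
  then obtain t w' where w: "w = t # w'" by (cases w) auto
  have eq: "walk_of G (g \<otimes> s) v = walk_of G (g \<otimes> t) w'" using Cons.prems w by simp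
  then have "g \<otimes> s = g \<otimes> t" by (metis hd_walk_of)
  then have st: "s = t" using Cons.prems w by simp
  have "v = w'" by (rule Cons.IH[of "g \<otimes> s"]) (use Cons.prems w st eq in auto)
  then show ?case using w st by simp
qed

lemma vwalk_walk_of:
  assumes "S \<subseteq> carrier G"
  shows "g \<in> carrier G \<Longrightarrow> w \<in> lists S \<Longrightarrow> vwalk (walk_of G g w) (cayley_graph G S)"
proof (induction w arbitrary: g)
  case Nil
  then show ?case by (simp add: vwalk_def cayley_graph_def)
next
  case (Cons s w)
  have "g \<otimes> s \<in> carrier G" using Cons.prems assms by auto
  then have "vwalk (walk_of G (g \<otimes> s) w) (cayley_graph G S)" using Cons by auto
  then show ?case
    using Cons.prems assms by (auto intro!: vwalk_consI simp: arcs_ends_cayley) (simp add: cayley_graph_def)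
qed

lemma vwalk_imp_walk_of:
  "vwalk p (cayley_graph G S) \<Longrightarrow> \<exists>w\<in>lists S. p = walk_of G (hd p) w"
proof (induction p rule: vwalk_induct)
  case (Base u)
  show ?case by (rule bexI[of _ "[]"]) auto
next
  case (Cons u v es)
  then obtain s w where "v = u \<otimes> s" "s \<in> S" "w \<in> lists S" "v # es = walk_of G v w"
    by (auto simp: arcs_ends_cayley)
  then show ?case by (intro bexI[of _ "s # w"]) auto
qed

text \<open>A walk in the simple graph determines its word, since the letter between consecutive
  vertices x and y must be \<open>inv x \<otimes> y\<close>. Counting paths becomes counting
  words.\<close>

lemma saw_count_cayley:
  assumes S: "S \<subseteq> carrier G" and g: "g \<in> carrier G"
  shows "saw_count (cayley_graph G S) g n = card (saw_words G S n)"
proof -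
  have "{p. vpath p (cayley_graph G S) \<and> hd p = g \<and> vwalk_length p = n}
      = walk_of G g ` saw_words G S n" (is "?A = ?B")
  proof
    show "?A \<subseteq> ?B"
    proof
      fix p assume "p \<in> ?A"
      then have p: "vwalk p (cayley_graph G S)" "distinct p" "hd p = g" "length p - 1 = n"
        by (auto simp: vpath_def)
      then obtain w where w: "w \<in> lists S" "p = walk_of G g w" using vwalk_imp_walk_of by blast
      have "set w \<subseteq> carrier G" using w S by auto
      then have "w \<in> saw_words G S n"
        using p w distinct_walk_of[OF g] by (auto simp: saw_words_def)
      then show "p \<in> ?B" using w by blast
    qed
    show "?B \<subseteq> ?A"
    proof
      fix p assume "p \<in> ?B"
      then obtain w where w: "w \<in> lists S" "length w = n" "saw_word G w" "p = walk_of G g w"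
        by (auto simp: saw_words_def)
      moreover have "set w \<subseteq> carrier G" using w S by auto
      ultimately show "p \<in> ?A"
        using distinct_walk_of[OF g] vwalk_walk_of[OF S g] by (auto simp: vpath_def)
    qed
  qed
  moreover have "inj_on (walk_of G g) (saw_words G S n)"
    by (rule inj_onI, rule walk_of_inj[OF g]) (use S in \<open>auto simp: saw_words_def\<close>)
  ultimately show ?thesis unfolding saw_count_def by (simp add: card_image)
qed

lemma connective_constant_geI:
  assumes S: "finite S" "S \<subseteq> carrier G" and l: "l > 0"
    and freq: "\<And>N. \<exists>n\<ge>N. l ^ n \<le> C * real n * real (card (saw_words G S n))"
  shows "cayley_connective_constant G S \<ge> l"
proof -
  have "lim (\<lambda>n. root n (real (card (saw_words G S n)))) \<ge> l"
    by (rule lim_root_submultiplicative_ge[OF _ l freq])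
      (rule card_saw_words_submultiplicative[OF S(1)])
  then show ?thesis
    using S by (simp add: cayley_connective_constant_def connective_constant_def saw_count_cayley)
qed

end

lemma (in group) generator_set_wprod:
  assumes S: "generator_set G S" and g: "g \<in> carrier G"
  shows "\<exists>w\<in>lists S. wprod G w = g"
proof -
  have S': "S \<subseteq> carrier G" "\<And>s. s \<in> S \<Longrightarrow> inv s \<in> S" using S by (auto simp: generator_set_def)
  have "g \<in> generate G S" using S g by (simp add: generator_set_def)
  then show ?thesis
  proof induction
    case one
    show ?case by (rule bexI[of _ "[]"]) auto
  next
    case (incl h)
    then show ?case using S' by (intro bexI[of _ "[h]"]) auto
  next
    case (inv h)
    then show ?case using S' by (intro bexI[of _ "[inv h]"]) auto
  next
    case (eng a b)
    then obtain u v where "u \<in> lists S" "v \<in> lists S" "wprod G u = a" "wprod G v = b" by blast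
    then show ?case using S' wprod_append[of u v] by (intro bexI[of _ "u @ v"]) auto
  qed
qed

section \<open>Growth of prefix codes\<close>

primrec code_words :: "'a list set \<Rightarrow> nat \<Rightarrow> 'a list set" where
  "code_words X 0 = {[]}"
| "code_words X (Suc k) = (\<lambda>(b, w). b @ w) ` (X \<times> code_words X k)"

definition prefix_code :: "'a list set \<Rightarrow> bool" where
  "prefix_code X \<longleftrightarrow> finite X \<and> [] \<notin> X \<and> (\<forall>b\<in>X. \<forall>c\<in>X. prefix b c \<longrightarrow> b = c)"

text \<open>Two blocks that begin the same word are comparable as prefixes, hence equal in a prefix
  code: concatenations parse uniquely.\<close>

lemma inj_on_code_append:
  assumes "prefix_code X"
  shows "inj_on (\<lambda>(b, w). b @ w) (X \<times> Y)"
proof (rule inj_onI, clarify)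
  fix b w c v assume h: "b \<in> X" "c \<in> X" "b @ w = c @ v"
  have "prefix b (b @ w)" "prefix c (c @ v)" by simp_all
  then have "prefix b (c @ v)" "prefix c (c @ v)" unfolding h(3) .
  then have "prefix b c \<or> prefix c b" using prefix_same_cases by blast
  then have "b = c" using assms h by (auto simp: prefix_code_def)
  then show "b = c \<and> w = v" using h by simp
qed

lemma finite_code_words: "prefix_code X \<Longrightarrow> finite (code_words X k)"
  by (induction k) (auto simp: prefix_code_def)

lemma code_words_lists:
  assumes "X \<subseteq> lists S"
  shows "w \<in> code_words X k \<Longrightarrow> w \<in> lists S"
proof (induction k arbitrary: w)
  case (Suc k)
  then obtain b v where w: "w = b @ v" "b \<in> X" "v \<in> code_words X k" by auto
  have "b \<in> lists S" using assms w(2) by (rule subsetD)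
  then show ?case using w Suc.IH[OF w(3)] by simp
qed simp

text \<open>Unique parsing makes the total weight multiplicative, so for k blocks it is the k-th
  power of the Kraft sum.\<close>

lemma code_words_weight:
  fixes z :: real
  assumes X: "prefix_code X" and z: "z \<ge> 0" and kraft: "(\<Sum>b\<in>X. z ^ length b) \<ge> 1"
  shows "(\<Sum>w\<in>code_words X k. z ^ length w) \<ge> 1"
proof (induction k)
  case (Suc k)
  have "(\<Sum>w\<in>code_words X (Suc k). z ^ length w)
      = (\<Sum>(b, w)\<in>X \<times> code_words X k. z ^ length b * z ^ length w)"
    by (subst code_words.simps, subst sum.reindex[OF inj_on_code_append[OF X]])
      (simp add: power_add case_prod_unfold)
  also have "\<dots> = (\<Sum>b\<in>X. z ^ length b) * (\<Sum>w\<in>code_words X k. z ^ length w)"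
    by (simp add: sum_product sum.cartesian_product)
  also have "\<dots> \<ge> 1 * 1" using kraft Suc by (intro mult_mono) auto
  finally show ?case by simp
qed simp

lemma code_words_length:
  assumes "prefix_code X" "\<And>b. b \<in> X \<Longrightarrow> length b \<le> L" "w \<in> code_words X k"
  shows "k \<le> length w \<and> length w \<le> L * k"
  using assms(3)
proof (induction k arbitrary: w)
  case (Suc k)
  then obtain b v where w: "w = b @ v" "b \<in> X" "v \<in> code_words X k" by auto
  have "length b \<ge> 1" using assms(1) w(2) by (cases b) (auto simp: prefix_code_def)
  moreover have "length b \<le> L" using assms(2) w(2) by blast
  moreover have "k \<le> length v" "length v \<le> L * k" using Suc.IH[OF w(3)] by auto
  ultimately show ?case using w(1) by simp
qed simp

text \<open>Pigeonhole over lengths: concatenations of k blocks have lengths between k and L k and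
  total weight at least one, so some length carries weight at least 1 / (L k).\<close>

lemma (in group) connective_constant_ge_code:
  assumes S: "finite S" "S \<subseteq> carrier G" and l: "l > 0"
    and X: "prefix_code X" "X \<subseteq> lists S"
    and kraft: "(\<Sum>b\<in>X. (1 / l) ^ length b) \<ge> 1"
    and saw: "\<And>k w. w \<in> code_words X k \<Longrightarrow> saw_word G w"
  shows "cayley_connective_constant G S \<ge> l"
proof -
  define L where "L = Max (length ` X)"
  have finX: "finite X" using X(1) by (simp add: prefix_code_def)
  have L: "length b \<le> L" if "b \<in> X" for b unfolding L_def using finX that by simp
  note lists = code_words_lists[OF X(2)]
  have "\<exists>n\<ge>N. l ^ n \<le> real L * real n * real (card (saw_words G S n))" for N
  proof -
    \<comment> \<open>A positive k puts the length to be found beyond N and leaves at most L k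
      lengths in \<open>{k..L * k}\<close>.\<close>
    define k where "k = Suc N"
    have len: "k \<le> length w \<and> length w \<le> L * k" if "w \<in> code_words X k" for w
      using code_words_length[OF X(1) L that] .
    let ?c = "\<lambda>n. card (saw_words G S n)"
    have "code_words X k \<noteq> {}"
      using code_words_weight[OF X(1) _ kraft, of k] l by auto
    then obtain w0 where "w0 \<in> code_words X k" by blast
    from len[OF this] have Lk: "k \<le> L * k" by linarith
    have "\<exists>n\<in>{k..L * k}. l ^ n \<le> real (L * k) * real (?c n)"
    proof (rule ccontr)
      assume neg: "\<not> ?thesis"
      have small: "real (?c n) * (1 / l) ^ n < 1 / real (L * k)" if "n \<in> {k..L * k}" for n
      proof -
        have "real (L * k) * real (?c n) < l ^ n" using neg that by force
        moreover have "real (L * k) > 0" using Lk k_def by (metis of_nat_0_less_iff less_le_trans zero_less_Suc)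
        ultimately show ?thesis using l by (simp add: power_one_over pos_less_divide_eq pos_divide_less_eq mult.commute)
      qed
      have "1 \<le> (\<Sum>w\<in>code_words X k. (1 / l) ^ length w)"
        using code_words_weight[OF X(1) _ kraft] l by simp
      also have "\<dots> = (\<Sum>n\<in>{k..L * k}. \<Sum>w\<in>{w \<in> code_words X k. length w = n}. (1 / l) ^ length w)"
        by (rule sum.group[symmetric]) (use finite_code_words[OF X(1)] len in auto)
      also have "\<dots> = (\<Sum>n\<in>{k..L * k}. real (card {w \<in> code_words X k. length w = n}) * (1 / l) ^ n)"
      proof (rule sum.cong[OF HOL.refl])
        fix n
        have "(\<Sum>w\<in>{w \<in> code_words X k. length w = n}. (1 / l) ^ length w)
            = (\<Sum>w\<in>{w \<in> code_words X k. length w = n}. (1 / l) ^ n)"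
          by (intro sum.cong) auto
        then show "(\<Sum>w\<in>{w \<in> code_words X k. length w = n}. (1 / l) ^ length w)
            = real (card {w \<in> code_words X k. length w = n}) * (1 / l) ^ n" by simp
      qed
      also have "\<dots> \<le> (\<Sum>n\<in>{k..L * k}. real (?c n) * (1 / l) ^ n)"
      proof (intro sum_mono mult_right_mono)
        fix n show "real (card {w \<in> code_words X k. length w = n}) \<le> real (?c n)"
          using lists saw finite_saw_words[OF S(1)]
          by (intro of_nat_mono card_mono) (auto simp: saw_words_def)
      qed (use l in simp)
      also have "\<dots> < (\<Sum>n\<in>{k..L * k}. 1 / real (L * k))"
        using small Lk by (intro sum_strict_mono) auto
      also have "\<dots> = real (card {k..L * k}) / real (L * k)"
        by (simp only: sum_constant times_divide_eq_right mult_1_right)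
      also have "\<dots> \<le> 1"
      proof -
        have "card {k..L * k} \<le> L * k" by (simp only: card_atLeastAtMost k_def)
        then have "real (card {k..L * k}) \<le> real (L * k)" by (rule of_nat_mono)
        then show ?thesis by (metis divide_le_eq_1 le_less of_nat_0_le_iff)
      qed
      finally show False by simp
    qed
    then obtain n where n: "n \<ge> k" "l ^ n \<le> real (L * k) * real (?c n)" by auto
    have "real (L * k) * real (?c n) \<le> real L * real n * real (?c n)"
      using n(1) by (intro mult_right_mono) (auto intro: mult_left_mono)
    then show ?thesis using n by (intro exI[of _ n]) (auto simp: k_def)
  qed
  then show ?thesis by (rule connective_constant_geI[OF S l])
qed

text \<open>The set \<open>Q\<close> over-approximates the values of the prefixes of concatenated blocks.\<close>

definition safe_block :: "('a, 'b) monoid_scheme \<Rightarrow> 'a set \<Rightarrow> 'a list \<Rightarrow> bool" where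
  "safe_block G Q b \<longleftrightarrow> saw_word G b \<and>
     (\<forall>v. suffix v b \<longrightarrow> v \<noteq> [] \<longrightarrow> (\<forall>g\<in>Q. wprod G v \<otimes>\<^bsub>G\<^esub> g \<noteq> \<one>\<^bsub>G\<^esub>)) \<and>
     (\<forall>v. prefix v b \<longrightarrow> wprod G v \<in> Q) \<and> (\<forall>g\<in>Q. wprod G b \<otimes>\<^bsub>G\<^esub> g \<in> Q)"

text \<open>A factor with value one would lie in the first block, or in the rest, or be a suffix of
  the block followed by a prefix of the rest. The value of that prefix is in \<open>Q\<close>, which
  is why prefix values are carried along in the induction.\<close>

lemma (in group) saw_code_words:
  assumes X: "X \<subseteq> lists (carrier G)" and safe: "\<And>b. b \<in> X \<Longrightarrow> safe_block G Q b"
    and Q: "\<one> \<in> Q"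
  shows "w \<in> code_words X k \<Longrightarrow> saw_word G w \<and> (\<forall>u. prefix u w \<longrightarrow> wprod G u \<in> Q)"
proof (induction k arbitrary: w)
  case 0
  then show ?case using Q by simp
next
  case (Suc k)
  then obtain b v where w: "w = b @ v" "b \<in> X" "v \<in> code_words X k" by auto
  have bcar: "set b \<subseteq> carrier G" using w X by auto
  have vcar: "set u \<subseteq> carrier G" if "prefix u v" for u
    using code_words_lists[OF X w(3)] set_mono_prefix[OF that] by auto
  note v = Suc.IH[OF w(3)] and b = safe[OF w(2), unfolded safe_block_def]
  have "saw_word G (c @ v)" if "suffix c b" for c
    using that
  proof (induction c)
    case Nil
    then show ?case using v by simp
  next
    case (Cons s c)
    have ccar: "set (s # c) \<subseteq> carrier G" using Cons.prems bcar set_mono_suffix by blast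
    have "saw_word G (s # c)"
      using b Cons.prems saw_word_append by (metis suffix_def)
    moreover have "s \<otimes> wprod G (c @ u) \<noteq> \<one>" if "prefix u v" for u
    proof -
      have "wprod G (s # c) \<otimes> wprod G u \<noteq> \<one>" using b v that Cons.prems by blast
      then show ?thesis using ccar vcar[OF that] by (simp add: wprod_append m_assoc)
    qed
    moreover have "saw_word G (c @ v)" using Cons.IH[OF suffix_ConsD[OF Cons.prems]] .
    ultimately have "s \<otimes> wprod G u \<noteq> \<one>" if "prefix u (c @ v)" for u
      using that unfolding prefix_append saw_word.simps by blast
    with \<open>saw_word G (c @ v)\<close> show ?case by simp
  qed
  then have "saw_word G w" using w(1) by simp
  moreover have "wprod G u \<in> Q" if "prefix u w" for u
  proof -
    have "prefix u b \<or> (\<exists>u'. u = b @ u' \<and> prefix u' v)"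
      using that unfolding w(1) prefix_append .
    then consider "prefix u b" | u' where "u = b @ u'" "prefix u' v" by blast
    then show ?thesis
    proof cases
      case (2 u')
      have "wprod G b \<otimes> wprod G u' \<in> Q" using b v 2 by blast
      then show ?thesis using 2 bcar vcar by (simp add: wprod_append)
    qed (use b in blast)
  qed
  ultimately show ?case by blast
qed

section \<open>Kraft sums at the inverse golden mean\<close>

lemma golden_mean_bounds: "golden_mean > 8 / 5" "golden_mean < sqrt 3" "golden_mean\<^sup>2 = golden_mean + 1"
proof -
  have "sqrt 5 > 11 / 5" by (rule real_less_rsqrt) (simp add: power2_eq_square)
  then show "golden_mean > 8 / 5" by (simp add: golden_mean_def)
  show sq: "golden_mean\<^sup>2 = golden_mean + 1"
    by (simp add: golden_mean_def power2_eq_square field_simps)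
  have "sqrt 5 < 12 / 5" by (rule real_less_lsqrt) (simp_all add: power2_eq_square)
  then show "golden_mean < sqrt 3"
    by (intro real_less_rsqrt) (simp add: sq, simp add: golden_mean_def)
qed

text \<open>The sums belong, in order, to the code of the HNN case, to the two codes with letters p
  and q outside the amalgamated subgroup, and to the code with a letter inside it.\<close>

lemma golden_mean_kraft:
  defines "z \<equiv> 1 / golden_mean"
  shows "z + z\<^sup>2 = 1" and "2 * z\<^sup>2 + 2 * z ^ 3 \<ge> 1" and "2 * z\<^sup>2 + 2 * z ^ 4 \<ge> 1"
    and "z\<^sup>2 + 2 * z ^ 3 + z ^ 4 = 1"
proof -
  have g: "golden_mean > 8 / 5" "golden_mean\<^sup>2 = golden_mean + 1" using golden_mean_bounds by auto
  then show 1: "z + z\<^sup>2 = 1" by (simp add: z_def field_simps power2_eq_square)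
  \<comment> \<open>The relation z^2 = 1 - z turns the three remaining sums into 2 z, 6 - 8 z and 1,
    so exactly these two bounds are wanted; the upper one is where
    \<open>golden_mean > 8 / 5\<close> enters.\<close>
  have z: "z < 5 / 8" "z \<ge> 1 / 2"
    using g golden_mean_bounds(2) real_sqrt_less_mono[of 3 4] by (auto simp: z_def field_simps)
  have z2: "z\<^sup>2 = 1 - z" using 1 by simp
  have "z ^ 3 = z - z\<^sup>2"
    by (metis mult.commute mult.right_neutral power3_eq_cube power2_eq_square right_diff_distrib z2)
  then have z3: "z ^ 3 = 2 * z - 1" using z2 by simp
  have "z ^ 4 = (1 - z)\<^sup>2" by (simp flip: z2)
  then have z4: "z ^ 4 = 2 - 3 * z" using z2 by (simp add: power2_diff)
  show "2 * z\<^sup>2 + 2 * z ^ 3 \<ge> 1" "2 * z\<^sup>2 + 2 * z ^ 4 \<ge> 1" "z\<^sup>2 + 2 * z ^ 3 + z ^ 4 = 1"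
    using z by (simp_all add: z2 z3 z4)
qed

lemma (in group) connective_constant_ge_golden_code:
  assumes S: "finite S" "S \<subseteq> carrier G" and X: "prefix_code X" "X \<subseteq> lists S"
    and kraft: "(\<Sum>b\<in>X. (1 / golden_mean) ^ length b) \<ge> 1"
    and safe: "\<And>b. b \<in> X \<Longrightarrow> safe_block G Q b" and Q: "\<one> \<in> Q"
  shows "cayley_connective_constant G S \<ge> golden_mean"
proof (rule connective_constant_ge_code[OF S _ X kraft])
  have "X \<subseteq> lists (carrier G)" using X S by auto
  then show "saw_word G w" if "w \<in> code_words X k" for k w
    using saw_code_words[OF _ safe Q that] by blast
qed (use golden_mean_bounds(1) in linarith)

section \<open>Alternating products\<close>

inductive alt_prod :: "('a, 'b) monoid_scheme \<Rightarrow> 'a set \<Rightarrow> 'a set \<Rightarrow> 'a \<Rightarrow> bool" for G where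
  single: "g \<in> A - B \<Longrightarrow> alt_prod G A B g"
| cons: "g \<in> A - B \<Longrightarrow> alt_prod G B A h \<Longrightarrow> alt_prod G A B (g \<otimes>\<^bsub>G\<^esub> h)"

text \<open>The normal form theorem for amalgams, cut down to what the codes need: an alternating
  product never falls into the common subgroup. The assumptions are symmetric, so results transfer
  by \<open>swap\<close>.\<close>

locale reduced_pair = group +
  fixes A B
  assumes subA: "subgroup A G" and subB: "subgroup B G"
    and alt_AB: "alt_prod G A B g \<Longrightarrow> g \<notin> A \<inter> B"
    and alt_BA: "alt_prod G B A g \<Longrightarrow> g \<notin> A \<inter> B"

lemma (in reduced_pair) swap: "reduced_pair G B A"
  using is_group subA subB alt_AB alt_BA
  by (auto intro!: reduced_pair.intro reduced_pair_axioms.intro simp: Int_commute)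

context reduced_pair
begin

lemma carA: "g \<in> A \<Longrightarrow> g \<in> carrier G" and carB: "g \<in> B \<Longrightarrow> g \<in> carrier G"
  using subA subB by (auto dest: subgroup.mem_carrier)

lemma AB_mult:
  "g \<in> A \<Longrightarrow> h \<in> A \<Longrightarrow> g \<otimes> h \<in> A" "g \<in> B \<Longrightarrow> h \<in> B \<Longrightarrow> g \<otimes> h \<in> B"
  "g \<in> A \<Longrightarrow> inv g \<in> A" "g \<in> B \<Longrightarrow> inv g \<in> B" "\<one> \<in> A" "\<one> \<in> B"
  using subA subB by (auto intro: subgroup.m_closed subgroup.m_inv_closed subgroup.one_closed)

lemma diff_mult:
  assumes "d \<in> A \<inter> B" "g \<in> A - B"
  shows "d \<otimes> g \<in> A - B" "g \<otimes> d \<in> A - B" "inv g \<in> A - B"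
proof -
  have c: "d \<in> carrier G" "g \<in> carrier G" using assms carA by auto
  have "inv d \<otimes> (d \<otimes> g) = g" "g \<otimes> d \<otimes> inv d = g" "inv (inv g) = g"
    using c by (simp_all add: m_assoc inv_solve_left')
  then show "d \<otimes> g \<in> A - B" "g \<otimes> d \<in> A - B" "inv g \<in> A - B"
    using assms AB_mult by (metis Diff_iff IntD1 IntD2)+
qed

lemma alt_prod_closed: "alt_prod G C D g \<Longrightarrow> C \<subseteq> carrier G \<Longrightarrow> D \<subseteq> carrier G \<Longrightarrow> g \<in> carrier G"
  by (induction rule: alt_prod.induct) auto

lemma alt_AB_absorb:
  assumes "alt_prod G A B g" "d \<in> A \<inter> B"
  shows "alt_prod G A B (d \<otimes> g)"
  using assms(1)
proof cases
  case single
  then show ?thesis using diff_mult assms by (auto intro: alt_prod.single)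
next
  case (cons a h)
  have "h \<in> carrier G"
    using alt_prod_closed[OF cons(3)] carA carB by blast
  then have "d \<otimes> g = d \<otimes> a \<otimes> h" using cons assms carA by (simp add: m_assoc)
  then show ?thesis using cons diff_mult assms by (auto intro: alt_prod.cons)
qed

lemma alt_AB_not_one: "alt_prod G A B g \<Longrightarrow> g \<noteq> \<one>"
  using alt_AB AB_mult by blast

end

context reduced_pair
begin

lemma alt_BA_absorb: "alt_prod G B A g \<Longrightarrow> d \<in> A \<inter> B \<Longrightarrow> alt_prod G B A (d \<otimes> g)"
  and alt_BA_not_one: "alt_prod G B A g \<Longrightarrow> g \<noteq> \<one>"
  and diff_mult': "d \<in> A \<inter> B \<Longrightarrow> g \<in> B - A \<Longrightarrow> d \<otimes> g \<in> B - A"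
    "d \<in> A \<inter> B \<Longrightarrow> g \<in> B - A \<Longrightarrow> g \<otimes> d \<in> B - A"
  using reduced_pair.alt_AB_absorb[OF swap]
    reduced_pair.alt_AB_not_one[OF swap] reduced_pair.diff_mult[OF swap]
  by (simp_all add: Int_commute)

text \<open>This is the set \<open>Q\<close> for \<open>safe_block\<close>. All blocks end with x,
  and what follows is judged together with that x: its first letters may form an incomplete syllable
  lying in the intersection, but x times it is still alternating.\<close>

definition continuations :: "'a \<Rightarrow> 'a set" where
  "continuations x = {g \<in> carrier G. alt_prod G B A (x \<otimes> g)}"

lemma one_continuations: "x \<in> B - A \<Longrightarrow> \<one> \<in> continuations x"
  unfolding continuations_def using carB by (auto intro: alt_prod.single)

lemmas alt_intros = alt_prod.single alt_prod.cons

section \<open>Safe blocks made of one syllable in A followed by x\<close>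

lemma safe_block_2:
  assumes x: "x \<in> B - A" and p: "p \<in> A - B"
  shows "safe_block G (continuations x) [p, x]"
proof -
  have c: "x \<in> carrier G" "p \<in> carrier G" using x p carA carB by auto
  have "p \<otimes> x \<noteq> \<one>" "p \<noteq> \<one>" "x \<noteq> \<one>"
    using alt_AB_not_one[OF alt_prod.cons[OF p alt_prod.single[OF x]]]
      alt_AB_not_one[OF alt_prod.single[OF p]] alt_BA_not_one[OF alt_prod.single[OF x]] by auto
  moreover have "p \<otimes> (x \<otimes> g) \<noteq> \<one>" "x \<otimes> g \<noteq> \<one>" "alt_prod G B A (x \<otimes> (p \<otimes> (x \<otimes> g)))"
    if "g \<in> continuations x" for g
  proof -
    have a: "alt_prod G B A (x \<otimes> g)" using that by (simp add: continuations_def)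
    then have b: "alt_prod G A B (p \<otimes> (x \<otimes> g))" using p by (auto intro: alt_intros)
    show "x \<otimes> g \<noteq> \<one>" by (rule alt_BA_not_one[OF a])
    show "p \<otimes> (x \<otimes> g) \<noteq> \<one>" by (rule alt_AB_not_one[OF b])
    show "alt_prod G B A (x \<otimes> (p \<otimes> (x \<otimes> g)))" using x b by (auto intro: alt_intros)
  qed
  moreover have "alt_prod G B A x" "alt_prod G B A (x \<otimes> p)" "alt_prod G B A (x \<otimes> (p \<otimes> x))"
    using alt_prod.single[OF x] alt_prod.cons[OF x alt_prod.single[OF p]]
      alt_prod.cons[OF x alt_prod.cons[OF p alt_prod.single[OF x]]] by auto
  ultimately show ?thesis using c
    by (auto simp: safe_block_def suffix_Cons prefix_Cons continuations_def m_assoc)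
qed

text \<open>The letters p and r together form one syllable in \<open>A - B\<close>. Either of them
  alone may lie in the intersection, hence the separate hypotheses on \<open>x \<otimes> p\<close>
  and on r in front of an alternating product.\<close>

lemma safe_block_3:
  assumes x: "x \<in> B - A" and pr: "p \<in> carrier G" "r \<in> A" "p \<noteq> \<one>" "r \<noteq> \<one>"
    and t: "p \<otimes> r \<in> A - B" and alt: "alt_prod G B A (x \<otimes> p)"
    and r: "\<And>g. alt_prod G B A g \<Longrightarrow> r \<otimes> g \<noteq> \<one>"
  shows "safe_block G (continuations x) [p, r, x]"
proof -
  have c: "x \<in> carrier G" "r \<in> carrier G" using x pr carA carB by auto
  have "x \<noteq> \<one>" "p \<otimes> r \<noteq> \<one>" using x t AB_mult by auto
  moreover have "p \<otimes> (r \<otimes> (x \<otimes> g)) \<noteq> \<one>" "r \<otimes> (x \<otimes> g) \<noteq> \<one>" "x \<otimes> g \<noteq> \<one>"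
    "alt_prod G B A (x \<otimes> (p \<otimes> (r \<otimes> (x \<otimes> g))))"
    if "g \<in> continuations x" for g
  proof -
    have a: "alt_prod G B A (x \<otimes> g)" and gc: "g \<in> carrier G"
      using that by (simp_all add: continuations_def)
    then have "alt_prod G A B (p \<otimes> r \<otimes> (x \<otimes> g))" using t by (auto intro: alt_intros)
    then have b: "alt_prod G A B (p \<otimes> (r \<otimes> (x \<otimes> g)))" using c pr gc by (simp add: m_assoc)
    show "x \<otimes> g \<noteq> \<one>" by (rule alt_BA_not_one[OF a])
    show "r \<otimes> (x \<otimes> g) \<noteq> \<one>" by (rule r[OF a])
    show "p \<otimes> (r \<otimes> (x \<otimes> g)) \<noteq> \<one>" by (rule alt_AB_not_one[OF b])
    show "alt_prod G B A (x \<otimes> (p \<otimes> (r \<otimes> (x \<otimes> g))))" using x b by (auto intro: alt_intros)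
  qed
  note cont = this
  moreover have "alt_prod G B A x" "alt_prod G B A (x \<otimes> (p \<otimes> r))"
    using alt_prod.single[OF x] alt_prod.cons[OF x alt_prod.single[OF t]] by auto
  \<comment> \<open>Loops inside the block are the case where nothing follows it.\<close>
  moreover have "p \<otimes> (r \<otimes> x) \<noteq> \<one>" "r \<otimes> x \<noteq> \<one>" "alt_prod G B A (x \<otimes> (p \<otimes> (r \<otimes> x)))"
    using cont[OF one_continuations[OF x]] c by auto
  ultimately show ?thesis using c pr alt
    by (auto simp: safe_block_def suffix_Cons prefix_Cons continuations_def m_assoc)
qed

text \<open>The syllable is now a product of three letters. Its shorter factors might cancel or fall
  into the intersection, so each has a hypothesis of its own.\<close>

lemma safe_block_4:
  assumes x: "x \<in> B - A" and pr: "p \<in> A" "r \<in> A" "q \<in> A" "p \<noteq> \<one>" "r \<noteq> \<one>" "q \<noteq> \<one>"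
    and ne: "p \<otimes> r \<noteq> \<one>" "r \<otimes> q \<noteq> \<one>"
    and t: "p \<otimes> (r \<otimes> q) \<in> A - B"
    and alt: "alt_prod G B A (x \<otimes> p)" "alt_prod G B A (x \<otimes> (p \<otimes> r))"
    and r: "\<And>g. alt_prod G B A g \<Longrightarrow> q \<otimes> g \<noteq> \<one>" "\<And>g. alt_prod G B A g \<Longrightarrow> r \<otimes> q \<otimes> g \<noteq> \<one>"
  shows "safe_block G (continuations x) [p, r, q, x]"
proof -
  have c: "x \<in> carrier G" "r \<in> carrier G" "p \<in> carrier G" "q \<in> carrier G" using x pr carA carB by auto
  have "x \<noteq> \<one>" "p \<otimes> (r \<otimes> q) \<noteq> \<one>" using x t AB_mult by auto
  moreover have "p \<otimes> (r \<otimes> (q \<otimes> (x \<otimes> g))) \<noteq> \<one>" "r \<otimes> (q \<otimes> (x \<otimes> g)) \<noteq> \<one>" "q \<otimes> (x \<otimes> g) \<noteq> \<one>"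
    "x \<otimes> g \<noteq> \<one>" "alt_prod G B A (x \<otimes> (p \<otimes> (r \<otimes> (q \<otimes> (x \<otimes> g)))))"
    if "g \<in> continuations x" for g
  proof -
    have a: "alt_prod G B A (x \<otimes> g)" and gc: "g \<in> carrier G"
      using that by (simp_all add: continuations_def)
    then have "alt_prod G A B (p \<otimes> (r \<otimes> q) \<otimes> (x \<otimes> g))" using t by (auto intro: alt_intros)
    then have b: "alt_prod G A B (p \<otimes> (r \<otimes> (q \<otimes> (x \<otimes> g))))" using c pr gc by (simp add: m_assoc)
    show "x \<otimes> g \<noteq> \<one>" by (rule alt_BA_not_one[OF a])
    show "q \<otimes> (x \<otimes> g) \<noteq> \<one>" by (rule r(1)[OF a])
    show "r \<otimes> (q \<otimes> (x \<otimes> g)) \<noteq> \<one>" using r(2)[OF a] c gc by (simp add: m_assoc)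
    show "p \<otimes> (r \<otimes> (q \<otimes> (x \<otimes> g))) \<noteq> \<one>" by (rule alt_AB_not_one[OF b])
    show "alt_prod G B A (x \<otimes> (p \<otimes> (r \<otimes> (q \<otimes> (x \<otimes> g)))))" using x b by (auto intro: alt_intros)
  qed
  note cont = this
  moreover have "alt_prod G B A x" "alt_prod G B A (x \<otimes> (p \<otimes> (r \<otimes> q)))"
    using alt_prod.single[OF x] alt_prod.cons[OF x alt_prod.single[OF t]] by auto
  moreover have "p \<otimes> (r \<otimes> (q \<otimes> x)) \<noteq> \<one>" "r \<otimes> (q \<otimes> x) \<noteq> \<one>" "q \<otimes> x \<noteq> \<one>"
      "alt_prod G B A (x \<otimes> (p \<otimes> (r \<otimes> (q \<otimes> x))))"
    using cont[OF one_continuations[OF x]] c by auto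
  ultimately show ?thesis using c pr alt ne
    by (auto simp: safe_block_def suffix_Cons prefix_Cons continuations_def m_assoc)
qed

text \<open>The letter z is optional on either side of p, since it leaves the type of the syllable
  unchanged. With w the inverse golden mean, the Kraft sum is (w (1 + w))^2, which is exactly one
  because w + w^2 = 1.\<close>

lemma golden_central_letter:
  assumes p: "p \<in> A - B" and x: "x \<in> B - A" and z: "z \<in> A \<inter> B" "z \<noteq> \<one>"
    and S: "finite S" "S \<subseteq> carrier G" "{p, x, z} \<subseteq> S"
  shows "cayley_connective_constant G S \<ge> golden_mean"
proof -
  let ?X = "{[p, x], [p, z, x], [z, p, x], [z, p, z, x]}"
  have ne: "p \<noteq> x" "z \<noteq> x" "p \<noteq> z" "x \<noteq> z" "z \<noteq> p" using p x z by auto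
  have c: "x \<in> carrier G" "p \<in> carrier G" "z \<in> carrier G" using x p z carA carB by auto
  have p1: "p \<noteq> \<one>" using p AB_mult by auto
  have pz: "p \<otimes> z \<in> A - B" "z \<otimes> p \<in> A - B" using diff_mult p z by auto
  have zpz: "z \<otimes> (p \<otimes> z) \<in> A - B" using diff_mult pz z by auto
  have xz: "x \<otimes> z \<in> B - A" using diff_mult' x z by auto
  have xzp: "alt_prod G B A (x \<otimes> (z \<otimes> p))" using x pz by (auto intro: alt_intros)
  have zg: "z \<otimes> g \<noteq> \<one>" if "alt_prod G B A g" for g
    using alt_BA_not_one[OF alt_BA_absorb[OF that z(1)]] .
  have pg: "p \<otimes> g \<noteq> \<one>" if "alt_prod G B A g" for g
    using alt_AB_not_one alt_prod.cons[OF p that] .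
  have pzg: "p \<otimes> z \<otimes> g \<noteq> \<one>" if "alt_prod G B A g" for g
    using alt_AB_not_one alt_prod.cons[OF pz(1) that] .
  have "safe_block G (continuations x) [p, x]" by (rule safe_block_2[OF x p])
  moreover have "safe_block G (continuations x) [p, z, x]"
    using x p z c pz p1 zg by (intro safe_block_3) (auto intro: alt_intros)
  moreover have "safe_block G (continuations x) [z, p, x]"
    using x p z c pz p1 pg xz by (intro safe_block_3) (auto intro: alt_intros)
  moreover have "safe_block G (continuations x) [z, p, z, x]"
    using x p z c pz p1 pzg zg xz zpz xzp AB_mult(5,6)
    by (intro safe_block_4) (auto intro: alt_intros)
  ultimately have safe: "safe_block G (continuations x) b" if "b \<in> ?X" for b
    using that by auto
  have code: "prefix_code ?X" using ne by (auto simp: prefix_code_def)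
  have "(\<Sum>b\<in>?X. (1 / golden_mean) ^ length b)
      = (1 / golden_mean)\<^sup>2 + 2 * (1 / golden_mean) ^ 3 + (1 / golden_mean) ^ 4"
    using ne by (simp add: numeral_eq_Suc)
  then have "(\<Sum>b\<in>?X. (1 / golden_mean) ^ length b) \<ge> 1" using golden_mean_kraft(4) by simp
  from connective_constant_ge_golden_code[OF S(1,2) code _ this safe one_continuations[OF x]]
  show ?thesis using S(3) by auto
qed

lemma golden_letter_pair:
  assumes x: "x \<in> B - A" and pq: "p \<in> A - B" "q \<in> A - B" "p \<noteq> q"
    and inv: "inv p \<in> {p, q}" "inv q \<in> {p, q}"
    and S: "finite S" "S \<subseteq> carrier G" "{p, q, x} \<subseteq> S"
  shows "cayley_connective_constant G S \<ge> golden_mean"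
proof -
  have c: "x \<in> carrier G" "p \<in> carrier G" "q \<in> carrier G" using x pq carA carB by auto
  define r where "r = inv q"
  define s where "s = inv p"
  have rs: "r \<in> A - B" "s \<in> A - B" "r \<in> {p, q}" "s \<in> {p, q}" using inv pq r_def s_def by auto
  have rc: "r \<in> carrier G" "s \<in> carrier G" using r_def s_def c by auto
  \<comment> \<open>Either p and q are involutions, and then r = q and s = p, or they are inverse to
    each other, and then r = p and s = q.\<close>
  have rs_cases: "(r = p \<and> s = q) \<or> (r = q \<and> s = p)"
    using rs pq(3) c by (metis inv_inv insertE r_def s_def singletonD)
  have qs: "q \<otimes> s = inv (p \<otimes> r)" using c by (simp add: r_def s_def inv_mult_group)
  have pr1: "p \<otimes> r \<noteq> \<one>"
    using pq(3) c by (metis inv_equality inv_inv r_def rc(1))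
  have "1 \<le> (1 / golden_mean)\<^sup>2 * 2 + 2 * (1 / golden_mean) ^ 3"
    "1 \<le> (1 / golden_mean)\<^sup>2 * 2 + 2 * (1 / golden_mean) ^ 4"
    using golden_mean_kraft by (simp_all add: algebra_simps)
  note kraft = this
  have ne: "p \<noteq> x" "q \<noteq> x" "r \<noteq> x" "s \<noteq> x" using pq x rs by auto
  have one: "p \<noteq> \<one>" "q \<noteq> \<one>" "r \<noteq> \<one>" "s \<noteq> \<one>" using pq rs AB_mult by auto
  have car: "p \<in> A" "q \<in> A" "r \<in> A" "s \<in> A" using pq rs by auto
  have alt: "alt_prod G B A (x \<otimes> p)" "alt_prod G B A (x \<otimes> q)"
    using x pq by (auto intro: alt_intros)
  have app: "u \<otimes> g \<noteq> \<one>" if "u \<in> A - B" "alt_prod G B A g" for u g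
    using alt_AB_not_one alt_prod.cons[OF that] .
  have b2: "safe_block G (continuations x) [p, x]" "safe_block G (continuations x) [q, x]"
    using safe_block_2 x pq by auto
  have Xsub: "{p, q, r, s, x} \<subseteq> S" using S rs by auto
  show ?thesis
  proof (cases "p \<otimes> r \<in> B")
    case False
    then have t: "p \<otimes> r \<in> A - B" using car AB_mult by auto
    then have t': "q \<otimes> s \<in> A - B" using qs diff_mult(3)[of \<one>] AB_mult by auto
    let ?X = "{[p, x], [q, x], [p, r, x], [q, s, x]}"
    have "safe_block G (continuations x) [p, r, x]"
      using x c car one t alt app[OF rs(1)] by (intro safe_block_3) auto
    moreover have "safe_block G (continuations x) [q, s, x]"
      using x c car one t' alt app[OF rs(2)] by (intro safe_block_3) auto
    ultimately have safe: "safe_block G (continuations x) b" if "b \<in> ?X" for b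
      using that b2 by auto
    have code: "prefix_code ?X" using ne pq(3) by (auto simp: prefix_code_def)
    have "(\<Sum>b\<in>?X. (1 / golden_mean) ^ length b)
        = (1 / golden_mean)\<^sup>2 * 2 + 2 * (1 / golden_mean) ^ 3"
      using ne pq(3) by (simp add: numeral_eq_Suc)
    then have "(\<Sum>b\<in>?X. (1 / golden_mean) ^ length b) \<ge> 1" using kraft by simp
    from connective_constant_ge_golden_code[OF S(1,2) code _ this safe one_continuations[OF x]]
    show ?thesis using Xsub by auto
  next
    \<comment> \<open>Now \<open>p \<otimes> r\<close> is absorbed by the x after it, so the word p
      r x has a single syllable. A third letter restores a syllable in \<open>A - B\<close>, at the
      price of longer blocks.\<close>
    case True
    then have t: "p \<otimes> r \<in> A \<inter> B" using car AB_mult by auto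
    then have t': "q \<otimes> s \<in> A \<inter> B" using qs AB_mult by auto
    have qs1: "q \<otimes> s \<noteq> \<one>" using qs pr1 c rc by simp
    \<comment> \<open>By \<open>rs_cases\<close>, each of \<open>r \<otimes> p\<close> and
      \<open>s \<otimes> q\<close> equals \<open>p \<otimes> r\<close> or
      \<open>q \<otimes> s\<close>.\<close>
    have rp: "r \<otimes> p \<in> A \<inter> B" "r \<otimes> p \<noteq> \<one>" "s \<otimes> q \<in> A \<inter> B" "s \<otimes> q \<noteq> \<one>"
      using rs_cases t t' qs1 pr1 by auto
    let ?X = "{[p, x], [q, x], [p, r, p, x], [q, s, q, x]}"
    have prp: "p \<otimes> (r \<otimes> p) \<in> A - B" "q \<otimes> (s \<otimes> q) \<in> A - B" using rp diff_mult pq by auto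
    have alt': "alt_prod G B A (x \<otimes> (p \<otimes> r))" "alt_prod G B A (x \<otimes> (q \<otimes> s))"
      using diff_mult'(2)[OF t x] diff_mult'(2)[OF t' x] by (auto intro: alt_prod.single)
    have rpg: "r \<otimes> p \<otimes> g \<noteq> \<one>" "s \<otimes> q \<otimes> g \<noteq> \<one>" if "alt_prod G B A g" for g
      using alt_BA_not_one alt_BA_absorb[OF that] rp by auto
    have "safe_block G (continuations x) [p, r, p, x]"
      by (rule safe_block_4) (use x car one pr1 rp prp alt alt' app[OF pq(1)] rpg in auto)
    moreover have "safe_block G (continuations x) [q, s, q, x]"
      by (rule safe_block_4) (use x car one qs1 rp prp alt alt' app[OF pq(2)] rpg in auto)
    ultimately have safe: "safe_block G (continuations x) b" if "b \<in> ?X" for b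
      using that b2 by auto
    have code: "prefix_code ?X" using ne pq(3) by (auto simp: prefix_code_def)
    have "(\<Sum>b\<in>?X. (1 / golden_mean) ^ length b)
        = (1 / golden_mean)\<^sup>2 * 2 + 2 * (1 / golden_mean) ^ 4"
      using ne pq(3) by (simp add: numeral_eq_Suc)
    then have "(\<Sum>b\<in>?X. (1 / golden_mean) ^ length b) \<ge> 1" using kraft by simp
    from connective_constant_ge_golden_code[OF S(1,2) code _ this safe one_continuations[OF x]]
    show ?thesis using Xsub by auto
  qed
qed

lemma generator_set_not_subset:
  assumes "generator_set G S" "S \<subseteq> A" "B \<noteq> A \<inter> B"
  shows False
proof -
  have "carrier G \<subseteq> A"
    using assms generate_subgroup_incl[OF assms(2) subA] by (auto simp: generator_set_def)
  then show False using assms carB by auto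
qed

text \<open>If z is in B, it is a letter in the intersection. Otherwise y and z both lie in
  \<open>A - B\<close>, and their inverses stay in A, hence among y and z, as x is the only letter
  outside A.\<close>

lemma golden_pair:
  assumes S: "generator_set G S" "card S = 3" and x: "x \<in> S" "x \<in> B - A"
    and y: "y \<in> S" "y \<in> A - B" and z: "z \<in> A" "S = {x, y, z}"
  shows "cayley_connective_constant G S \<ge> golden_mean"
proof -
  have fin: "finite S" "S \<subseteq> carrier G" using S by (auto simp: generator_set_def)
  have z1: "z \<noteq> \<one>" using S z by (auto simp: generator_set_def)
  have yz: "y \<noteq> z" using S(2) z(2) by (auto simp: card_insert_if split: if_splits)
  have invS: "inv g \<in> S" if "g \<in> S" for g
    using S(1) that unfolding generator_set_def by blast
  show ?thesis
  proof (cases "z \<in> B")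
    case True
    then show ?thesis using golden_central_letter[OF y(2) x(2) _ z1 fin] z by auto
  next
    case False
    have "inv y \<in> A" "inv z \<in> A" using y z AB_mult by auto
    then have "inv y \<in> {y, z}" "inv z \<in> {y, z}" using invS z x by auto
    then show ?thesis
      using golden_letter_pair[OF x(2) y(2) _ yz _ _ fin] z False by auto
  qed
qed

text \<open>Letters from one factor alone generate a subgroup of that factor, which is proper; so
  both \<open>A - B\<close> and \<open>B - A\<close> contain a letter. The third one may be placed
  in A by symmetry.\<close>

lemma golden_reduced_pair:
  assumes S: "generator_set G S" "card S = 3" "S \<subseteq> A \<union> B" and AB: "A \<noteq> A \<inter> B" "B \<noteq> A \<inter> B"
  shows "cayley_connective_constant G S \<ge> golden_mean"
proof -
  obtain x where x: "x \<in> S" "x \<in> B - A"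
    using generator_set_not_subset[OF S(1)] S(3) AB by blast
  obtain y where y: "y \<in> S" "y \<in> A - B"
    using reduced_pair.generator_set_not_subset[OF swap S(1)] S(3) AB by blast
  have xy: "x \<noteq> y" using x y by auto
  have "card (S - {x, y}) = 1"
    using S(2) x y xy by (subst card_Diff_subset) auto
  then obtain z where z: "S - {x, y} = {z}" by (rule card_1_singletonE)
  then have Sz: "S = {x, y, z}" using x y by auto
  then have "z \<in> A \<or> z \<in> B" using S(3) by auto
  then show ?thesis
    using golden_pair[OF S(1,2) x y _ Sz]
      reduced_pair.golden_pair[OF swap S(1,2) y x, of z] Sz by (auto simp: insert_commute)
qed

end

section \<open>Presentations\<close>

lemma words_append [simp]: "u @ v \<in> words X \<longleftrightarrow> u \<in> words X \<and> v \<in> words X"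
  by (auto simp: words_def)

lemma words_Cons [simp]: "x # v \<in> words X \<longleftrightarrow> fst x \<in> X \<and> v \<in> words X"
  by (cases x) (auto simp: words_def)

lemma words_Nil [simp]: "[] \<in> words X"
  by (simp add: words_def)

lemma pres_eq_words: "pres_eq X R u v \<Longrightarrow> u \<in> words X \<and> v \<in> words X"
  by (induction rule: pres_eq.induct) auto

lemma pres_eq_append_left: "pres_eq X R u v \<Longrightarrow> w \<in> words X \<Longrightarrow> pres_eq X R (w @ u) (w @ v)"
proof (induction rule: pres_eq.induct)
  case (cancel u v x b)
  then show ?case using pres_eq.cancel[of "w @ u" X v x R b] by simp
next
  case (relator u v r)
  then show ?case using pres_eq.relator[of "w @ u" X v r R] by simp
qed (auto intro: pres_eq.intros)

lemma pres_eq_append_right: "pres_eq X R u v \<Longrightarrow> w \<in> words X \<Longrightarrow> pres_eq X R (u @ w) (v @ w)"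
proof (induction rule: pres_eq.induct)
  case (cancel u v x b)
  then show ?case using pres_eq.cancel[of u X "v @ w" x R b] by simp
next
  case (relator u v r)
  then show ?case using pres_eq.relator[of u X "v @ w" r R] by simp
qed (auto intro: pres_eq.intros)

lemma pres_eq_append:
  assumes "pres_eq X R u u'" "pres_eq X R v v'"
  shows "pres_eq X R (u @ v) (u' @ v')"
  using assms pres_eq_words[OF assms(1)] pres_eq_words[OF assms(2)]
  by (meson pres_eq.trans pres_eq_append_left pres_eq_append_right)

lemma pres_class_eq: "pres_eq X R u v \<Longrightarrow> pres_class X R u = pres_class X R v"
  unfolding pres_class_def by (rule Collect_cong) (metis pres_eq.sym pres_eq.trans)

lemma pres_class_eqD:
  "v \<in> words X \<Longrightarrow> pres_class X R u = pres_class X R v \<Longrightarrow> pres_eq X R u v"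
  unfolding pres_class_def using pres_eq.refl by fastforce

lemma pres_group_mult:
  assumes "u \<in> words X" "v \<in> words X"
  shows "pres_class X R u \<otimes>\<^bsub>pres_group X R\<^esub> pres_class X R v = pres_class X R (u @ v)"
proof -
  have "pres_class X R (a @ b) = pres_class X R (u @ v)"
    if "a \<in> pres_class X R u" "b \<in> pres_class X R v" for a b
    using that by (metis mem_Collect_eq pres_class_def pres_class_eq pres_eq_append)
  moreover have "u \<in> pres_class X R u" "v \<in> pres_class X R v"
    using assms by (auto simp: pres_class_def intro: pres_eq.refl)
  ultimately have "(\<Union>a\<in>pres_class X R u. \<Union>b\<in>pres_class X R v. pres_class X R (a @ b))
      = pres_class X R (u @ v)"
    by (intro UN_constant_eq[of u] UN_constant_eq[of v] ballI)
  then show ?thesis by (simp add: pres_group_def)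
qed

locale presented_group = group +
  fixes X :: "'g set" and R :: "'g word set" and \<psi> :: "'g word set \<Rightarrow> 'a"
  assumes iso: "\<psi> \<in> iso (pres_group X R) G"
begin

definition ev :: "'g word \<Rightarrow> 'a" where
  "ev w = \<psi> (pres_class X R w)"

lemma ev_closed: "w \<in> words X \<Longrightarrow> ev w \<in> carrier G"
  using iso by (auto simp: ev_def iso_def hom_def pres_group_def)

lemma ev_append: "u \<in> words X \<Longrightarrow> v \<in> words X \<Longrightarrow> ev (u @ v) = ev u \<otimes> ev v"
  unfolding ev_def using iso
  by (subst pres_group_mult[symmetric]) (auto simp: iso_def hom_def pres_group_def)

lemma ev_Nil: "ev [] = \<one>"
  using ev_append[of "[]" "[]"] ev_closed[of "[]"] by simp

lemma ev_Cons: "fst x \<in> X \<Longrightarrow> v \<in> words X \<Longrightarrow> ev (x # v) = ev [x] \<otimes> ev v"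
  using ev_append[of "[x]" v] by simp

lemma ev_eq: "pres_eq X R u v \<Longrightarrow> ev u = ev v"
  unfolding ev_def by (simp add: pres_class_eq)

lemma ev_eqD: "u \<in> words X \<Longrightarrow> v \<in> words X \<Longrightarrow> ev u = ev v \<Longrightarrow> pres_eq X R u v"
  unfolding ev_def using iso
  by (intro pres_class_eqD) (auto simp: iso_def bij_betw_def inj_on_def pres_group_def)

lemma ev_surj: "g \<in> carrier G \<Longrightarrow> \<exists>w\<in>words X. ev w = g"
  using iso unfolding iso_def bij_betw_def ev_def pres_group_def by force

lemma ev_inv:
  assumes "x \<in> X"
  shows "ev [(x, False)] = inv (ev [(x, True)])"
proof -
  have "pres_eq X R [(x, False), (x, True)] []"
    using pres_eq.cancel[of "[]" X "[]" x R False] assms by simp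
  then have "ev [(x, False)] \<otimes> ev [(x, True)] = \<one>"
    using ev_eq ev_Nil ev_append[of "[(x, False)]" "[(x, True)]"] assms by simp
  then show ?thesis using assms ev_closed by (metis inv_equality words_Cons words_Nil fst_conv)
qed

end

section \<open>The exponent of the stable letter\<close>

definition stable_exponent :: "'g option word \<Rightarrow> int" where
  "stable_exponent w = (\<Sum>(x, b)\<leftarrow>w. if x = None then (if b then 1 else - 1) else 0)"

lemma stable_exponent_append: "stable_exponent (u @ v) = stable_exponent u + stable_exponent v"
  by (simp add: stable_exponent_def)

lemma stable_exponent_lift: "stable_exponent (hnn_lift w) = 0"
  by (induction w) (auto simp: stable_exponent_def hnn_lift_def)

lemma stable_exponent_inv: "stable_exponent (word_inv w) = - stable_exponent w"
  by (induction w) (auto simp: stable_exponent_def word_inv_def)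

text \<open>Old relators do not contain the stable letter and a new one contains it once with each
  sign, so every relator has exponent sum zero.\<close>

lemma stable_exponent_pres_eq:
  "pres_eq X (hnn_relators X' R C1 f) u v \<Longrightarrow> stable_exponent u = stable_exponent v"
proof (induction rule: pres_eq.induct)
  case (cancel u v x b)
  show ?case unfolding stable_exponent_append by (simp add: stable_exponent_def)
next
  case (relator u v r)
  have "stable_exponent r = 0"
    using relator(3) unfolding hnn_relators_def
    by (auto simp: stable_exponent_append stable_exponent_lift stable_exponent_inv
        simp flip: append_Cons append_Nil) (auto simp: stable_exponent_append stable_exponent_lift stable_exponent_inv stable_exponent_def)
  then show ?case unfolding stable_exponent_append by simp
qed auto

lemma hnn_hom_int:
  assumes G: "group G" and iso: "hnn_group X R C1 f \<cong> G"
  obtains h :: "'a \<Rightarrow> int" and t where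
    "\<And>x y. x \<in> carrier G \<Longrightarrow> y \<in> carrier G \<Longrightarrow> h (x \<otimes>\<^bsub>G\<^esub> y) = h x + h y"
    and "t \<in> carrier G" "h t \<noteq> 0"
proof -
  let ?X = "insert None (Some ` X)" and ?R = "hnn_relators X R C1 f"
  obtain \<psi> where "\<psi> \<in> iso (pres_group ?X ?R) G"
    using iso by (auto simp: is_iso_def hnn_group_def)
  then interpret presented_group G ?X ?R \<psi>
    using G by (simp add: presented_group_def presented_group_axioms_def)
  \<comment> \<open>Any word for g will do: \<open>stable_exponent_pres_eq\<close> makes the value
    independent of the choice.\<close>
  define h where "h g = stable_exponent (SOME w. w \<in> words ?X \<and> ev w = g)" for g
  have h: "h (ev w) = stable_exponent w" if "w \<in> words ?X" for w
  proof -
    let ?w = "SOME v. v \<in> words ?X \<and> ev v = ev w"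
    have "?w \<in> words ?X \<and> ev ?w = ev w" by (rule someI[of _ w]) (use that in simp)
    then have "pres_eq ?X ?R ?w w" using ev_eqD that by blast
    then show ?thesis unfolding h_def by (rule stable_exponent_pres_eq)
  qed
  show ?thesis
  proof
    show "h (x \<otimes>\<^bsub>G\<^esub> y) = h x + h y" if xy: "x \<in> carrier G" "y \<in> carrier G" for x y
    proof -
      obtain u v where "u \<in> words ?X" "v \<in> words ?X" "ev u = x" "ev v = y"
        using ev_surj[OF xy(1)] ev_surj[OF xy(2)] by blast
      then show ?thesis
        using h[of u] h[of v] h[of "u @ v"] ev_append[of u v] stable_exponent_append[of u v] by simp
    qed
    show "ev [(None, True)] \<in> carrier G" by (rule ev_closed) simp
    show "h (ev [(None, True)]) \<noteq> 0" by (subst h) (simp_all add: stable_exponent_def)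
  qed
qed

section \<open>Reduced words in amalgamated products\<close>

text \<open>The predicate under \<open>SOME\<close> depends only on the right coset of h, so this
  chooses a transversal. The trivial coset gets the identity, so that elements of the image of C
  contribute no syllable.\<close>

definition coset_rep ::
    "('h, 'p) monoid_scheme \<Rightarrow> ('c, 'r) monoid_scheme \<Rightarrow> ('c \<Rightarrow> 'h) \<Rightarrow> 'h \<Rightarrow> 'h" where
  "coset_rep H C i h = (if h \<in> i ` carrier C then \<one>\<^bsub>H\<^esub>
     else SOME g. \<exists>c\<in>carrier C. g = i c \<otimes>\<^bsub>H\<^esub> h)"

definition coset_part ::
    "('h, 'p) monoid_scheme \<Rightarrow> ('c, 'r) monoid_scheme \<Rightarrow> ('c \<Rightarrow> 'h) \<Rightarrow> 'h \<Rightarrow> 'c" where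
  "coset_part H C i h = (SOME c. c \<in> carrier C \<and> i c \<otimes>\<^bsub>H\<^esub> coset_rep H C i h = h)"

definition nontrivial_reps ::
    "('h, 'p) monoid_scheme \<Rightarrow> ('c, 'r) monoid_scheme \<Rightarrow> ('c \<Rightarrow> 'h) \<Rightarrow> 'h set" where
  "nontrivial_reps H C i = coset_rep H C i ` (carrier H - i ` carrier C)"

locale embedded_group = H: group H + C: group C
  for H :: "('h, 'p) monoid_scheme" and C :: "('c, 'r) monoid_scheme" +
  fixes i :: "'c \<Rightarrow> 'h"
  assumes mon: "i \<in> mon C H"
begin

lemma i_closed [simp]: "c \<in> carrier C \<Longrightarrow> i c \<in> carrier H"
  and i_mult: "c \<in> carrier C \<Longrightarrow> d \<in> carrier C \<Longrightarrow> i (c \<otimes>\<^bsub>C\<^esub> d) = i c \<otimes>\<^bsub>H\<^esub> i d"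
  and i_inj: "c \<in> carrier C \<Longrightarrow> d \<in> carrier C \<Longrightarrow> i c = i d \<Longrightarrow> c = d"
  using mon by (auto simp: mon_def hom_def inj_on_def)

lemma i_one: "i \<one>\<^bsub>C\<^esub> = \<one>\<^bsub>H\<^esub>"
  using i_mult[of "\<one>\<^bsub>C\<^esub>" "\<one>\<^bsub>C\<^esub>"] i_closed[of "\<one>\<^bsub>C\<^esub>"] by simp

lemma i_inv: "c \<in> carrier C \<Longrightarrow> i (inv\<^bsub>C\<^esub> c) \<otimes>\<^bsub>H\<^esub> i c = \<one>\<^bsub>H\<^esub>"
  using i_mult[of "inv\<^bsub>C\<^esub> c" c] by (simp add: i_one)

lemma i_cancel: "c \<in> carrier C \<Longrightarrow> h \<in> carrier H \<Longrightarrow> i (inv\<^bsub>C\<^esub> c) \<otimes>\<^bsub>H\<^esub> (i c \<otimes>\<^bsub>H\<^esub> h) = h"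
  by (simp add: i_inv flip: H.m_assoc)

lemma image_mult_iff:
  assumes "c \<in> carrier C" "h \<in> carrier H"
  shows "i c \<otimes>\<^bsub>H\<^esub> h \<in> i ` carrier C \<longleftrightarrow> h \<in> i ` carrier C"
proof
  assume "i c \<otimes>\<^bsub>H\<^esub> h \<in> i ` carrier C"
  then obtain d where d: "d \<in> carrier C" "i c \<otimes>\<^bsub>H\<^esub> h = i d" by auto
  then have "h = i (inv\<^bsub>C\<^esub> c \<otimes>\<^bsub>C\<^esub> d)" using i_cancel[OF assms] assms by (simp add: i_mult)
  then show "h \<in> i ` carrier C" using assms d by auto
next
  assume "h \<in> i ` carrier C"
  then obtain d where "d \<in> carrier C" "h = i d" by auto
  then have "i c \<otimes>\<^bsub>H\<^esub> h = i (c \<otimes>\<^bsub>C\<^esub> d)" using assms by (simp add: i_mult)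
  then show "i c \<otimes>\<^bsub>H\<^esub> h \<in> i ` carrier C" using assms \<open>d \<in> carrier C\<close> by auto
qed

lemma image_mult_right_iff:
  assumes "c \<in> carrier C" "h \<in> carrier H" "h \<otimes>\<^bsub>H\<^esub> i c \<in> i ` carrier C"
  shows "h \<in> i ` carrier C"
proof -
  obtain d where d: "d \<in> carrier C" "h \<otimes>\<^bsub>H\<^esub> i c = i d" using assms by auto
  have "h = h \<otimes>\<^bsub>H\<^esub> i c \<otimes>\<^bsub>H\<^esub> i (inv\<^bsub>C\<^esub> c)"
    using assms i_mult[of c "inv\<^bsub>C\<^esub> c"] by (simp add: H.m_assoc i_one)
  then have "h = i (d \<otimes>\<^bsub>C\<^esub> inv\<^bsub>C\<^esub> c)" using d assms by (simp add: i_mult)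
  then show ?thesis using assms d by auto
qed

lemma coset_rep_shift:
  assumes "c \<in> carrier C" "h \<in> carrier H"
  shows "coset_rep H C i (i c \<otimes>\<^bsub>H\<^esub> h) = coset_rep H C i h"
proof -
  have "(\<exists>d\<in>carrier C. g = i d \<otimes>\<^bsub>H\<^esub> (i c \<otimes>\<^bsub>H\<^esub> h)) \<longleftrightarrow> (\<exists>d\<in>carrier C. g = i d \<otimes>\<^bsub>H\<^esub> h)" for g
  proof
    assume "\<exists>d\<in>carrier C. g = i d \<otimes>\<^bsub>H\<^esub> (i c \<otimes>\<^bsub>H\<^esub> h)"
    then obtain d where "d \<in> carrier C" "g = i d \<otimes>\<^bsub>H\<^esub> (i c \<otimes>\<^bsub>H\<^esub> h)" by blast
    then show "\<exists>d\<in>carrier C. g = i d \<otimes>\<^bsub>H\<^esub> h"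
      using assms by (intro bexI[of _ "d \<otimes>\<^bsub>C\<^esub> c"]) (auto simp: i_mult H.m_assoc)
  next
    assume "\<exists>d\<in>carrier C. g = i d \<otimes>\<^bsub>H\<^esub> h"
    then obtain d where "d \<in> carrier C" "g = i d \<otimes>\<^bsub>H\<^esub> h" by blast
    then show "\<exists>d\<in>carrier C. g = i d \<otimes>\<^bsub>H\<^esub> (i c \<otimes>\<^bsub>H\<^esub> h)"
      using assms i_cancel[OF assms]
      by (intro bexI[of _ "d \<otimes>\<^bsub>C\<^esub> inv\<^bsub>C\<^esub> c"]) (auto simp: i_mult H.m_assoc)
  qed
  then show ?thesis unfolding coset_rep_def using image_mult_iff[OF assms] by simp
qed

lemma coset_rep_mem:
  assumes "h \<in> carrier H"
  shows "\<exists>c\<in>carrier C. coset_rep H C i h = i c \<otimes>\<^bsub>H\<^esub> h"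
proof (cases "h \<in> i ` carrier C")
  case True
  then obtain c where "c \<in> carrier C" "h = i c" by blast
  then show ?thesis
    using i_inv True by (intro bexI[of _ "inv\<^bsub>C\<^esub> c"]) (auto simp: coset_rep_def)
next
  case False
  have "\<exists>g. \<exists>c\<in>carrier C. g = i c \<otimes>\<^bsub>H\<^esub> h" by blast
  then have "\<exists>c\<in>carrier C. (SOME g. \<exists>c\<in>carrier C. g = i c \<otimes>\<^bsub>H\<^esub> h) = i c \<otimes>\<^bsub>H\<^esub> h"
    by (rule someI_ex)
  then show ?thesis using False by (simp add: coset_rep_def)
qed

lemma coset_rep_closed: "h \<in> carrier H \<Longrightarrow> coset_rep H C i h \<in> carrier H"
  using coset_rep_mem by force

lemma coset_rep_idem: "h \<in> carrier H \<Longrightarrow> coset_rep H C i (coset_rep H C i h) = coset_rep H C i h"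
  using coset_rep_mem coset_rep_shift by metis

lemma coset_rep_image_iff:
  "h \<in> carrier H \<Longrightarrow> coset_rep H C i h \<in> i ` carrier C \<longleftrightarrow> h \<in> i ` carrier C"
  using coset_rep_mem image_mult_iff by metis

lemma coset_part:
  assumes "h \<in> carrier H"
  shows "coset_part H C i h \<in> carrier C" "i (coset_part H C i h) \<otimes>\<^bsub>H\<^esub> coset_rep H C i h = h"
proof -
  obtain c where "c \<in> carrier C" "coset_rep H C i h = i c \<otimes>\<^bsub>H\<^esub> h" using coset_rep_mem[OF assms] by blast
  then have "\<exists>c. c \<in> carrier C \<and> i c \<otimes>\<^bsub>H\<^esub> coset_rep H C i h = h"
    using i_cancel[OF _ assms] by (intro exI[of _ "inv\<^bsub>C\<^esub> c"]) simp
  from someI_ex[OF this] show "coset_part H C i h \<in> carrier C"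
      "i (coset_part H C i h) \<otimes>\<^bsub>H\<^esub> coset_rep H C i h = h"
    unfolding coset_part_def by auto
qed

lemma coset_part_unique:
  assumes "c \<in> carrier C" "h \<in> carrier H" "i c \<otimes>\<^bsub>H\<^esub> coset_rep H C i h = h"
  shows "coset_part H C i h = c"
proof -
  have "i (coset_part H C i h) = i c"
    using assms coset_part[OF assms(2)] coset_rep_closed[OF assms(2)]
    by (metis H.right_cancel i_closed)
  then show ?thesis using i_inj assms coset_part(1) by blast
qed

lemma coset_part_shift:
  assumes "c \<in> carrier C" "h \<in> carrier H"
  shows "coset_part H C i (i c \<otimes>\<^bsub>H\<^esub> h) = c \<otimes>\<^bsub>C\<^esub> coset_part H C i h"
  using assms coset_part[OF assms(2)] coset_rep_closed[OF assms(2)]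
  by (intro coset_part_unique) (simp_all add: coset_rep_shift i_mult H.m_assoc)

end

text \<open>A pair \<open>(c, zs)\<close> stands for the normal form \<open>c s\<^sub>1 \<dots> s\<^sub>n\<close>, where the \<open>s\<^sub>k\<close> tagged by \<open>\<tau>\<close> are coset
  representatives in \<open>H\<close>. Absorbing a leading \<open>H\<close>-syllable into \<open>c\<close> identifies these with pairs in
  \<open>H \<times> V0\<close>, on which \<open>H\<close> acts by left multiplication.\<close>

locale coset_action = embedded_group H C i
  for H :: "('h, 'p) monoid_scheme" and C :: "('c, 'r) monoid_scheme" and i :: "'c \<Rightarrow> 'h" +
  fixes \<tau> :: "'h \<Rightarrow> 'z" and V0 V :: "'z list set"
  assumes inj_tag: "inj \<tau>"
    and V: "V = V0 \<union> {\<tau> s # zs | s zs. s \<in> nontrivial_reps H C i \<and> zs \<in> V0}"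
    and V0: "\<tau> s # zs \<notin> V0"
begin

definition glue :: "'h \<times> 'z list \<Rightarrow> 'c \<times> 'z list" where
  "glue = (\<lambda>(h, zs). (coset_part H C i h,
     if h \<in> i ` carrier C then zs else \<tau> (coset_rep H C i h) # zs))"

text \<open>No list in \<open>V0\<close> begins with an H-syllable, so a leading one reveals that h
  is outside the image of C. Coset part and representative then recover h.\<close>

lemma inj_on_glue: "inj_on glue (carrier H \<times> V0)"
proof (rule inj_onI, clarify)
  fix h zs h' zs'
  assume h: "h \<in> carrier H" "zs \<in> V0" "h' \<in> carrier H" "zs' \<in> V0" and eq: "glue (h, zs) = glue (h', zs')"
  have part: "coset_part H C i h = coset_part H C i h'" using eq by (simp add: glue_def)
  have "(h \<in> i ` carrier C \<longleftrightarrow> h' \<in> i ` carrier C) \<and> zs = zs'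
      \<and> coset_rep H C i h = coset_rep H C i h'"
    using eq h V0 inj_tag by (auto simp: glue_def inj_def coset_rep_def split: if_splits)
  then show "h = h' \<and> zs = zs'" using part coset_part(2) h by metis
qed

lemma glue_image:
  assumes "c \<in> carrier C" "zs \<in> V0"
  shows "glue (i c, zs) = (c, zs)"
proof -
  have "coset_part H C i (i c) = c"
    using assms by (intro coset_part_unique) (auto simp: coset_rep_def)
  then show ?thesis using assms by (auto simp: glue_def)
qed

lemma bij_glue: "bij_betw glue (carrier H \<times> V0) (carrier C \<times> V)"
proof (rule bij_betw_imageI[OF inj_on_glue], rule equalityI)
  show "glue ` (carrier H \<times> V0) \<subseteq> carrier C \<times> V"
  proof (rule image_subsetI, clarify)
    fix h zs assume h: "h \<in> carrier H" "zs \<in> V0"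
    have "(if h \<in> i ` carrier C then zs else \<tau> (coset_rep H C i h) # zs) \<in> V"
      using h unfolding V nontrivial_reps_def by (auto intro!: exI[of _ "coset_rep H C i h"])
    then show "glue (h, zs) \<in> carrier C \<times> V" using coset_part(1)[OF h(1)] by (simp add: glue_def)
  qed
  show "carrier C \<times> V \<subseteq> glue ` (carrier H \<times> V0)"
  proof clarify
    fix c zs assume c: "c \<in> carrier C" and "zs \<in> V"
    then consider "zs \<in> V0" | s zs' where "zs = \<tau> s # zs'" "s \<in> nontrivial_reps H C i" "zs' \<in> V0"
      unfolding V by blast
    then show "(c, zs) \<in> glue ` (carrier H \<times> V0)"
    proof cases
      case 1
      then show ?thesis using glue_image[OF c] c by (intro image_eqI[of _ _ "(i c, zs)"]) auto
    next
      case (2 s zs')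
      then obtain h where h: "h \<in> carrier H" "h \<notin> i ` carrier C" "s = coset_rep H C i h"
        by (auto simp: nontrivial_reps_def)
      have s: "s \<in> carrier H" "s \<notin> i ` carrier C" "coset_rep H C i s = s"
        using h coset_rep_closed coset_rep_image_iff coset_rep_idem by auto
      have "coset_part H C i (i c \<otimes>\<^bsub>H\<^esub> s) = c"
        using c s by (intro coset_part_unique) (auto simp: coset_rep_shift)
      then have "glue (i c \<otimes>\<^bsub>H\<^esub> s, zs') = (c, zs)"
        using 2 c s image_mult_iff[OF c s(1)] by (auto simp: glue_def coset_rep_shift)
      then show ?thesis using c s 2 by (intro image_eqI[of _ _ "(i c \<otimes>\<^bsub>H\<^esub> s, zs')"]) auto
    qed
  qed
qed

definition unglue :: "'c \<times> 'z list \<Rightarrow> 'h \<times> 'z list" where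
  "unglue = inv_into (carrier H \<times> V0) glue"

definition act :: "'h \<Rightarrow> 'c \<times> 'z list \<Rightarrow> 'c \<times> 'z list" where
  "act a \<omega> = glue (a \<otimes>\<^bsub>H\<^esub> fst (unglue \<omega>), snd (unglue \<omega>))"

lemma unglue_glue: "h \<in> carrier H \<Longrightarrow> zs \<in> V0 \<Longrightarrow> unglue (glue (h, zs)) = (h, zs)"
  unfolding unglue_def using bij_glue by (simp add: bij_betw_def)

lemma glueE:
  assumes "\<omega> \<in> carrier C \<times> V"
  obtains h zs where "\<omega> = glue (h, zs)" "h \<in> carrier H" "zs \<in> V0"
proof -
  have "\<omega> \<in> glue ` (carrier H \<times> V0)" using assms bij_betw_imp_surj_on[OF bij_glue] by simp
  then obtain p where "p \<in> carrier H \<times> V0" "\<omega> = glue p" by blast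
  then show ?thesis using that[of "fst p" "snd p"] by (simp add: mem_Times_iff)
qed

lemma act_glue: "a \<in> carrier H \<Longrightarrow> h \<in> carrier H \<Longrightarrow> zs \<in> V0 \<Longrightarrow> act a (glue (h, zs)) = glue (a \<otimes>\<^bsub>H\<^esub> h, zs)"
  by (simp add: act_def unglue_glue)

lemma act_closed: "a \<in> carrier H \<Longrightarrow> \<omega> \<in> carrier C \<times> V \<Longrightarrow> act a \<omega> \<in> carrier C \<times> V"
proof (erule glueE)
  fix h zs assume h: "a \<in> carrier H" "\<omega> = glue (h, zs)" "h \<in> carrier H" "zs \<in> V0"
  then have "act a \<omega> \<in> glue ` (carrier H \<times> V0)" by (auto simp: act_glue)
  then show "act a \<omega> \<in> carrier C \<times> V" unfolding bij_betw_imp_surj_on[OF bij_glue] .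
qed

lemma act_mult:
  "a \<in> carrier H \<Longrightarrow> b \<in> carrier H \<Longrightarrow> \<omega> \<in> carrier C \<times> V \<Longrightarrow> act a (act b \<omega>) = act (a \<otimes>\<^bsub>H\<^esub> b) \<omega>"
  by (erule glueE) (simp add: act_glue H.m_assoc)

lemma act_one: "\<omega> \<in> carrier C \<times> V \<Longrightarrow> act \<one>\<^bsub>H\<^esub> \<omega> = \<omega>"
  by (erule glueE) (simp add: act_glue)

text \<open>The formula does not mention H. Hence the actions of the two factors of an amalgam agree
  on C, and the identifying relators act trivially.\<close>

lemma act_image:
  assumes "c \<in> carrier C" "\<omega> \<in> carrier C \<times> V"
  shows "act (i c) \<omega> = (c \<otimes>\<^bsub>C\<^esub> fst \<omega>, snd \<omega>)"
  using assms(2)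
proof (rule glueE)
  fix h zs assume h: "\<omega> = glue (h, zs)" "h \<in> carrier H" "zs \<in> V0"
  then have "act (i c) \<omega> = glue (i c \<otimes>\<^bsub>H\<^esub> h, zs)" using assms(1) act_glue by simp
  also have "\<dots> = (c \<otimes>\<^bsub>C\<^esub> fst (glue (h, zs)), snd (glue (h, zs)))"
    using assms(1) h by (simp add: glue_def image_mult_iff coset_part_shift coset_rep_shift)
  finally show ?thesis using h by simp
qed

text \<open>Multiplying on the right by an element of the image of C cannot bring a into that image,
  so a new syllable always appears.\<close>

lemma act_prepend:
  assumes "a \<in> carrier H" "a \<notin> i ` carrier C" "c \<in> carrier C" "zs \<in> V0"
  shows "\<exists>c' s. act a (c, zs) = (c', \<tau> s # zs)"
proof -
  have "act a (c, zs) = glue (a \<otimes>\<^bsub>H\<^esub> i c, zs)"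
    using assms glue_image[of c zs] act_glue[of a "i c" zs] by simp
  moreover have "a \<otimes>\<^bsub>H\<^esub> i c \<notin> i ` carrier C" using assms image_mult_right_iff by blast
  ultimately have "act a (c, zs) = (coset_part H C i (a \<otimes>\<^bsub>H\<^esub> i c), \<tau> (coset_rep H C i (a \<otimes>\<^bsub>H\<^esub> i c)) # zs)"
    by (simp add: glue_def)
  then show ?thesis by blast
qed

end

section \<open>Action of an amalgam on its normal forms\<close>

locale amalgam_setup =
  fixes H :: "('h, 'p) monoid_scheme" and K :: "('k, 'q) monoid_scheme"
    and C :: "('c, 'r) monoid_scheme" and i :: "'c \<Rightarrow> 'h" and j :: "'c \<Rightarrow> 'k"
  assumes data: "amalgam_data H K C i j"
begin

sublocale EH: embedded_group H C i
  using data by (simp add: amalgam_data_def embedded_group_def embedded_group_axioms_def)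

sublocale EK: embedded_group K C j
  using data by (simp add: amalgam_data_def embedded_group_def embedded_group_axioms_def)

primrec normal :: "('h + 'k) list \<Rightarrow> bool" where
  "normal [] \<longleftrightarrow> True"
| "normal (z # zs) \<longleftrightarrow> z \<in> Inl ` nontrivial_reps H C i \<union> Inr ` nontrivial_reps K C j \<and>
     (zs = [] \<or> isl (hd zs) \<noteq> isl z) \<and> normal zs"

text \<open>One set of normal forms is split in two ways, by whether the first syllable comes from H
  and, below, by whether it comes from K. Both factors thereby act on the same set.\<close>

sublocale AH: coset_action H C i Inl "{zs. normal zs \<and> (zs = [] \<or> \<not> isl (hd zs))}" "{zs. normal zs}"
proof
  show "{zs. normal zs} = {zs. normal zs \<and> (zs = [] \<or> \<not> isl (hd zs))} \<union>
      {Inl s # zs | s zs. s \<in> nontrivial_reps H C i \<and> zs \<in> {zs. normal zs \<and> (zs = [] \<or> \<not> isl (hd zs))}}"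
    (is "?l = ?r")
  proof (rule Set.set_eqI)
    show "zs \<in> ?l \<longleftrightarrow> zs \<in> ?r" for zs by (cases zs) auto
  qed
qed auto

sublocale AK: coset_action K C j Inr "{zs. normal zs \<and> (zs = [] \<or> isl (hd zs))}" "{zs. normal zs}"
proof
  show "{zs. normal zs} = {zs. normal zs \<and> (zs = [] \<or> isl (hd zs))} \<union>
      {Inr s # zs | s zs. s \<in> nontrivial_reps K C j \<and> zs \<in> {zs. normal zs \<and> (zs = [] \<or> isl (hd zs))}}"
    (is "?l = ?r")
  proof (rule Set.set_eqI)
    show "zs \<in> ?l \<longleftrightarrow> zs \<in> ?r" for zs by (cases zs) auto
  qed
qed auto

definition normal_forms :: "('c \<times> ('h + 'k) list) set" where
  "normal_forms = carrier C \<times> {zs. normal zs}"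

definition act_letter :: "('h + 'k) \<times> bool \<Rightarrow> 'c \<times> ('h + 'k) list \<Rightarrow> 'c \<times> ('h + 'k) list" where
  "act_letter x = (case fst x of
     Inl a \<Rightarrow> AH.act (if snd x then a else inv\<^bsub>H\<^esub> a)
   | Inr a \<Rightarrow> AK.act (if snd x then a else inv\<^bsub>K\<^esub> a))"

abbreviation act_word :: "('h + 'k) word \<Rightarrow> 'c \<times> ('h + 'k) list \<Rightarrow> 'c \<times> ('h + 'k) list" where
  "act_word \<equiv> foldr act_letter"

lemma act_letter_closed:
  "fst x \<in> amalgam_gens H K \<Longrightarrow> \<omega> \<in> normal_forms \<Longrightarrow> act_letter x \<omega> \<in> normal_forms"
  unfolding normal_forms_def amalgam_gens_def act_letter_def
  using AH.act_closed AK.act_closed by auto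

lemma act_word_closed:
  "w \<in> words (amalgam_gens H K) \<Longrightarrow> \<omega> \<in> normal_forms \<Longrightarrow> act_word w \<omega> \<in> normal_forms"
  by (induction w) (auto intro: act_letter_closed)

lemma act_letter_cancel:
  "x \<in> amalgam_gens H K \<Longrightarrow> \<omega> \<in> normal_forms \<Longrightarrow> act_letter (x, b) (act_letter (x, \<not> b) \<omega>) = \<omega>"
  unfolding normal_forms_def amalgam_gens_def act_letter_def
  by (auto simp: AH.act_mult AK.act_mult AH.act_one AK.act_one)

lemma act_relator:
  assumes "r \<in> amalgam_relators H K C i j" "\<omega> \<in> normal_forms"
  shows "act_word r \<omega> = \<omega>"
proof -
  have mem: "\<omega> \<in> carrier C \<times> {zs. normal zs}" using assms(2) by (simp add: normal_forms_def)
  consider (H) a b where "r = [(Inl a, True), (Inl b, True), (Inl (a \<otimes>\<^bsub>H\<^esub> b), False)]"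
      "a \<in> carrier H" "b \<in> carrier H"
    | (K) a b where "r = [(Inr a, True), (Inr b, True), (Inr (a \<otimes>\<^bsub>K\<^esub> b), False)]"
      "a \<in> carrier K" "b \<in> carrier K"
    | (C) c where "r = [(Inl (i c), True), (Inr (j c), False)]" "c \<in> carrier C"
    using assms(1) unfolding amalgam_relators_def by blast
  then show ?thesis
  proof cases
    case (H a b)
    let ?\<omega> = "AH.act (inv\<^bsub>H\<^esub> (a \<otimes>\<^bsub>H\<^esub> b)) \<omega>"
    have cl: "?\<omega> \<in> carrier C \<times> {zs. normal zs}" using H mem by (intro AH.act_closed) auto
    have "AH.act a (AH.act b ?\<omega>) = AH.act (a \<otimes>\<^bsub>H\<^esub> b) ?\<omega>"
      using H by (intro AH.act_mult[OF _ _ cl])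
    also have "\<dots> = AH.act (a \<otimes>\<^bsub>H\<^esub> b \<otimes>\<^bsub>H\<^esub> inv\<^bsub>H\<^esub> (a \<otimes>\<^bsub>H\<^esub> b)) \<omega>"
      using H by (intro AH.act_mult[OF _ _ mem]) auto
    also have "\<dots> = \<omega>" using H AH.act_one[OF mem] by simp
    finally show ?thesis using H by (simp add: act_letter_def)
  next
    case (K a b)
    let ?\<omega> = "AK.act (inv\<^bsub>K\<^esub> (a \<otimes>\<^bsub>K\<^esub> b)) \<omega>"
    have cl: "?\<omega> \<in> carrier C \<times> {zs. normal zs}" using K mem by (intro AK.act_closed) auto
    have "AK.act a (AK.act b ?\<omega>) = AK.act (a \<otimes>\<^bsub>K\<^esub> b) ?\<omega>"
      using K by (intro AK.act_mult[OF _ _ cl])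
    also have "\<dots> = AK.act (a \<otimes>\<^bsub>K\<^esub> b \<otimes>\<^bsub>K\<^esub> inv\<^bsub>K\<^esub> (a \<otimes>\<^bsub>K\<^esub> b)) \<omega>"
      using K by (intro AK.act_mult[OF _ _ mem]) auto
    also have "\<dots> = \<omega>" using K AK.act_one[OF mem] by simp
    finally show ?thesis using K by (simp add: act_letter_def)
  next
    case (C c)
    let ?\<omega> = "AK.act (inv\<^bsub>K\<^esub> (j c)) \<omega>"
    have cl: "?\<omega> \<in> carrier C \<times> {zs. normal zs}" using C mem by (intro AK.act_closed) auto
    have "AH.act (i c) ?\<omega> = AK.act (j c) ?\<omega>"
      using AH.act_image[OF C(2) cl] AK.act_image[OF C(2) cl] by simp
    also have "\<dots> = \<omega>" using C mem by (simp add: AK.act_mult AK.act_one)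
    finally show ?thesis using C by (simp add: act_letter_def)
  qed
qed

text \<open>Van der Waerden's device: the relators act as the identity on normal forms, so words
  with different effects on them represent different elements.\<close>

lemma act_pres_eq:
  "pres_eq (amalgam_gens H K) (amalgam_relators H K C i j) u v \<Longrightarrow>
    \<omega> \<in> normal_forms \<Longrightarrow> act_word u \<omega> = act_word v \<omega>"
proof (induction arbitrary: \<omega> rule: pres_eq.induct)
  case (cancel u v x b)
  then show ?case using act_letter_cancel act_word_closed by simp
next
  case (relator u v r)
  then show ?case using act_relator act_word_closed by simp
qed auto

primrec reduced :: "('h + 'k) list \<Rightarrow> bool" where
  "reduced [] \<longleftrightarrow> True"
| "reduced (z # zs) \<longleftrightarrow> z \<in> Inl ` (carrier H - i ` carrier C) \<union> Inr ` (carrier K - j ` carrier C) \<and>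
     (zs = [] \<or> isl (hd zs) \<noteq> isl z) \<and> reduced zs"

abbreviation word_of :: "('h + 'k) list \<Rightarrow> ('h + 'k) word" where
  "word_of \<equiv> map (\<lambda>z. (z, True))"

lemma word_of_words: "reduced zs \<Longrightarrow> word_of zs \<in> words (amalgam_gens H K)"
  by (induction zs) (auto simp: amalgam_gens_def)

lemma base_normal: "(\<one>\<^bsub>C\<^esub>, []) \<in> normal_forms"
  by (simp add: normal_forms_def)

text \<open>Each letter adds one syllable from its own factor. Passing to coset representatives
  alters the syllables but not the factors they come from, so only these are compared.\<close>

lemma act_reduced:
  "reduced zs \<Longrightarrow> map isl (snd (act_word (word_of zs) (\<one>\<^bsub>C\<^esub>, []))) = map isl zs"
proof (induction zs)
  case (Cons z zs)
  obtain c zs' where act: "act_word (word_of zs) (\<one>\<^bsub>C\<^esub>, []) = (c, zs')" by force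
  have "(c, zs') \<in> normal_forms"
    using act_word_closed[OF word_of_words base_normal, of zs] Cons.prems act by simp
  then have n: "c \<in> carrier C" "normal zs'" by (auto simp: normal_forms_def)
  have isl: "map isl zs' = map isl zs" using Cons act by simp
  then have hd: "zs' = [] \<or> isl (hd zs') \<noteq> isl z"
    using Cons.prems by (cases zs'; cases zs) auto
  show ?case
  proof (cases z)
    case (Inl a)
    then have "\<exists>c' s. AH.act a (c, zs') = (c', Inl s # zs')"
      using Cons.prems n hd by (intro AH.act_prepend) auto
    moreover have "act_letter (Inl a, True) = AH.act a" by (simp add: act_letter_def)
    ultimately show ?thesis using act isl Inl by auto
  next
    case (Inr a)
    then have "\<exists>c' s. AK.act a (c, zs') = (c', Inr s # zs')"
      using Cons.prems n hd by (intro AK.act_prepend) auto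
    moreover have "act_letter (Inr a, True) = AK.act a" by (simp add: act_letter_def)
    ultimately show ?thesis using act isl Inr by auto
  qed
qed simp

end

section \<open>The two factors as subgroups of the amalgam\<close>

locale amalgam_group = amalgam_setup H K C i j +
  presented_group G "amalgam_gens H K" "amalgam_relators H K C i j" \<psi>
  for H :: "('h, 'p) monoid_scheme" and K :: "('k, 'q) monoid_scheme"
    and C :: "('c, 'r) monoid_scheme" and i j
    and G :: "('a, 'b) monoid_scheme" (structure) and \<psi>
begin

definition letter :: "'h + 'k \<Rightarrow> 'a" where
  "letter z = ev [(z, True)]"

definition left_factor :: "'a set" where
  "left_factor = (\<lambda>a. letter (Inl a)) ` carrier H"

definition right_factor :: "'a set" where
  "right_factor = (\<lambda>a. letter (Inr a)) ` carrier K"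

lemma gens_Inl [simp]: "Inl a \<in> amalgam_gens H K \<longleftrightarrow> a \<in> carrier H"
  and gens_Inr [simp]: "Inr b \<in> amalgam_gens H K \<longleftrightarrow> b \<in> carrier K"
  by (auto simp: amalgam_gens_def)

lemma letter_closed: "z \<in> amalgam_gens H K \<Longrightarrow> letter z \<in> carrier G"
  unfolding letter_def by (rule ev_closed) simp

lemma ev_relator:
  assumes "r \<in> amalgam_relators H K C i j" "r \<in> words (amalgam_gens H K)"
  shows "ev r = \<one>"
  using ev_eq[OF pres_eq.relator[of "[]" "amalgam_gens H K" "[]" r "amalgam_relators H K C i j"]] assms ev_Nil
  by simp

lemma letter_mult_aux:
  assumes "x \<in> amalgam_gens H K" "y \<in> amalgam_gens H K" "z \<in> amalgam_gens H K"
    "[(x, True), (y, True), (z, False)] \<in> amalgam_relators H K C i j"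
  shows "letter x \<otimes> letter y = letter z"
proof -
  have "ev [(x, True), (y, True), (z, False)] = \<one>" by (rule ev_relator) (use assms in simp_all)
  then have "letter x \<otimes> (letter y \<otimes> inv (letter z)) = \<one>"
    using assms by (simp add: letter_def ev_Cons[of _ "_ # _"] ev_inv)
  then have "letter x \<otimes> letter y \<otimes> inv (letter z) = \<one>"
    using assms letter_closed by (simp add: m_assoc)
  then have "inv (inv (letter z)) = letter x \<otimes> letter y"
    using assms letter_closed by (intro inv_equality) auto
  then show ?thesis using assms letter_closed by simp
qed

lemma letter_mult_Inl: "a \<in> carrier H \<Longrightarrow> b \<in> carrier H \<Longrightarrow> letter (Inl a) \<otimes> letter (Inl b) = letter (Inl (a \<otimes>\<^bsub>H\<^esub> b))"
  by (rule letter_mult_aux) (auto simp: amalgam_relators_def)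

lemma letter_mult_Inr: "a \<in> carrier K \<Longrightarrow> b \<in> carrier K \<Longrightarrow> letter (Inr a) \<otimes> letter (Inr b) = letter (Inr (a \<otimes>\<^bsub>K\<^esub> b))"
  by (rule letter_mult_aux) (auto simp: amalgam_relators_def)

lemma letter_amalgamated:
  assumes "c \<in> carrier C"
  shows "letter (Inl (i c)) = letter (Inr (j c))"
proof -
  have "ev [(Inl (i c), True), (Inr (j c), False)] = \<one>"
    by (rule ev_relator) (use assms in \<open>auto simp: amalgam_relators_def\<close>)
  then have "letter (Inl (i c)) \<otimes> inv (letter (Inr (j c))) = \<one>"
    using assms by (simp add: letter_def ev_Cons[of _ "_ # _"] ev_inv)
  then have "inv (inv (letter (Inr (j c)))) = letter (Inl (i c))"
    using assms letter_closed by (intro inv_equality) auto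
  then show ?thesis using assms letter_closed by simp
qed

lemma subgroup_left: "subgroup left_factor G"
proof -
  have "group_hom H G (\<lambda>a. letter (Inl a))"
    by unfold_locales (auto simp: hom_def letter_closed letter_mult_Inl)
  from group_hom.img_is_subgroup[OF this] show ?thesis unfolding left_factor_def .
qed

lemma subgroup_right: "subgroup right_factor G"
proof -
  have "group_hom K G (\<lambda>a. letter (Inr a))"
    by unfold_locales (auto simp: hom_def letter_closed letter_mult_Inr)
  from group_hom.img_is_subgroup[OF this] show ?thesis unfolding right_factor_def .
qed

lemma reduced_unique_types:
  assumes "reduced zs" "reduced zs'" "ev (word_of zs) = ev (word_of zs')"
  shows "map isl zs = map isl zs'"
  using act_pres_eq[OF ev_eqD[OF _ _ assms(3)] base_normal] word_of_words assms act_reduced by metis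

lemma reduced_not_amalgamated:
  assumes "reduced zs" "c \<in> carrier C" "ev (word_of zs) = letter (Inl (i c))"
  shows "zs = []"
proof -
  have "act_word (word_of zs) (\<one>\<^bsub>C\<^esub>, []) = act_word [(Inl (i c), True)] (\<one>\<^bsub>C\<^esub>, [])"
    by (rule act_pres_eq[OF ev_eqD base_normal])
      (use assms word_of_words in \<open>auto simp: letter_def\<close>)
  moreover have "snd (act_word [(Inl (i c), True)] (\<one>\<^bsub>C\<^esub>, [])) = []"
    using assms AH.act_image[of c "(\<one>\<^bsub>C\<^esub>, [])"] by (simp add: act_letter_def)
  ultimately show ?thesis using act_reduced[OF assms(1)] by simp
qed

lemma left_diffE:
  assumes "g \<in> left_factor - right_factor"
  obtains a where "a \<in> carrier H - i ` carrier C" "g = letter (Inl a)"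
  using assms letter_amalgamated unfolding left_factor_def right_factor_def by fastforce

lemma right_diffE:
  assumes "g \<in> right_factor - left_factor"
  obtains b where "b \<in> carrier K - j ` carrier C" "g = letter (Inr b)"
  using assms letter_amalgamated[symmetric] unfolding left_factor_def right_factor_def by fastforce

text \<open>The two factors change places at every induction step, so both orders are treated in one
  statement.\<close>

lemma alt_prod_reduced:
  assumes "alt_prod G A B g"
  shows "(A = left_factor \<and> B = right_factor \<longrightarrow>
        (\<exists>zs. reduced zs \<and> zs \<noteq> [] \<and> isl (hd zs) \<and> g = ev (word_of zs))) \<and>
      (A = right_factor \<and> B = left_factor \<longrightarrow>
        (\<exists>zs. reduced zs \<and> zs \<noteq> [] \<and> \<not> isl (hd zs) \<and> g = ev (word_of zs)))"
  using assms
proof induction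
  case (single g A B)
  have "\<exists>zs. reduced zs \<and> zs \<noteq> [] \<and> isl (hd zs) \<and> g = ev (word_of zs)"
    if AB: "A = left_factor" "B = right_factor"
  proof -
    have "g \<in> left_factor - right_factor" using single AB by simp
    then obtain a where "a \<in> carrier H - i ` carrier C" "g = letter (Inl a)"
      by (rule left_diffE)
    then show ?thesis by (intro exI[of _ "[Inl a]"]) (auto simp: letter_def)
  qed
  moreover have "\<exists>zs. reduced zs \<and> zs \<noteq> [] \<and> \<not> isl (hd zs) \<and> g = ev (word_of zs)"
    if AB: "A = right_factor" "B = left_factor"
  proof -
    have "g \<in> right_factor - left_factor" using single AB by simp
    then obtain b where "b \<in> carrier K - j ` carrier C" "g = letter (Inr b)"
      by (rule right_diffE)
    then show ?thesis by (intro exI[of _ "[Inr b]"]) (auto simp: letter_def)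
  qed
  ultimately show ?case by blast
next
  case (cons g A B h)
  have "\<exists>zs. reduced zs \<and> zs \<noteq> [] \<and> isl (hd zs) \<and> g \<otimes> h = ev (word_of zs)"
    if AB: "A = left_factor" "B = right_factor"
  proof -
    have "g \<in> left_factor - right_factor" using cons AB by simp
    then obtain a where a: "a \<in> carrier H - i ` carrier C" "g = letter (Inl a)"
      by (rule left_diffE)
    obtain zs where zs: "reduced zs" "zs \<noteq> []" "\<not> isl (hd zs)" "h = ev (word_of zs)"
      using cons AB by blast
    then have "g \<otimes> h = ev (word_of (Inl a # zs))"
      using a word_of_words[OF zs(1)] by (subst list.map, subst ev_Cons) (auto simp: letter_def)
    then show ?thesis using a zs by (intro exI[of _ "Inl a # zs"]) auto
  qed
  moreover have "\<exists>zs. reduced zs \<and> zs \<noteq> [] \<and> \<not> isl (hd zs) \<and> g \<otimes> h = ev (word_of zs)"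
    if AB: "A = right_factor" "B = left_factor"
  proof -
    have "g \<in> right_factor - left_factor" using cons AB by simp
    then obtain b where b: "b \<in> carrier K - j ` carrier C" "g = letter (Inr b)"
      by (rule right_diffE)
    obtain zs where zs: "reduced zs" "zs \<noteq> []" "isl (hd zs)" "h = ev (word_of zs)"
      using cons AB by blast
    then have "g \<otimes> h = ev (word_of (Inr b # zs))"
      using b word_of_words[OF zs(1)] by (subst list.map, subst ev_Cons) (auto simp: letter_def)
    then show ?thesis using b zs by (intro exI[of _ "Inr b # zs"]) auto
  qed
  ultimately show ?case by blast
qed

text \<open>The element would equal a letter a of H and a letter b of K. If one of them is in the
  image of C, the word is empty; otherwise the one-letter words a and b are reduced, of different
  types and equal in value.\<close>

lemma reduced_notin_inter:
  assumes "reduced zs" "zs \<noteq> []"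
  shows "ev (word_of zs) \<notin> left_factor \<inter> right_factor"
proof
  assume mem: "ev (word_of zs) \<in> left_factor \<inter> right_factor"
  then obtain a b where a: "a \<in> carrier H" "ev (word_of zs) = letter (Inl a)"
    and b: "b \<in> carrier K" "ev (word_of zs) = letter (Inr b)"
    by (auto simp: left_factor_def right_factor_def)
  have na: "a \<notin> i ` carrier C"
    using reduced_not_amalgamated[OF assms(1)] a assms(2) by auto
  have nb: "b \<notin> j ` carrier C"
    using reduced_not_amalgamated[OF assms(1)] b assms(2) letter_amalgamated by auto
  have "map isl [Inl a :: 'h + 'k] = map isl [Inr b :: 'h + 'k]"
    by (rule reduced_unique_types) (use a b na nb in \<open>auto simp: letter_def\<close>)
  then show False by simp
qed

sublocale reduced_pair G left_factor right_factor
proof (intro reduced_pair.intro reduced_pair_axioms.intro is_group subgroup_left subgroup_right)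
  show "g \<notin> left_factor \<inter> right_factor" if "alt_prod G left_factor right_factor g" for g
    using alt_prod_reduced[OF that] reduced_notin_inter by blast
  show "g \<notin> left_factor \<inter> right_factor" if "alt_prod G right_factor left_factor g" for g
    using alt_prod_reduced[OF that] reduced_notin_inter by blast
qed

lemma factors_proper:
  "left_factor \<noteq> left_factor \<inter> right_factor" "right_factor \<noteq> left_factor \<inter> right_factor"
proof -
  have "i ` carrier C \<noteq> carrier H" "j ` carrier C \<noteq> carrier K" using data by (auto simp: amalgam_data_def)
  then obtain a b where a: "a \<in> carrier H - i ` carrier C" and b: "b \<in> carrier K - j ` carrier C"
    by auto
  have "letter (Inl a) \<notin> left_factor \<inter> right_factor"
    using reduced_notin_inter[of "[Inl a]"] a by (auto simp: letter_def)
  then show "left_factor \<noteq> left_factor \<inter> right_factor" using a by (auto simp: left_factor_def)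
  have "letter (Inr b) \<notin> left_factor \<inter> right_factor"
    using reduced_notin_inter[of "[Inr b]"] b by (auto simp: letter_def)
  then show "right_factor \<noteq> left_factor \<inter> right_factor" using b by (auto simp: right_factor_def)
qed

lemma image_amalgam_factors: "\<psi> ` amalgam_factors H K C i j = left_factor \<union> right_factor"
proof -
  have "\<psi> ` amalgam_factors H K C i j = letter ` amalgam_gens H K"
    by (simp add: amalgam_factors_def image_image letter_def ev_def)
  then show ?thesis
    by (simp add: amalgam_gens_def left_factor_def right_factor_def image_Un image_image)
qed

lemma generate_factors: "generate G (left_factor \<union> right_factor) = carrier G"
proof
  have sub: "left_factor \<union> right_factor \<subseteq> carrier G"
    using subgroup_left subgroup_right by (auto dest: subgroup.mem_carrier)
  then show "generate G (left_factor \<union> right_factor) \<subseteq> carrier G" by (rule generate_incl)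
  have "ev w \<in> generate G (left_factor \<union> right_factor)" if "w \<in> words (amalgam_gens H K)" for w
    using that
  proof (induction w)
    case Nil
    then show ?case by (simp add: ev_Nil generate.one)
  next
    case (Cons x w)
    obtain z b where x: "x = (z, b)" "z \<in> amalgam_gens H K" using Cons.prems by (cases x) auto
    then have z: "letter z \<in> left_factor \<union> right_factor"
      by (auto simp: amalgam_gens_def left_factor_def right_factor_def)
    then have "ev [x] \<in> generate G (left_factor \<union> right_factor)"
      using x ev_inv[OF x(2)] by (cases b) (auto simp: letter_def intro: generate.incl generate.inv)
    then show ?case using Cons ev_Cons[of x w] by (auto intro: generate.eng)
  qed
  then show "carrier G \<subseteq> generate G (left_factor \<union> right_factor)" using ev_surj by blast
qed

end

section \<open>Edge boundaries in infinite Cayley graphs\<close>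

definition edge_boundary :: "('a, 'b) monoid_scheme \<Rightarrow> 'a set \<Rightarrow> 'a set \<Rightarrow> ('a \<times> 'a) set" where
  "edge_boundary G S B = {(x, s). x \<in> B \<and> s \<in> S \<and> x \<otimes>\<^bsub>G\<^esub> s \<notin> B}"

lemma finite_edge_boundary: "finite S \<Longrightarrow> finite B \<Longrightarrow> finite (edge_boundary G S B)"
  by (rule finite_subset[of _ "B \<times> S"]) (auto simp: edge_boundary_def)

text \<open>The union of the two boundaries on the left is contained in the union of those on the
  right, and likewise for the intersections; the cardinalities of union and intersection add up to
  the sums.\<close>

lemma edge_boundary_submodular:
  assumes "finite S" "finite A" "finite B"
  shows "card (edge_boundary G S (A \<inter> B)) + card (edge_boundary G S (A \<union> B))
    \<le> card (edge_boundary G S A) + card (edge_boundary G S B)"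
proof -
  let ?e = "edge_boundary G S"
  have "card (?e (A \<inter> B)) + card (?e (A \<union> B))
      = card (?e (A \<inter> B) \<union> ?e (A \<union> B)) + card (?e (A \<inter> B) \<inter> ?e (A \<union> B))"
    using assms by (intro card_Un_Int finite_edge_boundary) auto
  also have "\<dots> \<le> card (?e A \<union> ?e B) + card (?e A \<inter> ?e B)"
    using assms finite_edge_boundary[of S A G] finite_edge_boundary[of S B G]
    by (intro add_mono card_mono) (auto simp: edge_boundary_def)
  also have "\<dots> = card (?e A) + card (?e B)"
    using assms by (intro card_Un_Int[symmetric] finite_edge_boundary) auto
  finally show ?thesis .
qed

context group
begin

lemma card_edge_boundary_translate:
  assumes "S \<subseteq> carrier G" "B \<subseteq> carrier G" "g \<in> carrier G"
  shows "card (edge_boundary G S ((\<lambda>x. g \<otimes> x) ` B)) = card (edge_boundary G S B)"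
proof -
  have inj: "g \<otimes> x = g \<otimes> y \<longleftrightarrow> x = y" if "x \<in> carrier G" "y \<in> carrier G" for x y
    using that assms by simp
  have "edge_boundary G S ((\<lambda>x. g \<otimes> x) ` B) = (\<lambda>(x, s). (g \<otimes> x, s)) ` edge_boundary G S B"
  proof -
    have "g \<otimes> x \<otimes> s \<in> (\<lambda>x. g \<otimes> x) ` B \<longleftrightarrow> x \<otimes> s \<in> B" if "x \<in> B" "s \<in> S" for x s
    proof -
      have c: "x \<in> carrier G" "s \<in> carrier G" using that assms by auto
      then have "g \<otimes> x \<otimes> s = g \<otimes> (x \<otimes> s)" using assms by (simp add: m_assoc)
      then show ?thesis using c assms inj[of "x \<otimes> s"] by (auto simp: image_iff)
    qed
    note iff = this
    show ?thesis
    proof (intro equalityI subsetI)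
      fix p assume "p \<in> edge_boundary G S ((\<lambda>x. g \<otimes> x) ` B)"
      then obtain x s where "p = (g \<otimes> x, s)" "x \<in> B" "s \<in> S" "g \<otimes> x \<otimes> s \<notin> (\<lambda>x. g \<otimes> x) ` B"
        unfolding edge_boundary_def by blast
      then show "p \<in> (\<lambda>(x, s). (g \<otimes> x, s)) ` edge_boundary G S B"
        using iff by (intro image_eqI[of _ _ "(x, s)"]) (simp_all add: edge_boundary_def)
    next
      fix p assume "p \<in> (\<lambda>(x, s). (g \<otimes> x, s)) ` edge_boundary G S B"
      then show "p \<in> edge_boundary G S ((\<lambda>x. g \<otimes> x) ` B)"
        using iff unfolding edge_boundary_def by fastforce
    qed
  qed
  moreover have "inj_on (\<lambda>(x, s). (g \<otimes> x, s)) (edge_boundary G S B)"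
    using assms(2) inj by (intro inj_onI) (auto simp: edge_boundary_def subset_iff)
  ultimately show ?thesis by (simp add: card_image)
qed

text \<open>A finite set with smallest boundary, and among these of smallest size, is a coset of a finite
  subgroup by submodularity.\<close>

lemma edge_boundary_ge:
  assumes S: "generator_set G S" and inf: "infinite (carrier G)"
    and B: "finite B" "B \<noteq> {}" "B \<subseteq> carrier G"
  shows "card S \<le> card (edge_boundary G S B)"
proof -
  let ?f = "\<lambda>B. card (edge_boundary G S B)"
  let ?P = "\<lambda>B. finite B \<and> B \<noteq> {} \<and> B \<subseteq> carrier G"
  have Sfin: "finite S" "S \<subseteq> carrier G" "\<one> \<notin> S" using S by (auto simp: generator_set_def)
  obtain A0 where A0: "?P A0" "\<And>B. ?P B \<Longrightarrow> ?f A0 \<le> ?f B"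
    using ex_has_least_nat[of ?P B ?f] B by blast
  obtain A1 where A1: "?P A1 \<and> ?f A1 = ?f A0"
      "\<And>B. ?P B \<and> ?f B = ?f A0 \<Longrightarrow> card A1 \<le> card B"
    using ex_has_least_nat[of "\<lambda>B. ?P B \<and> ?f B = ?f A0" A0 card] A0(1) by blast
  obtain a where a: "a \<in> A1" using A1 by blast
  then have ac: "a \<in> carrier G" using A1 by blast
  define A where "A = (\<lambda>x. inv a \<otimes> x) ` A1"
  have card_tr: "card ((\<lambda>x. g \<otimes> x) ` B) = card B" if "g \<in> carrier G" "B \<subseteq> carrier G" for g B
    using that by (intro card_image inj_onI) (auto simp: subset_iff)
  have A: "?P A" "?f A = ?f A0" "card A = card A1"
    using A1 ac card_edge_boundary_translate[OF Sfin(2), of A1 "inv a"] card_tr[of "inv a" A1]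
    by (auto simp: A_def)
  have one: "\<one> \<in> A" unfolding A_def using a ac by (intro image_eqI[of _ _ a]) auto
  \<comment> \<open>A and its translate by \<open>inv g\<close> both contain the identity.
    Submodularity makes their intersection a minimizer too, and the least cardinality of A forces
    the two sets to coincide.\<close>
  have quot: "inv g \<otimes> x \<in> A" if g: "g \<in> A" and x: "x \<in> A" for g x
  proof -
    have gc: "g \<in> carrier G" using g A by blast
    let ?A = "(\<lambda>x. inv g \<otimes> x) ` A"
    have A': "?P ?A" "?f ?A = ?f A0" "card ?A = card A"
      using A gc card_edge_boundary_translate[OF Sfin(2), of A "inv g"] card_tr[of "inv g" A] by auto
    have "\<one> \<in> ?A" using g gc by (intro image_eqI[of _ _ g]) auto
    then have int: "?P (A \<inter> ?A)" using one A by blast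
    have "?f (A \<inter> ?A) + ?f (A \<union> ?A) \<le> ?f A + ?f ?A"
      using A A' by (intro edge_boundary_submodular Sfin) auto
    moreover have "?f A0 \<le> ?f (A \<union> ?A)" using A A' by (intro A0) auto
    moreover have "?f A0 \<le> ?f (A \<inter> ?A)" by (intro A0 int)
    ultimately have "?f (A \<inter> ?A) = ?f A0" using A A' by linarith
    then have "card A \<le> card (A \<inter> ?A)" using A1(2) int A by metis
    then have "A \<inter> ?A = A" using A by (intro card_seteq) auto
    moreover have "finite ?A" using A by blast
    ultimately have "A = ?A" using A'(3) by (intro card_seteq) auto
    then show ?thesis using x by blast
  qed
  have inv: "inv g \<in> A" if "g \<in> A" for g using quot[OF that one] that A by auto
  have mult: "g \<otimes> h \<in> A" if "g \<in> A" "h \<in> A" for g h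
    using quot[OF inv[OF that(1)] that(2)] that A by auto
  have sub: "subgroup A G" by (rule subgroupI) (use A inv mult in auto)
  have "\<not> S \<subseteq> A"
  proof
    assume "S \<subseteq> A"
    from generate_subgroup_incl[OF this sub] have "carrier G \<subseteq> A"
      using S by (simp add: generator_set_def)
    then show False using inf A finite_subset by blast
  qed
  then have k: "card (S - A) \<ge> 1" using Sfin by (simp add: Suc_le_eq card_gt_0_iff)
  have "card (insert \<one> (S \<inter> A)) \<le> card A" using A one by (intro card_mono) auto
  then have j: "card (S \<inter> A) + 1 \<le> card A" using Sfin by simp
  have "A \<times> (S - A) \<subseteq> edge_boundary G S A"
  proof clarify
    fix x s assume xs: "x \<in> A" "s \<in> S" "s \<notin> A"
    then have c: "x \<in> carrier G" "s \<in> carrier G" using A Sfin by auto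
    have "x \<otimes> s \<notin> A"
    proof
      assume "x \<otimes> s \<in> A"
      from quot[OF xs(1) this] have "s \<in> A" using c by (simp flip: m_assoc)
      then show False using xs by blast
    qed
    then show "(x, s) \<in> edge_boundary G S A" using xs by (simp add: edge_boundary_def)
  qed
  \<comment> \<open>From every element of the subgroup each letter outside it leaves. With j letters
    inside and k >= 1 outside, the subgroup has at least j + 1 elements, counting the identity, and
    (j + 1) k >= j + k.\<close>
  then have "card (A \<times> (S - A)) \<le> ?f A"
    using A Sfin by (intro card_mono finite_edge_boundary) auto
  then have "card A * card (S - A) \<le> ?f A" by (simp add: card_cartesian_product)
  moreover have "card S = card (S \<inter> A) + card (S - A)"
    using Sfin by (metis card_Diff_subset_Int card_mono finite_Int inf_le1 le_add_diff_inverse)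
  moreover have "card (S \<inter> A) + card (S - A) \<le> (card (S \<inter> A) + 1) * card (S - A)"
    using k by simp
  moreover have "(card (S \<inter> A) + 1) * card (S - A) \<le> card A * card (S - A)"
    using j by (rule mult_le_mono1)
  ultimately have "card S \<le> ?f A0" using A by linarith
  then show ?thesis using A0(2) B by (meson le_trans)
qed

end

section \<open>Infinite Cayley graphs of degree at least four\<close>

locale infinite_cayley = group +
  fixes S
  assumes gen: "generator_set G S" and inf: "infinite (carrier G)"
begin

lemma S_finite: "finite S" and S_carrier: "S \<subseteq> carrier G" and one_notin_S: "\<one> \<notin> S"
  and S_inv: "s \<in> S \<Longrightarrow> inv s \<in> S"
  using gen by (auto simp: generator_set_def)

lemma S_closed [simp]: "s \<in> S \<Longrightarrow> s \<in> carrier G"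
  using S_carrier by blast

definition steps :: "'a set \<Rightarrow> ('a \<times> 'a) set" where
  "steps X = {(x, x \<otimes> s) | x s. x \<in> carrier G \<and> s \<in> S \<and> x \<notin> X \<and> x \<otimes> s \<notin> X}"

text \<open>For w in X or outside the carrier this is only w itself, hence finite; so
  \<open>big X w\<close> already implies that w is a vertex off X.\<close>

definition component :: "'a set \<Rightarrow> 'a \<Rightarrow> 'a set" where
  "component X w = {y. (w, y) \<in> (steps X)\<^sup>*}"

definition big :: "'a set \<Rightarrow> 'a \<Rightarrow> bool" where
  "big X w \<longleftrightarrow> infinite (component X w)"

lemma sym_steps: "sym (steps X)"
proof (rule symI)
  fix x y assume "(x, y) \<in> steps X"
  then obtain s where s: "x \<in> carrier G" "s \<in> S" "x \<notin> X" "x \<otimes> s \<notin> X" "y = x \<otimes> s"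
    by (auto simp: steps_def)
  then have "x = y \<otimes> inv s" by (simp add: m_assoc)
  moreover have "y \<in> carrier G" "inv s \<in> S" "y \<notin> X" using s S_inv by auto
  moreover have "y \<otimes> inv s \<notin> X" using s(3) \<open>x = y \<otimes> inv s\<close> by (rule back_subst)
  ultimately show "(y, x) \<in> steps X" unfolding steps_def by blast
qed

lemma component_eq: "y \<in> component X w \<Longrightarrow> component X y = component X w"
proof -
  assume "y \<in> component X w"
  then have "(w, y) \<in> (steps X)\<^sup>*" by (simp add: component_def)
  moreover from this have "(y, w) \<in> (steps X)\<^sup>*" using sym_rtrancl[OF sym_steps] by (rule symD[rotated])
  ultimately have "(y, z) \<in> (steps X)\<^sup>* \<longleftrightarrow> (w, z) \<in> (steps X)\<^sup>*" for z by (meson rtrancl_trans)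
  then show ?thesis by (simp add: component_def)
qed

lemma component_antimono: "X \<subseteq> Y \<Longrightarrow> component Y w \<subseteq> component X w"
proof -
  assume "X \<subseteq> Y"
  then have "steps Y \<subseteq> steps X" unfolding steps_def by blast
  from rtrancl_mono[OF this] show ?thesis unfolding component_def by blast
qed

lemma component_self: "w \<in> component X w"
  by (simp add: component_def)

lemma component_step:
  "w \<in> carrier G \<Longrightarrow> s \<in> S \<Longrightarrow> w \<notin> X \<Longrightarrow> w \<otimes> s \<notin> X \<Longrightarrow> w \<otimes> s \<in> component X w"
  unfolding component_def steps_def by blast

lemma component_subset:
  assumes "w \<in> carrier G" "w \<notin> X"
  shows "component X w \<subseteq> carrier G - X"
proof
  fix y assume "y \<in> component X w"
  then have "(w, y) \<in> (steps X)\<^sup>*" by (simp add: component_def)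
  then show "y \<in> carrier G - X" by induction (use assms in \<open>auto simp: steps_def\<close>)
qed

lemma big_mem:
  assumes "big X w"
  shows "w \<in> carrier G" "w \<notin> X"
proof -
  have "w \<in> carrier G \<and> w \<notin> X"
  proof (rule ccontr)
    assume neg: "\<not> ?thesis"
    have "component X w \<subseteq> {w}"
    proof
      fix y assume "y \<in> component X w"
      then have "(w, y) \<in> (steps X)\<^sup>*" by (simp add: component_def)
      then show "y \<in> {w}" by (cases rule: converse_rtranclE) (use neg in \<open>auto simp: steps_def\<close>)
    qed
    then show False using assms finite_subset by (auto simp: big_def)
  qed
  then show "w \<in> carrier G" "w \<notin> X" by auto
qed

lemma big_antimono: "X \<subseteq> Y \<Longrightarrow> big Y w \<Longrightarrow> big X w"
  unfolding big_def using component_antimono[of X Y w] finite_subset[of "component Y w" "component X w"] by blast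

lemma big_component: "y \<in> component X w \<Longrightarrow> big X y \<longleftrightarrow> big X w"
  unfolding big_def by (simp add: component_eq)

text \<open>Deleting w leaves pieces of its component that each contain one of the finitely many
  neighbours of w; were all of them finite, the component would be finite.\<close>

lemma big_child:
  assumes "big X w"
  shows "\<exists>s\<in>S. big (insert w X) (w \<otimes> s)"
proof (rule ccontr)
  assume "\<not> ?thesis"
  then have fin: "finite (component (insert w X) (w \<otimes> s))" if "s \<in> S" for s
    using that by (auto simp: big_def)
  have "component X w \<subseteq> insert w (\<Union>s\<in>S. component (insert w X) (w \<otimes> s))"
  proof
    fix y assume "y \<in> component X w"
    then have "(w, y) \<in> (steps X)\<^sup>*" by (simp add: component_def)
    then show "y \<in> insert w (\<Union>s\<in>S. component (insert w X) (w \<otimes> s))"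
    proof induction
      case (step y z)
      show ?case
      proof (cases "z = w \<or> y = w")
        case True
        then show ?thesis using step(2) component_self by (auto simp: steps_def)
      next
        case False
        then have "(y, z) \<in> steps (insert w X)" using step(2) by (auto simp: steps_def)
        moreover obtain s where "s \<in> S" "(w \<otimes> s, y) \<in> (steps (insert w X))\<^sup>*"
          using step.IH False by (auto simp: component_def)
        ultimately show ?thesis by (auto simp: component_def intro: rtrancl_into_rtrancl)
      qed
    qed simp
  qed
  moreover have "finite (insert w (\<Union>s\<in>S. component (insert w X) (w \<otimes> s)))"
    using fin S_finite by simp
  ultimately show False using assms finite_subset unfolding big_def by blast
qed

lemma component_empty: "component {} \<one> = carrier G"
proof
  show "component {} \<one> \<subseteq> carrier G" using component_subset[of \<one> "{}"] by simp
  have "x \<in> carrier G \<and> (\<forall>y\<in>carrier G. y \<otimes> x \<in> component {} y)" if "x \<in> generate G S" for x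
    using that
  proof induction
    case one
    then show ?case by (simp add: component_self)
  next
    case (incl h)
    then show ?case using component_step[of _ h "{}"] by simp
  next
    case (inv h)
    then show ?case using component_step[of _ "inv h" "{}"] S_inv by simp
  next
    case (eng a b)
    then show ?case
      by (metis component_eq m_assoc m_closed)
  qed
  note gen_mem = this
  show "carrier G \<subseteq> component {} \<one>"
  proof
    fix x assume x: "x \<in> carrier G"
    then have "x \<in> generate G S" using gen by (simp add: generator_set_def)
    then have "\<one> \<otimes> x \<in> component {} \<one>" using gen_mem by blast
    then show "x \<in> component {} \<one>" using x by simp
  qed
qed

section \<open>Walks that stay in infinite components\<close>

definition vertex :: "'a list \<Rightarrow> nat \<Rightarrow> 'a" where
  "vertex w k = wprod G (take k w)"

definition visited :: "'a list \<Rightarrow> nat \<Rightarrow> 'a set" where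
  "visited w k = vertex w ` {..k}"

definition extendable :: "'a list \<Rightarrow> bool" where
  "extendable w \<longleftrightarrow> w \<in> lists S \<and> (\<forall>k<length w. big (visited w k) (vertex w (Suc k)))"

definition children :: "'a list \<Rightarrow> nat \<Rightarrow> 'a set" where
  "children w k = {s \<in> S. big (visited w k) (vertex w k \<otimes> s)}"

definition extendable_words :: "nat \<Rightarrow> 'a list set" where
  "extendable_words n = {w. extendable w \<and> length w = n}"

lemma vertex_0 [simp]: "vertex w 0 = \<one>"
  by (simp add: vertex_def)

lemma vertex_Suc:
  assumes "w \<in> lists S" "k < length w"
  shows "vertex w (Suc k) = vertex w k \<otimes> w ! k"
proof -
  have "set (take k w) \<subseteq> carrier G" using assms(1) set_take_subset[of k w] by auto
  moreover have "w ! k \<in> carrier G" using assms S_carrier nth_mem[of k w] by auto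
  ultimately show ?thesis using assms(2) by (simp add: vertex_def take_Suc_conv_app_nth wprod_append)
qed

lemma vertex_closed: "w \<in> lists S \<Longrightarrow> vertex w k \<in> carrier G"
  unfolding vertex_def using set_take_subset[of k w] by (intro wprod_closed) auto

lemma vertex_append: "k \<le> length w \<Longrightarrow> vertex (w @ u) k = vertex w k"
  by (simp add: vertex_def)

lemma visited_append: "k \<le> length w \<Longrightarrow> visited (w @ u) k = visited w k"
  by (auto simp: visited_def vertex_append)

lemma children_append: "k \<le> length w \<Longrightarrow> children (w @ u) k = children w k"
  by (simp add: children_def vertex_append visited_append)

lemma visited_mono: "j \<le> k \<Longrightarrow> visited w j \<subseteq> visited w k"
  by (auto simp: visited_def)

lemma vertex_visited: "j \<le> k \<Longrightarrow> vertex w j \<in> visited w k"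
  by (auto simp: visited_def)

lemma extendable_snoc:
  "extendable (w @ [s]) \<longleftrightarrow> extendable w \<and> s \<in> children w (length w)"
proof (cases "w \<in> lists S \<and> s \<in> S")
  case True
  then have "vertex (w @ [s]) (Suc (length w)) = vertex w (length w) \<otimes> s"
    using vertex_Suc[of "w @ [s]" "length w"] by (simp add: vertex_append)
  then show ?thesis
    using True by (auto simp: extendable_def children_def visited_append vertex_append less_Suc_eq)
next
  case False
  then show ?thesis by (auto simp: extendable_def children_def)
qed

lemma big_vertex:
  assumes "extendable w" "j < l" "l \<le> length w"
  shows "big (visited w j) (vertex w l)"
proof -
  have "big (visited w (l - 1)) (vertex w l)"
    using assms by (cases l) (auto simp: extendable_def)
  moreover have "visited w j \<subseteq> visited w (l - 1)" using assms by (intro visited_mono) auto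
  ultimately show ?thesis using big_antimono by blast
qed

lemma vertex_inj:
  assumes "extendable w" "j \<le> length w" "l \<le> length w" "vertex w j = vertex w l"
  shows "j = l"
proof -
  have "vertex w j \<noteq> vertex w l" if "j < l" "l \<le> length w" for j l
    using big_mem(2)[OF big_vertex[OF assms(1) that]] vertex_visited[of j j w] by auto
  then show ?thesis using assms by (metis nat_neq_iff)
qed

lemma extendable_saw:
  assumes "extendable w"
  shows "saw_word G w"
proof -
  have w: "set w \<subseteq> carrier G" using assms by (auto simp: extendable_def)
  have nth: "walk_of G g u ! k = g \<otimes> wprod G (take k u)"
    if "g \<in> carrier G" "set u \<subseteq> carrier G" "k \<le> length u" for g u k
    using that
  proof (induction u arbitrary: g k)
    case (Cons s u)
    then show ?case
      using set_take_subset[of "k - 1" u] by (cases k) (auto simp: m_assoc subset_iff)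
  qed simp
  have "distinct (walk_of G \<one> w)"
    unfolding distinct_conv_nth
  proof (intro allI impI)
    fix j l assume "j < length (walk_of G \<one> w)" "l < length (walk_of G \<one> w)" "j \<noteq> l"
    then have "j \<le> length w" "l \<le> length w" "vertex w j \<noteq> vertex w l"
      using vertex_inj[OF assms] by auto
    moreover have "wprod G (take m w) \<in> carrier G" for m
      using set_take_subset[of m w] w by (intro wprod_closed) auto
    ultimately show "walk_of G \<one> w ! j \<noteq> walk_of G \<one> w ! l"
      using nth[OF one_closed w] by (simp add: vertex_def)
  qed
  then show ?thesis using distinct_walk_of[OF one_closed w] by simp
qed

lemma children_nonempty:
  assumes "extendable w"
  shows "children w (length w) \<noteq> {}"
proof (cases "length w")
  case 0
  have "big {} \<one>" using inf by (simp add: big_def component_empty)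
  from big_child[OF this] show ?thesis using 0 by (auto simp: children_def visited_def)
next
  case (Suc k)
  then have "big (visited w k) (vertex w (Suc k))" using assms by (simp add: extendable_def)
  moreover have "insert (vertex w (Suc k)) (visited w k) = visited w (Suc k)"
    by (auto simp: visited_def atMost_Suc)
  ultimately show ?thesis using big_child[of "visited w k" "vertex w (Suc k)"] Suc
    by (auto simp: children_def)
qed

lemma finite_children: "finite (children w k)"
  using S_finite by (simp add: children_def)

lemma finite_extendable_words: "finite (extendable_words n)"
  by (rule finite_subset[OF _ finite_lists_length_eq[OF S_finite, of n]])
    (auto simp: extendable_words_def extendable_def)

lemma extendable_words_Suc:
  "extendable_words (Suc n) = (\<lambda>(w, s). w @ [s]) ` (SIGMA w:extendable_words n. children w n)"
proof (rule Set.set_eqI)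
  fix u
  show "u \<in> extendable_words (Suc n) \<longleftrightarrow>
      u \<in> (\<lambda>(w, s). w @ [s]) ` (SIGMA w:extendable_words n. children w n)"
    by (cases u rule: rev_cases) (auto simp: extendable_words_def extendable_snoc)
qed

text \<open>Each product is the probability that a walk choosing uniformly among its continuations
  follows the given word. No mass is lost, because every extendable word has a continuation.\<close>

lemma extendable_words_flow:
  "(\<Sum>w\<in>extendable_words n. \<Prod>k<n. 1 / real (card (children w k))) = 1"
proof (induction n)
  case 0
  have "extendable_words 0 = {[]}" by (auto simp: extendable_words_def extendable_def)
  then show ?case by simp
next
  case (Suc n)
  let ?p = "\<lambda>w n. \<Prod>k<n. 1 / real (card (children w k))"
  have "(\<Sum>w\<in>extendable_words (Suc n). ?p w (Suc n))
      = (\<Sum>(w, s)\<in>(SIGMA w:extendable_words n. children w n). ?p (w @ [s]) (Suc n))"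
    unfolding extendable_words_Suc by (subst sum.reindex) (auto intro!: inj_onI simp: case_prod_unfold)
  also have "\<dots> = (\<Sum>w\<in>extendable_words n. \<Sum>s\<in>children w n. ?p (w @ [s]) (Suc n))"
    by (rule sum.Sigma[symmetric]) (auto simp: finite_extendable_words finite_children)
  also have "\<dots> = (\<Sum>w\<in>extendable_words n. \<Sum>s\<in>children w n. ?p w n / real (card (children w n)))"
  proof (intro sum.cong)
    fix w s assume "w \<in> extendable_words n"
    then have "children (w @ [s]) k = children w k" if "k \<le> n" for k
      using that by (intro children_append) (simp add: extendable_words_def)
    then show "?p (w @ [s]) (Suc n) = ?p w n / real (card (children w n))" by simp
  qed auto
  also have "\<dots> = (\<Sum>w\<in>extendable_words n. ?p w n)"
  proof (intro sum.cong)
    fix w assume "w \<in> extendable_words n"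
    then have "children w n \<noteq> {}" using children_nonempty by (auto simp: extendable_words_def)
    then have "card (children w n) \<noteq> 0" using finite_children by simp
    then show "(\<Sum>s\<in>children w n. ?p w n / real (card (children w n))) = ?p w n" by simp
  qed simp
  finally show ?case using Suc by simp
qed

end

context infinite_cayley
begin

text \<open>The finite components left behind when the walk leaves its \<open>i\<close>-th vertex.\<close>

definition pockets :: "'a list \<Rightarrow> nat \<Rightarrow> 'a set" where
  "pockets w i = (\<Union>s\<in>{s \<in> S. vertex w i \<otimes> s \<notin> visited w i \<and> \<not> big (visited w i) (vertex w i \<otimes> s)}.
     component (visited w i) (vertex w i \<otimes> s))"

lemma pocketsE:
  assumes "y \<in> pockets w i"
  obtains s where "s \<in> S" "vertex w i \<otimes> s \<notin> visited w i"
    "\<not> big (visited w i) (vertex w i \<otimes> s)" "y \<in> component (visited w i) (vertex w i \<otimes> s)"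
  using assms by (auto simp: pockets_def)

lemma finite_pockets: "finite (pockets w i)"
  using S_finite by (auto simp: pockets_def big_def)

lemma pockets_mem:
  assumes "w \<in> lists S" "y \<in> pockets w i"
  shows "y \<in> carrier G" "y \<notin> visited w i" "\<not> big (visited w i) y"
proof -
  obtain s where s: "s \<in> S" "vertex w i \<otimes> s \<notin> visited w i"
    "\<not> big (visited w i) (vertex w i \<otimes> s)" "y \<in> component (visited w i) (vertex w i \<otimes> s)"
    using assms(2) by (rule pocketsE)
  have "vertex w i \<otimes> s \<in> carrier G" using vertex_closed[OF assms(1)] s by simp
  from component_subset[OF this s(2)] show "y \<in> carrier G" "y \<notin> visited w i" using s(4) by auto
  show "\<not> big (visited w i) y" using big_component[OF s(4)] s(3) by simp
qed

lemma pockets_iff: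
  assumes "w \<in> lists S" "s \<in> S"
  shows "vertex w i \<otimes> s \<in> pockets w i \<longleftrightarrow>
    vertex w i \<otimes> s \<notin> visited w i \<and> \<not> big (visited w i) (vertex w i \<otimes> s)"
proof
  show "vertex w i \<otimes> s \<in> pockets w i"
    if "vertex w i \<otimes> s \<notin> visited w i \<and> \<not> big (visited w i) (vertex w i \<otimes> s)"
    using that assms component_self unfolding pockets_def by blast
qed (use pockets_mem[OF assms(1)] in blast)

lemma pockets_step:
  assumes "w \<in> lists S" "y \<in> pockets w i" "s \<in> S" "y \<otimes> s \<notin> visited w i"
  shows "y \<otimes> s \<in> pockets w i"
proof -
  obtain t where t: "t \<in> S" "vertex w i \<otimes> t \<notin> visited w i"
    "\<not> big (visited w i) (vertex w i \<otimes> t)" "y \<in> component (visited w i) (vertex w i \<otimes> t)"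
    using assms(2) by (rule pocketsE)
  have "y \<otimes> s \<in> component (visited w i) y"
    using pockets_mem[OF assms(1,2)] assms(3,4) by (intro component_step)
  then have "y \<otimes> s \<in> component (visited w i) (vertex w i \<otimes> t)" using component_eq[OF t(4)] by simp
  then show ?thesis using t unfolding pockets_def by blast
qed

text \<open>A pocket hangs on the i-th vertex, which lay in an infinite component before the walk
  took it. Hence edges into the pocket were available extensions earlier, and pockets with different
  indices are disjoint.\<close>

lemma pockets_earlier_big:
  assumes "extendable w" "j < i" "i \<le> length w" "y \<in> pockets w i"
  shows "big (visited w j) y"
proof -
  have w: "w \<in> lists S" using assms(1) by (simp add: extendable_def)
  obtain s where s: "s \<in> S" "vertex w i \<otimes> s \<notin> visited w i"
    "y \<in> component (visited w i) (vertex w i \<otimes> s)"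
    using assms(4) by (rule pocketsE)
  have sub: "visited w j \<subseteq> visited w i" using assms by (intro visited_mono) simp
  have big: "big (visited w j) (vertex w i)" by (rule big_vertex[OF assms(1-3)])
  have "vertex w i \<otimes> s \<in> component (visited w j) (vertex w i)"
    using big_mem[OF big] s sub by (intro component_step) auto
  then have "big (visited w j) (vertex w i \<otimes> s)" using big_component big by blast
  moreover have "y \<in> component (visited w j) (vertex w i \<otimes> s)"
    using component_antimono[OF sub] s(3) by blast
  ultimately show ?thesis using big_component by blast
qed

lemma pockets_not_vertex:
  assumes "extendable w" "i \<le> length w" "y \<in> pockets w i" "l \<le> length w"
  shows "y \<noteq> vertex w l"
proof
  assume y: "y = vertex w l"
  have w: "w \<in> lists S" using assms(1) by (simp add: extendable_def)
  show False
  proof (cases "l \<le> i")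
    case True
    then show False using pockets_mem(2)[OF w assms(3)] vertex_visited[OF True, of w] y by simp
  next
    case False
    then have "big (visited w i) y" using big_vertex[OF assms(1), of i l] assms y by simp
    then show False using pockets_mem(3)[OF w assms(3)] by simp
  qed
qed

definition pocket_entries :: "'a list \<Rightarrow> nat \<Rightarrow> (nat \<times> 'a) set" where
  "pocket_entries w i = {(j, s). j < i \<and> s \<in> S \<and> vertex w j \<otimes> s \<in> pockets w i}"

lemma finite_pocket_entries: "finite (pocket_entries w i)"
  by (rule finite_subset[of _ "{..<i} \<times> S"]) (auto simp: pocket_entries_def S_finite)

text \<open>The edge boundary of the pockets together with the current vertex has at least \<open>card S\<close> edges,
  so the pockets have at least as many edges to earlier vertices as to the current one.\<close>

lemma pocket_entries_ge:
  assumes "w \<in> lists S"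
  shows "card {s \<in> S. vertex w i \<otimes> s \<in> pockets w i} \<le> card (pocket_entries w i)"
proof -
  let ?v = "vertex w i" and ?E = "{s \<in> S. vertex w i \<otimes> s \<in> pockets w i}"
  let ?B = "insert ?v (pockets w i)"
  let ?f = "\<lambda>(j, s). (vertex w j \<otimes> s, inv s)"
  have vc: "vertex w k \<in> carrier G" for k using vertex_closed[OF assms] .
  \<comment> \<open>A boundary edge starts at the current vertex with a letter not leading into the
    pockets, or it starts in a pocket; then it ends at an earlier vertex and is a reversed pocket
    entry.\<close>
  have "edge_boundary G S ?B \<subseteq> {?v} \<times> (S - ?E) \<union> ?f ` pocket_entries w i"
  proof
    fix p assume "p \<in> edge_boundary G S ?B"
    then obtain x s where p: "p = (x, s)" "x \<in> ?B" "s \<in> S" "x \<otimes> s \<notin> ?B"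
      by (auto simp: edge_boundary_def)
    show "p \<in> {?v} \<times> (S - ?E) \<union> ?f ` pocket_entries w i"
    proof (cases "x = ?v")
      case True
      then show ?thesis using p by auto
    next
      case False
      then have x: "x \<in> pockets w i" using p by simp
      then have "x \<otimes> s \<in> visited w i" using pockets_step[OF assms x p(3)] p(4) by blast
      then obtain j where j: "j \<le> i" "x \<otimes> s = vertex w j" by (auto simp: visited_def)
      have "j \<noteq> i" using j p by auto
      have xc: "x \<in> carrier G" using pockets_mem[OF assms x] by blast
      then have "vertex w j \<otimes> inv s = x" using p(3) by (simp add: m_assoc flip: j(2))
      then have "(j, inv s) \<in> pocket_entries w i" "?f (j, inv s) = p"
        using x j \<open>j \<noteq> i\<close> p S_inv by (auto simp: pocket_entries_def)
      then show ?thesis by (intro UnI2) (rule image_eqI[OF HOL.sym])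
    qed
  qed
  then have "card (edge_boundary G S ?B) \<le> card ({?v} \<times> (S - ?E) \<union> ?f ` pocket_entries w i)"
    using S_finite finite_pocket_entries by (intro card_mono) auto
  also have "\<dots> \<le> card ({?v} \<times> (S - ?E)) + card (?f ` pocket_entries w i)" by (rule card_Un_le)
  also have "\<dots> \<le> card (S - ?E) + card (pocket_entries w i)"
    using card_image_le[OF finite_pocket_entries, of ?f w i] by (simp add: card_cartesian_product)
  also have "card (S - ?E) = card S - card ?E" using S_finite by (intro card_Diff_subset) auto
  finally have "card (edge_boundary G S ?B) \<le> card S - card ?E + card (pocket_entries w i)" .
  moreover have "card S \<le> card (edge_boundary G S ?B)"
    using finite_pockets pockets_mem[OF assms] vc by (intro edge_boundary_ge[OF gen inf]) auto
  moreover have "card ?E \<le> card S" using S_finite by (intro card_mono) auto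
  ultimately show ?thesis by linarith
qed

text \<open>Every edge that is unavailable at one vertex of the walk is charged to an unused extension at
  an earlier vertex: an edge back to the walk to its reverse, an edge into a pocket to an edge
  entering that pocket.\<close>

lemma sum_card_children:
  assumes ext: "extendable w"
  shows "length w * card S \<le> 2 * (\<Sum>k<length w. card (children w k))"
proof -
  define n where "n = length w"
  let ?v = "vertex w"
  have w: "w \<in> lists S" using ext by (simp add: extendable_def)
  have vc: "?v k \<in> carrier G" for k using vertex_closed[OF w] .
  have nxt: "w ! j \<in> children w j" "?v j \<otimes> w ! j = ?v (Suc j)" if "j < n" for j
  proof -
    have "w ! j \<in> S" using w that n_def by (metis in_listsD nth_mem)
    then show "?v j \<otimes> w ! j = ?v (Suc j)" "w ! j \<in> children w j"
      using ext that w vertex_Suc[OF w] by (auto simp: extendable_def children_def n_def)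
  qed
  define Ch where "Ch = (SIGMA j:{..<n}. children w j - {w ! j})"
  define bad where "bad i = {s \<in> S - children w i. \<not> (0 < i \<and> ?v i \<otimes> s = ?v (i - 1))}" for i
  define backward where "backward = {(i, s). i < n \<and> s \<in> bad i \<and> ?v i \<otimes> s \<in> visited w i}"
  define into_pockets where "into_pockets = (SIGMA i:{..<n}. {s \<in> S. ?v i \<otimes> s \<in> pockets w i})"
  define idx where "idx = inv_into {..n} ?v"
  define f where "f = (\<lambda>(i, s). (idx (?v i \<otimes> s), inv s))"
  define entries where "entries = (\<Union>i<n. pocket_entries w i)"
  have fin_bad: "finite (bad i)" for i using S_finite by (simp add: bad_def)
  have fin_Ch: "finite Ch" using finite_children by (auto simp: Ch_def)
  have fin_back: "finite backward"
    by (rule finite_subset[of _ "{..<n} \<times> S"]) (auto simp: backward_def bad_def S_finite)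
  have inj: "inj_on ?v {..n}" using vertex_inj[OF ext] by (auto simp: inj_on_def n_def)
  have idx: "idx (?v j) = j" if "j \<le> n" for j using inj that by (simp add: idx_def)
  have backE: "\<exists>j. j < i \<and> Suc j \<noteq> i \<and> ?v i \<otimes> s = ?v j \<and> ?v j \<otimes> inv s = ?v i \<and> s \<in> S \<and> i < n"
    if "(i, s) \<in> backward" for i s
  proof -
    have s: "s \<in> S" "i < n" "\<not> (0 < i \<and> ?v i \<otimes> s = ?v (i - 1))" "?v i \<otimes> s \<in> visited w i"
      using that by (auto simp: backward_def bad_def)
    then obtain j where j: "j \<le> i" "?v i \<otimes> s = ?v j" by (auto simp: visited_def)
    have "j \<noteq> i" using j(2) s(1) vc[of i] one_notin_S by auto
    moreover have "Suc j \<noteq> i" using s(3) j by auto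
    moreover have "?v j \<otimes> inv s = ?v i" using s(1) vc by (simp add: m_assoc flip: j(2))
    ultimately show ?thesis using j s by (intro exI[of _ j]) auto
  qed
  have f_back: "f (i, s) \<in> Ch \<and> (\<exists>l<n. ?v (fst (f (i, s))) \<otimes> snd (f (i, s)) = ?v l)"
    if mem: "(i, s) \<in> backward" for i s
  proof -
    obtain j where j: "j < i" "Suc j \<noteq> i" "?v i \<otimes> s = ?v j" "?v j \<otimes> inv s = ?v i" "s \<in> S" "i < n"
      using backE[OF mem] by blast
    have "big (visited w j) (?v i)" using big_vertex[OF ext, of j i] j n_def by simp
    then have "inv s \<in> children w j" using j S_inv by (simp add: children_def)
    moreover have "inv s \<noteq> w ! j"
    proof
      assume "inv s = w ! j"
      then have "?v i = ?v (Suc j)" using nxt(2)[of j] j by simp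
      then show False using vertex_inj[OF ext, of i "Suc j"] j n_def by simp
    qed
    moreover have "f (i, s) = (j, inv s)" using j idx[of j] by (simp add: f_def)
    ultimately show ?thesis using j by (auto simp: Ch_def)
  qed
  have inj_f: "inj_on f backward"
  proof (rule inj_onI, clarify)
    fix i s i' s' assume b: "(i, s) \<in> backward" "(i', s') \<in> backward" and eq: "f (i, s) = f (i', s')"
    obtain j where j: "j < i" "?v i \<otimes> s = ?v j" "s \<in> S" "i < n" using backE[OF b(1)] by blast
    obtain j' where j': "j' < i'" "?v i' \<otimes> s' = ?v j'" "s' \<in> S" "i' < n" using backE[OF b(2)] by blast
    have eqs: "j = j'" "inv s = inv s'" using eq j j' idx[of j] idx[of j'] by (simp_all add: f_def)
    then have "s = s'" using j(3) j'(3) by (metis S_closed inv_inv)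
    have "?v i \<otimes> s = ?v i' \<otimes> s" using j(2) j'(2) eqs \<open>s = s'\<close> by simp
    then have "?v i = ?v i'" using right_cancel[of s "?v i" "?v i'"] vc S_closed[OF j(3)] by blast
    then show "i = i' \<and> s = s'" using inj j j' \<open>s = s'\<close> by (simp add: inj_on_def)
  qed
  have entries_Ch: "entries \<subseteq> Ch"
  proof
    fix p assume "p \<in> entries"
    then obtain i j s where p: "p = (j, s)" "i < n" "j < i" "s \<in> S" "?v j \<otimes> s \<in> pockets w i"
      by (auto simp: entries_def pocket_entries_def)
    have "big (visited w j) (?v j \<otimes> s)"
      using pockets_earlier_big[OF ext p(3) _ p(5)] p n_def by simp
    moreover have "?v j \<otimes> s \<noteq> ?v (Suc j)"
      using pockets_not_vertex[OF ext _ p(5), of "Suc j"] p n_def by simp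
    ultimately show "p \<in> Ch" using p nxt(2)[of j] by (auto simp: Ch_def children_def)
  qed
  \<comment> \<open>Reversed edges end at vertices of the walk, pocket entries in pockets, which the
    walk never meets; so no extension is charged for both reasons.\<close>
  have disj: "f ` backward \<inter> entries = {}"
  proof (rule ccontr)
    assume "f ` backward \<inter> entries \<noteq> {}"
    then obtain p where p: "p \<in> f ` backward" "p \<in> entries" by blast
    obtain i where "i < n" "?v (fst p) \<otimes> snd p \<in> pockets w i"
      using p(2) by (auto simp: entries_def pocket_entries_def)
    moreover obtain l where "l < n" "?v (fst p) \<otimes> snd p = ?v l" using p(1) f_back by force
    ultimately show False using pockets_not_vertex[OF ext, of i "?v l" l] n_def by auto
  qed
  have pockets_disj: "pockets w i \<inter> pockets w i' = {}" if "i < i'" "i' < n" for i i'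
  proof -
    have "y \<notin> pockets w i" if "y \<in> pockets w i'" for y
      using pockets_earlier_big[OF ext \<open>i < i'\<close> _ that] pockets_mem(3)[OF w, of y i] \<open>i' < n\<close> n_def by auto
    then show ?thesis by blast
  qed
  have "card into_pockets = (\<Sum>i<n. card {s \<in> S. ?v i \<otimes> s \<in> pockets w i})"
    unfolding into_pockets_def using S_finite by (subst card_SigmaI) auto
  also have "\<dots> \<le> (\<Sum>i<n. card (pocket_entries w i))"
    by (intro sum_mono pocket_entries_ge[OF w])
  also have "\<dots> = card entries"
    unfolding entries_def
  proof (rule card_UN_disjoint[symmetric])
    have "pocket_entries w i \<inter> pocket_entries w j = {}" if "i < j" "j < n" for i j
      using pockets_disj[OF that] by (auto simp: pocket_entries_def)
    then show "\<forall>i\<in>{..<n}. \<forall>j\<in>{..<n}. i \<noteq> j \<longrightarrow> pocket_entries w i \<inter> pocket_entries w j = {}"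
      by (metis Int_commute lessThan_iff nat_neq_iff)
  qed (auto simp: finite_pocket_entries)
  finally have into_pockets: "card into_pockets \<le> card entries" .
  have "(SIGMA i:{..<n}. bad i) \<subseteq> backward \<union> into_pockets"
  proof (rule subsetI, rule UnCI)
    fix p assume "p \<in> (SIGMA i:{..<n}. bad i)" "p \<notin> into_pockets"
    then obtain i s where p: "p = (i, s)" and i: "i < n" "s \<in> bad i" and neg: "(i, s) \<notin> into_pockets"
      by blast
    have s: "s \<in> S" "\<not> big (visited w i) (?v i \<otimes> s)" using i by (auto simp: bad_def children_def)
    have "?v i \<otimes> s \<notin> pockets w i" using neg i s by (auto simp: into_pockets_def)
    then have "?v i \<otimes> s \<in> visited w i" using pockets_iff[OF w s(1)] s(2) by blast
    then show "p \<in> backward" using i p by (auto simp: backward_def)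
  qed
  then have "card (SIGMA i:{..<n}. bad i) \<le> card (backward \<union> into_pockets)"
    using fin_back S_finite by (intro card_mono) (auto simp: into_pockets_def)
  also have "\<dots> \<le> card backward + card into_pockets" by (rule card_Un_le)
  also have "\<dots> \<le> card (f ` backward) + card entries" using into_pockets inj_f by (simp add: card_image)
  also have "\<dots> = card (f ` backward \<union> entries)"
    using fin_back disj by (intro card_Un_disjoint[symmetric]) (auto simp: entries_def finite_pocket_entries)
  also have "\<dots> \<le> card Ch" using f_back entries_Ch fin_Ch by (intro card_mono) auto
  finally have "card (SIGMA i:{..<n}. bad i) \<le> card Ch" .
  moreover have "card Ch = (\<Sum>j<n. card (children w j - {w ! j}))"
    unfolding Ch_def using finite_children by (subst card_SigmaI) auto
  moreover have "card (SIGMA i:{..<n}. bad i) = (\<Sum>i<n. card (bad i))"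
    using fin_bad by (subst card_SigmaI) auto
  moreover have "(\<Sum>j<n. card (children w j - {w ! j})) + n = (\<Sum>j<n. card (children w j))"
  proof -
    have "card (children w j - {w ! j}) + 1 = card (children w j)" if "j < n" for j
      using card_Suc_Diff1[OF finite_children nxt(1)[OF that]] by simp
    then have "(\<Sum>j<n. card (children w j)) = (\<Sum>j<n. card (children w j - {w ! j}) + 1)"
      by (intro sum.cong) auto
    then show ?thesis by (simp add: sum.distrib sum_Suc)
  qed
  moreover have "n * card S \<le> (\<Sum>i<n. card (children w i)) + (\<Sum>i<n. card (bad i)) + n"
  proof -
    have "card S \<le> card (children w i) + card (bad i) + 1" for i
    proof -
      \<comment> \<open>At i = 0 the truncated i - 1 turns the extra element into the identity,
        harmless for an upper bound.\<close>
      have "S \<subseteq> children w i \<union> bad i \<union> {inv (?v i) \<otimes> ?v (i - 1)}"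
      proof
        fix s assume "s \<in> S"
        moreover have "s = inv (?v i) \<otimes> (?v i \<otimes> s)" using \<open>s \<in> S\<close> vc by (simp flip: m_assoc)
        ultimately show "s \<in> children w i \<union> bad i \<union> {inv (?v i) \<otimes> ?v (i - 1)}"
          by (auto simp: bad_def)
      qed
      then have "card S \<le> card (children w i \<union> bad i \<union> {inv (?v i) \<otimes> ?v (i - 1)})"
        using finite_children fin_bad by (intro card_mono) auto
      also have "\<dots> \<le> card (children w i \<union> bad i) + card {inv (?v i) \<otimes> ?v (i - 1)}" by (rule card_Un_le)
      also have "\<dots> \<le> card (children w i) + card (bad i) + 1" using card_Un_le[of "children w i" "bad i"] by simp
      finally show ?thesis .
    qed
    then have "(\<Sum>i<n. card S) \<le> (\<Sum>i<n. card (children w i) + card (bad i) + 1)" by (rule sum_mono)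
    then show ?thesis by (simp add: sum.distrib sum_Suc)
  qed
  ultimately show ?thesis unfolding n_def by linarith
qed

text \<open>The letter leading straight back to the previous vertex is never a continuation.\<close>

lemma card_children_le:
  assumes "extendable w" "k < length w" "0 < k"
  shows "card (children w k) < card S"
proof -
  have w: "w \<in> lists S" using assms by (simp add: extendable_def)
  obtain j where k: "k = Suc j" using assms(3) by (cases k) auto
  let ?s = "w ! j"
  have s: "?s \<in> S" using w k assms(2) by (metis in_listsD nth_mem Suc_lessD)
  have "vertex w k = vertex w j \<otimes> ?s" using vertex_Suc[OF w, of j] k assms(2) by simp
  then have "vertex w k \<otimes> inv ?s = vertex w j" using s vertex_closed[OF w, of j] by (simp add: m_assoc)
  then have "inv ?s \<notin> children w k"
    using big_mem(2)[of "visited w k" "vertex w j"] vertex_visited[of j k w] k by (auto simp: children_def)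
  then have "children w k \<subset> S" using S_inv[OF s] by (auto simp: children_def)
  then show ?thesis using S_finite by (rule psubset_card_mono[rotated])
qed

end

text \<open>The chord of the convex function taking t to b^t lies above it between t = 0 and t = 1.
  Equality holds at d = 1 and d = b, the extreme branching numbers.\<close>

lemma powr_le_linear:
  fixes b d :: real
  assumes "1 \<le> d" "d \<le> b" "1 < b"
  shows "b powr ((d - 1) / (b - 1)) \<le> d"
proof -
  define t where "t = (d - 1) / (b - 1)"
  have "0 \<le> t" "t \<le> 1" using assms by (simp_all add: t_def divide_le_eq_1)
  then have "b powr t * 1 powr (1 - t) \<le> t * b + (1 - t) * 1"
    using assms by (intro Youngs_inequality_0) auto
  also have "\<dots> = 1 + t * (b - 1)" by (simp add: algebra_simps)
  also have "\<dots> = d" using assms by (simp add: t_def)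
  finally show ?thesis by (simp add: t_def)
qed

text \<open>After the chord bound only the sum of the degrees matters, and an average of (b + 1) / 2
  yields b^(n/2). The start vertex may have degree b + 1; capping it at b costs at most a factor
  b.\<close>

lemma prod_degrees_ge:
  fixes d :: "nat \<Rightarrow> nat" and b n :: nat
  assumes b: "3 \<le> b" and d1: "\<And>k. k < n \<Longrightarrow> 1 \<le> d k" and d0: "d 0 \<le> b + 1"
    and db: "\<And>k. k < n \<Longrightarrow> 0 < k \<Longrightarrow> d k \<le> b" and sum: "n * (b + 1) \<le> 2 * (\<Sum>k<n. d k)"
  shows "sqrt 3 ^ n / real b \<le> (\<Prod>k<n. real (d k))"
proof -
  define e where "e k = min (d k) b" for k
  have "(\<Sum>k<n. d k) \<le> (\<Sum>k<n. e k + (if k = 0 then 1 else 0))"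
    using d0 db by (intro sum_mono) (auto simp: e_def)
  also have "\<dots> \<le> (\<Sum>k<n. e k) + 1" by (simp add: sum.distrib)
  finally have "n * (b + 1) \<le> 2 * (\<Sum>k<n. e k) + 2" using sum by linarith
  then have "real (n * (b + 1)) \<le> real (2 * (\<Sum>k<n. e k) + 2)" by (rule of_nat_mono)
  then have "real n * (real b + 1) \<le> 2 * (\<Sum>k<n. real (e k)) + 2" by (simp add: algebra_simps)
  then have e: "real n * (real b + 1) / 2 - 1 \<le> (\<Sum>k<n. real (e k))" by linarith
  \<comment> \<open>The exponent falls short of n / 2 by 1 / (b - 1), which is rounded up to
    one.\<close>
  have "real n / 2 - 1 \<le> real n / 2 - 1 / (real b - 1)" using b by (simp add: field_simps)
  also have "\<dots> = (real n * (real b + 1) / 2 - 1 - real n) / (real b - 1)"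
    using b by (simp add: field_simps)
  also have "\<dots> \<le> ((\<Sum>k<n. real (e k)) - real n) / (real b - 1)"
    using e b by (intro divide_right_mono) auto
  also have "\<dots> = (\<Sum>k<n. (real (e k) - 1) / (real b - 1))"
    by (simp add: sum_subtractf flip: sum_divide_distrib)
  finally have "real b powr (real n / 2 - 1) \<le> real b powr (\<Sum>k<n. (real (e k) - 1) / (real b - 1))"
    using b by (intro powr_mono) auto
  also have "\<dots> = (\<Prod>k<n. real b powr ((real (e k) - 1) / (real b - 1)))"
    using b by (intro powr_sum) auto
  also have "\<dots> \<le> (\<Prod>k<n. real (d k))"
  proof (intro prod_mono conjI)
    fix k assume "k \<in> {..<n}"
    then have "1 \<le> e k" "e k \<le> b" "e k \<le> d k" using d1 b by (auto simp: e_def)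
    then have "real b powr ((real (e k) - 1) / (real b - 1)) \<le> real (e k)"
      using b by (intro powr_le_linear) auto
    then show "real b powr ((real (e k) - 1) / (real b - 1)) \<le> real (d k)"
      using \<open>e k \<le> d k\<close> by linarith
  qed simp
  finally have lower: "real b powr (real n / 2) / real b \<le> (\<Prod>k<n. real (d k))"
    using b by (simp add: powr_diff)
  have sqrt: "sqrt 3 ^ n = 3 powr (real n / 2)"
    by (simp add: powr_half_sqrt[symmetric] powr_powr flip: powr_realpow)
  have "3 powr (real n / 2) / real b \<le> real b powr (real n / 2) / real b"
    using b by (intro divide_right_mono powr_mono2) auto
  then show ?thesis unfolding sqrt using lower by linarith
qed

text \<open>Every walk has probability at most b / (sqrt 3)^n and the probabilities sum to one, so
  there are at least (sqrt 3)^n / b walks.\<close>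

lemma (in infinite_cayley) connective_constant_ge_sqrt3:
  assumes "4 \<le> card S"
  shows "cayley_connective_constant G S \<ge> sqrt 3"
proof -
  define b where "b = card S - 1"
  have b: "3 \<le> b" "b + 1 = card S" using assms by (auto simp: b_def)
  have "sqrt 3 ^ n \<le> real b * real n * real (card (saw_words G S n))" if n: "n \<ge> 1" for n
  proof -
    have prod: "(\<Prod>k<n. 1 / real (card (children w k))) \<le> real b / sqrt 3 ^ n"
      if "w \<in> extendable_words n" for w
    proof -
      have w: "extendable w" "length w = n" using that by (auto simp: extendable_words_def)
      have "w ! k \<in> children w k" if "k < n" for k
      proof -
        have "w ! k \<in> S" using w that by (metis in_listsD nth_mem extendable_def)
        then show ?thesis using w that vertex_Suc[of w k] by (auto simp: extendable_def children_def)
      qed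
      then have deg1: "1 \<le> card (children w k)" if "k < n" for k
        using that finite_children[of w k] by (metis card_gt_0_iff Suc_leI One_nat_def empty_iff)
      have deg0: "card (children w 0) \<le> b + 1"
        unfolding b(2) using S_finite by (intro card_mono) (auto simp: children_def)
      have degb: "card (children w k) \<le> b" if "k < n" "0 < k" for k
        using card_children_le[OF w(1), of k] that w b by linarith
      have "n * (b + 1) \<le> 2 * (\<Sum>k<n. card (children w k))"
        using sum_card_children[OF w(1)] w b by simp
      from prod_degrees_ge[OF b(1) deg1 deg0 degb this]
      have "sqrt 3 ^ n / real b \<le> (\<Prod>k<n. real (card (children w k)))" .
      then have "1 / (\<Prod>k<n. real (card (children w k))) \<le> 1 / (sqrt 3 ^ n / real b)"
        using b by (intro divide_left_mono mult_pos_pos) (auto intro: less_le_trans[of _ "sqrt 3 ^ n / real b"])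
      then show ?thesis by (simp add: prod_dividef)
    qed
    have "1 = (\<Sum>w\<in>extendable_words n. \<Prod>k<n. 1 / real (card (children w k)))"
      by (rule extendable_words_flow[symmetric])
    also have "\<dots> \<le> real (card (extendable_words n)) * (real b / sqrt 3 ^ n)"
      using prod by (rule sum_bounded_above)
    finally have "sqrt 3 ^ n \<le> real b * real (card (extendable_words n))"
      by (simp add: field_simps)
    moreover have "card (extendable_words n) \<le> card (saw_words G S n)"
      using extendable_saw finite_saw_words[OF S_finite]
      by (intro card_mono) (auto simp: extendable_words_def saw_words_def extendable_def)
    then have "real b * real (card (extendable_words n)) \<le> real b * real (card (saw_words G S n))"
      by (intro mult_left_mono) auto
    moreover have "real b * real (card (saw_words G S n)) \<le> real b * real n * real (card (saw_words G S n))"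
      using n by (intro mult_right_mono) (auto simp: mult_le_cancel_left1)
    ultimately show ?thesis by linarith
  qed
  then have "\<exists>n\<ge>N. sqrt 3 ^ n \<le> real b * real n * real (card (saw_words G S n))" for N
    by (intro exI[of _ "max N 1"]) auto
  then show ?thesis by (intro connective_constant_geI[OF S_finite S_carrier]) auto
qed

section \<open>Cubic Cayley graphs with a height function\<close>

text \<open>A letter of nonzero height differs from its inverse, and the two take up two of the
  three letters. The third is then its own inverse and has height zero. Every nonempty suffix of a
  block contains the ascending letter, so its product with an element of nonnegative height has
  positive height.\<close>

lemma (in group) golden_height:
  fixes h :: "'a \<Rightarrow> int"
  assumes S: "generator_set G S" "card S = 3"
    and h: "\<And>x y. x \<in> carrier G \<Longrightarrow> y \<in> carrier G \<Longrightarrow> h (x \<otimes> y) = h x + h y"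
    and t: "t \<in> carrier G" "h t \<noteq> 0"
  shows "cayley_connective_constant G S \<ge> golden_mean"
proof -
  have fin: "finite S" "S \<subseteq> carrier G" and one: "\<one> \<notin> S" using S by (auto simp: generator_set_def)
  have invS: "inv s \<in> S" if "s \<in> S" for s using S(1) that unfolding generator_set_def by blast
  have h1: "h \<one> = 0" using h[of \<one> \<one>] by simp
  have hinv: "h (inv x) = - h x" if "x \<in> carrier G" for x
    using h[of "inv x" x] that h1 by simp
  have nz: "x \<noteq> \<one>" if "h x \<noteq> 0" for x using h1 that by auto
  have "\<exists>s\<in>S. h s \<noteq> 0"
  proof (rule ccontr)
    assume neg: "\<not> ?thesis"
    obtain w where w: "w \<in> lists S" "wprod G w = t" using generator_set_wprod[OF S(1) t(1)] by blast
    from w(1) have "h (wprod G w) = 0"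
    proof (induction w)
      case (Cons s w)
      then have "wprod G w \<in> carrier G" using fin by (intro wprod_closed) auto
      then show ?case using Cons neg fin by (auto simp: h)
    qed (simp add: h1)
    then show False using w t by simp
  qed
  then obtain s where s: "s \<in> S" "h s \<noteq> 0" by blast
  have "h s > 0 \<or> h (inv s) > 0" using s hinv fin by force
  then obtain a where a: "a \<in> S" "h a > 0" using s invS by blast
  have ac: "a \<in> carrier G" using a fin by blast
  have aa: "inv a \<noteq> a" using hinv[OF ac] a by auto
  have "card (S - {a, inv a}) = 1"
    using S(2) a(1) invS[OF a(1)] aa by (subst card_Diff_subset) auto
  then obtain b where "S - {a, inv a} = {b}" by (rule card_1_singletonE)
  then have b: "S = {a, inv a, b}" "b \<noteq> a" "b \<noteq> inv a" using a invS by auto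
  then have bc: "b \<in> carrier G" and b1: "b \<noteq> \<one>" using fin one by auto
  have "inv b \<noteq> a" "inv b \<noteq> inv a" using b(2,3) ac bc by (metis inv_inv)+
  then have "inv b = b" using invS[of b] b by auto
  then have hb: "h b = 0" using hinv[OF bc] by simp
  let ?X = "{[a], [b, a]}" and ?Q = "{g \<in> carrier G. h g \<ge> 0}"
  have ne: "a \<noteq> \<one>" "b \<otimes> a \<noteq> \<one>" using a hb ac bc by (auto intro!: nz simp: h)
  have ga: "a \<otimes> g \<noteq> \<one>" "b \<otimes> (a \<otimes> g) \<noteq> \<one>" if "g \<in> ?Q" for g
    using a hb ac bc that by (auto intro!: nz simp: h)
  have safe: "safe_block G ?Q x" if "x \<in> ?X" for x
    using that a hb ac bc b1 ne ga h1
    by (auto simp: safe_block_def suffix_Cons prefix_Cons h m_assoc)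
  have code: "prefix_code ?X" using b(2) by (auto simp: prefix_code_def)
  have "(\<Sum>x\<in>?X. (1 / golden_mean) ^ length x) = 1 / golden_mean + (1 / golden_mean)\<^sup>2"
    by (simp add: power2_eq_square)
  then have kraft: "(\<Sum>x\<in>?X. (1 / golden_mean) ^ length x) \<ge> 1" using golden_mean_kraft(1) by simp
  show ?thesis
    by (rule connective_constant_ge_golden_code[OF fin code _ kraft safe]) (use a b h1 in auto)
qed

section \<open>Minimal generator sets\<close>

lemma (in group) generate_finite_subset:
  assumes "X \<subseteq> carrier G" "g \<in> generate G X"
  shows "\<exists>Y. finite Y \<and> Y \<subseteq> X \<and> g \<in> generate G Y"
  using assms(2)
proof induction
  case one
  show ?case by (rule exI[of _ "{}"]) (auto intro: generate.one)
next
  case (incl h)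
  then show ?case by (intro exI[of _ "{h}"]) (auto intro: generate.incl)
next
  case (inv h)
  then show ?case by (intro exI[of _ "{h}"]) (auto intro: generate.inv)
next
  case (eng a b)
  then obtain Y Z where Y: "finite Y" "Y \<subseteq> X" "a \<in> generate G Y"
    and Z: "finite Z" "Z \<subseteq> X" "b \<in> generate G Z" by blast
  have "generate G Y \<subseteq> generate G (Y \<union> Z)" "generate G Z \<subseteq> generate G (Y \<union> Z)"
    by (simp_all add: mono_generate)
  then show ?case using Y Z by (intro exI[of _ "Y \<union> Z"]) (auto intro: generate.eng)
qed

text \<open>Each of finitely many generators is a product over a finite part of X. The union of
  these parts, closed under inverses and freed of the identity, is a generator set.\<close>

lemma (in group) generator_set_within:
  assumes fg: "finitely_generated_group G" and X: "X \<subseteq> carrier G" "generate G X = carrier G"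
    and inv: "\<And>x. x \<in> X \<Longrightarrow> inv x \<in> X"
  shows "\<exists>S\<subseteq>X. generator_set G S"
proof -
  obtain A where A: "finite A" "A \<subseteq> carrier G" "generate G A = carrier G"
    using fg by (auto simp: finitely_generated_group_def)
  have "\<forall>a\<in>A. \<exists>Y. finite Y \<and> Y \<subseteq> X \<and> a \<in> generate G Y"
  proof
    fix a assume "a \<in> A"
    then have "a \<in> generate G X" using A(2) X(2) by blast
    then show "\<exists>Y. finite Y \<and> Y \<subseteq> X \<and> a \<in> generate G Y" by (rule generate_finite_subset[OF X(1)])
  qed
  from bchoice[OF this] obtain Y
    where Y: "\<And>a. a \<in> A \<Longrightarrow> finite (Y a) \<and> Y a \<subseteq> X \<and> a \<in> generate G (Y a)" by blast
  define T where "T = (\<Union>a\<in>A. Y a)"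
  define S where "S = (T \<union> (\<lambda>x. inv x) ` T) - {\<one>}"
  have T: "finite T" "T \<subseteq> X" "T \<subseteq> carrier G" using A(1) Y X(1) unfolding T_def by blast+
  have SX: "S \<subseteq> X" using T(2) inv unfolding S_def by blast
  then have Sc: "S \<subseteq> carrier G" using X by blast
  have "T \<subseteq> generate G S"
  proof
    fix x assume "x \<in> T"
    then show "x \<in> generate G S"
      by (cases "x = \<one>") (auto simp: S_def intro: generate.one generate.incl)
  qed
  then have TS: "generate G T \<subseteq> generate G S"
    using generate_is_subgroup[OF Sc] by (rule generate_subgroup_incl)
  have "A \<subseteq> generate G S"
  proof
    fix a assume a: "a \<in> A"
    then have "generate G (Y a) \<subseteq> generate G T" by (intro mono_generate) (auto simp: T_def)
    then show "a \<in> generate G S" using Y[OF a] TS by blast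
  qed
  then have "generate G A \<subseteq> generate G S"
    using generate_is_subgroup[OF Sc] by (rule generate_subgroup_incl)
  then have gen: "generate G S = carrier G" using A(3) generate_incl[OF Sc] by blast
  have "(\<lambda>x. inv x) ` S = S"
  proof -
    have sub: "(\<lambda>x. inv x) ` S \<subseteq> S" using T(3) by (auto simp: S_def subset_iff)
    have "x = inv (inv x)" "inv x \<in> S" if "x \<in> S" for x using that sub Sc by auto
    then show ?thesis using sub by blast
  qed
  then have "generator_set G S" using gen T Sc by (simp add: generator_set_def S_def)
  then show ?thesis using SX by blast
qed

lemma minimal_generator_subset:
  assumes "generator_set G S"
  shows "\<exists>T\<subseteq>S. minimal_generator_set G T"
proof -
  obtain T where T: "T \<subseteq> S \<and> generator_set G T"
    "\<And>U. U \<subseteq> S \<and> generator_set G U \<Longrightarrow> card T \<le> card U"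
    using ex_has_least_nat[of "\<lambda>T. T \<subseteq> S \<and> generator_set G T" S card] assms by blast
  have "\<not> generator_set G U" if "U \<subset> T" for U
  proof
    assume U: "generator_set G U"
    have "finite T" using T(1) by (simp add: generator_set_def)
    then have "card U < card T" using that by (rule psubset_card_mono)
    moreover have "card T \<le> card U" using T U that by blast
    ultimately show False by simp
  qed
  then show ?thesis using T(1) by (auto simp: minimal_generator_set_def)
qed

lemma min_generator_card_le: "generator_set G S \<Longrightarrow> min_generator_card G \<le> card S"
  unfolding min_generator_card_def by (rule Least_le) blast

lemma min_generator_card_attained:
  assumes "generator_set G S"
  shows "\<exists>T. generator_set G T \<and> card T = min_generator_card G"
  unfolding min_generator_card_def
  by (rule LeastI[of "\<lambda>k. \<exists>T. generator_set G T \<and> card T = k" "card S"]) (use assms in blast)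

lemma minimal_generator_setI:
  assumes "generator_set G S" "card S = min_generator_card G"
  shows "minimal_generator_set G S"
proof -
  have "\<not> generator_set G U" if "U \<subset> S" for U
  proof
    assume "generator_set G U"
    from min_generator_card_le[OF this] have "card S \<le> card U" using assms by simp
    moreover have "card U < card S"
      using assms(1) that by (intro psubset_card_mono) (auto simp: generator_set_def)
    ultimately show False by simp
  qed
  then show ?thesis using assms by (simp add: minimal_generator_set_def)
qed

section \<open>Ends of virtually cyclic groups\<close>

lemma verts_cayley [simp]: "verts (cayley_graph G S) = carrier G"
  by (simp add: cayley_graph_def)

lemma sccs_verts_subset_verts: "C \<in> pre_digraph.sccs_verts D \<Longrightarrow> C \<subseteq> verts D"
  unfolding pre_digraph.sccs_verts_def by (auto elim: reachable_in_vertsE)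

lemma graph_ends_finite:
  assumes "finite (verts D)"
  shows "graph_ends D = 0"
proof -
  have "infinite_components_off D F = {}" for F
    using sccs_verts_subset_verts assms
    by (auto simp: infinite_components_off_def induce_subgraph_def dest!: sccs_verts_subset_verts intro: finite_subset)
  then have "graph_ends D \<le> 0"
    unfolding graph_ends_def by (intro SUP_least) (simp add: ecard_def zero_enat_def)
  then show ?thesis by simp
qed

lemma sccs_verts_unique:
  assumes "C \<in> pre_digraph.sccs_verts D" "p \<in> C"
  shows "C = {v. reachable D p v \<and> reachable D v p}"
  using assms unfolding pre_digraph.sccs_verts_def by blast

context group
begin

lemma arcs_ends_cayley_off:
  "arcs_ends (cayley_graph G S \<restriction> (carrier G - Y))
    = {(x, x \<otimes> s) | x s. x \<in> carrier G - Y \<and> s \<in> S \<and> x \<otimes> s \<in> carrier G - Y}"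
  by (force simp: arcs_ends_def arc_to_ends_def induce_subgraph_def cayley_graph_def)

lemma symmetric_cayley_off:
  assumes "generator_set G S"
  shows "symmetric (cayley_graph G S \<restriction> (carrier G - Y))"
  unfolding symmetric_def
proof (rule symI)
  fix x y assume "(x, y) \<in> arcs_ends (cayley_graph G S \<restriction> (carrier G - Y))"
  then obtain s where s: "y = x \<otimes> s" "x \<in> carrier G - Y" "s \<in> S" "y \<in> carrier G - Y"
    by (auto simp: arcs_ends_cayley_off)
  have "inv s \<in> S" using assms s(3) unfolding generator_set_def by blast
  moreover have "s \<in> carrier G" using assms s(3) by (auto simp: generator_set_def)
  then have "y \<otimes> inv s = x" using s by (simp add: m_assoc)
  ultimately show "(y, x) \<in> arcs_ends (cayley_graph G S \<restriction> (carrier G - Y))"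
    unfolding arcs_ends_cayley_off using s by blast
qed

lemma reachable_cayley_off:
  assumes S: "S \<subseteq> carrier G"
  shows "g \<in> carrier G \<Longrightarrow> u \<in> lists S \<Longrightarrow> (\<And>v. prefix v u \<Longrightarrow> g \<otimes> wprod G v \<notin> Y) \<Longrightarrow>
    reachable (cayley_graph G S \<restriction> (carrier G - Y)) g (g \<otimes> wprod G u)"
proof (induction u arbitrary: g)
  case Nil
  then show ?case by (auto simp: reachable_def)
next
  case (Cons s u)
  have s: "s \<in> carrier G" "s \<in> S" "set u \<subseteq> carrier G" using Cons.prems(2) S by auto
  have "g \<notin> Y" using Cons.prems(3)[of "[]"] Cons.prems(1) by simp
  have gs: "g \<otimes> s \<notin> Y" using Cons.prems(3)[of "[s]"] s by simp
  have "g \<otimes> s \<otimes> wprod G v \<notin> Y" if "prefix v u" for v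
  proof -
    have "set v \<subseteq> carrier G" using s(3) set_mono_prefix[OF that] by blast
    then show ?thesis using Cons.prems(3)[of "s # v"] that Cons.prems(1) s by (simp add: m_assoc)
  qed
  then have "reachable (cayley_graph G S \<restriction> (carrier G - Y)) (g \<otimes> s) (g \<otimes> s \<otimes> wprod G u)"
    using Cons.prems s by (intro Cons.IH) auto
  moreover have "(g, g \<otimes> s) \<in> arcs_ends (cayley_graph G S \<restriction> (carrier G - Y))"
    using Cons.prems(1) s gs \<open>g \<notin> Y\<close> by (auto simp: arcs_ends_cayley_off)
  moreover have "g \<in> verts (cayley_graph G S \<restriction> (carrier G - Y))"
    using Cons.prems(1) \<open>g \<notin> Y\<close> by (simp add: induce_subgraph_def)
  ultimately have "reachable (cayley_graph G S \<restriction> (carrier G - Y)) g (g \<otimes> s \<otimes> wprod G u)"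
    unfolding reachable_def by (metis converse_rtrancl_on_into_rtrancl_on)
  then show ?case using Cons.prems(1) s by (simp add: m_assoc)
qed

lemma int_pow_suc: "c \<in> carrier G \<Longrightarrow> c [^] (k + 1 :: int) = c [^] k \<otimes> c"
  by (simp add: int_pow_mult)

text \<open>Otherwise some power of c with exponent m > 0 is the identity, and the group has at most
  2 m elements.\<close>

lemma inj_int_pow:
  fixes c :: 'a
  assumes c: "c \<in> carrier G" "a \<in> carrier G" and inf: "infinite (carrier G)"
    and virt: "\<And>g. g \<in> carrier G \<Longrightarrow> \<exists>k::int. g = c [^] k \<or> g = c [^] k \<otimes> a"
  shows "inj (\<lambda>k::int. c [^] k)"
proof (rule ccontr)
  assume "\<not> inj (\<lambda>k::int. c [^] k)"
  then obtain k l :: int where kl: "k < l" "c [^] k = c [^] l"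
    unfolding inj_def by (metis linorder_neqE)
  define m where "m = l - k"
  have m: "m > 0" using kl by (simp add: m_def)
  have "c [^] m = c [^] l \<otimes> c [^] (- k)" using c by (simp add: m_def int_pow_mult[symmetric])
  also have "\<dots> = \<one>" using c kl(2)[symmetric] by (simp add: int_pow_mult[symmetric])
  finally have cm: "c [^] m = \<one>" .
  have red: "c [^] j = c [^] (j mod m)" for j :: int
  proof -
    have "c [^] j = c [^] (m * (j div m)) \<otimes> c [^] (j mod m)"
      using c(1) by (metis int_pow_mult mult_div_mod_eq)
    also have "\<dots> = (c [^] m) [^] (j div m) \<otimes> c [^] (j mod m)"
      using c by (simp add: int_pow_pow)
    finally show ?thesis using cm c by simp
  qed
  have "carrier G \<subseteq> (\<lambda>j. c [^] j) ` {0..<m} \<union> (\<lambda>j. c [^] j \<otimes> a) ` {0..<m}"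
  proof
    fix g assume "g \<in> carrier G"
    then obtain j :: int where "g = c [^] j \<or> g = c [^] j \<otimes> a" using virt by blast
    then have "g = c [^] (j mod m) \<or> g = c [^] (j mod m) \<otimes> a" using red by metis
    then show "g \<in> (\<lambda>j. c [^] j) ` {0..<m} \<union> (\<lambda>j. c [^] j \<otimes> a) ` {0..<m}" using m by auto
  qed
  then show False using inf finite_subset by blast
qed

text \<open>Away from a finite set \<open>Y\<close>, words for \<open>c\<close> and \<open>a\<close> connect \<open>c\<^sup>k\<close> to \<open>c\<^sup>k\<^sup>+\<^sup>1\<close> and \<open>c\<^sup>k a\<close>, so every infinite
  component contains \<open>c\<^sup>k\<close> for all large \<open>k\<close> or for all large \<open>-k\<close>.\<close>

lemma graph_ends_le_two:
  assumes S: "generator_set G S" and c: "c \<in> carrier G" "a \<in> carrier G"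
    and inf: "infinite (carrier G)"
    and virt: "\<And>g. g \<in> carrier G \<Longrightarrow> \<exists>k::int. g = c [^] k \<or> g = c [^] k \<otimes> a"
  shows "graph_ends (cayley_graph G S) \<le> 2"
  unfolding graph_ends_def
proof (intro SUP_least)
  fix F assume "F \<in> {F. subgraph F (cayley_graph G S) \<and> fin_digraph F}"
  then have F: "finite (verts F)" by (auto intro: fin_digraph.finite_verts)
  have Sc: "S \<subseteq> carrier G" using S by (auto simp: generator_set_def)
  define Y where "Y = verts F"
  define D where "D = cayley_graph G S \<restriction> (carrier G - Y)"
  have pow: "c [^] (k::int) \<in> carrier G" for k using c by simp
  obtain uc ua where u: "uc \<in> lists S" "wprod G uc = c" "ua \<in> lists S" "wprod G ua = a"
    using generator_set_wprod[OF S c(1)] generator_set_wprod[OF S c(2)] by blast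
  \<comment> \<open>A path labelled by one of the two words can hit Y only if it starts in
    \<open>bad\<close>.\<close>
  define P where "P = wprod G ` ({v. prefix v uc} \<union> {v. prefix v ua})"
  define bad where "bad = (\<Union>p\<in>P. (\<lambda>y. y \<otimes> inv p) ` (Y \<inter> carrier G))"
  have finP: "finite P"
  proof -
    have "{v. prefix v w} = set (prefixes w)" for w :: "'a list" by auto
    then show ?thesis by (simp add: P_def)
  qed
  have Pc: "P \<subseteq> carrier G"
  proof -
    have "wprod G v \<in> carrier G" if "prefix v w" "w \<in> lists S" for v w
      using set_mono_prefix[OF that(1)] that(2) Sc by (intro wprod_closed) auto
    then show ?thesis using u by (auto simp: P_def)
  qed
  have "finite bad" unfolding bad_def using finP F by (simp add: Y_def)
  then have "finite ((\<lambda>k::int. c [^] k) -` bad)"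
    using inj_int_pow[OF c inf virt] by (intro finite_vimageI)
  then have fin_bad: "finite (abs ` insert 0 ((\<lambda>k::int. c [^] k) -` bad))" by simp
  \<comment> \<open>The inserted 0 keeps the set nonempty for \<open>Max\<close> and makes N
    nonnegative.\<close>
  define N where "N = Max (abs ` insert 0 ((\<lambda>k::int. c [^] k) -` bad))"
  have N: "\<bar>k\<bar> \<le> N" if "c [^] k \<in> bad" for k :: int
    unfolding N_def using that by (intro Max_ge[OF fin_bad]) auto
  have N0: "N \<ge> 0"
    unfolding N_def by (rule order_trans[OF _ Max_ge[OF fin_bad, of 0]]) auto
  have good: "reachable D (c [^] k) (c [^] k \<otimes> c)" "reachable D (c [^] k) (c [^] k \<otimes> a)"
    if "\<bar>k\<bar> > N" for k :: int
  proof -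
    have off: "c [^] k \<otimes> p \<notin> Y" if "p \<in> P" for p
    proof
      assume y: "c [^] k \<otimes> p \<in> Y"
      have "c [^] k = c [^] k \<otimes> p \<otimes> inv p" using pow Pc that by (simp add: m_assoc subset_iff)
      then have "c [^] k \<in> bad" using y that pow Pc unfolding bad_def by blast
      then show False using N \<open>\<bar>k\<bar> > N\<close> by fastforce
    qed
    show "reachable D (c [^] k) (c [^] k \<otimes> c)"
      using reachable_cayley_off[OF Sc pow u(1), of k Y] off u by (auto simp: P_def D_def)
    show "reachable D (c [^] k) (c [^] k \<otimes> a)"
      using reachable_cayley_off[OF Sc pow u(3), of k Y] off u by (auto simp: P_def D_def)
  qed
  have symD: "reachable D y x" if "reachable D x y" for x y
    using symmetric_cayley_off[OF S] that unfolding D_def by (rule symmetric_reachable)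
  have trans: "reachable D x z" if "reachable D x y" "reachable D y z" for x y z
    using that unfolding reachable_def by (rule rtrancl_on_trans)
  have up: "reachable D (c [^] (N + 1)) (c [^] (N + 1 + int n))" for n
  proof (induction n)
    case 0
    have "c [^] (N + 1) \<in> verts D"
      using good(1)[of "N + 1"] N0 by (auto elim: reachable_in_vertsE)
    then show ?case by (simp add: reachable_def)
  next
    case (Suc n)
    have "c [^] (N + 1 + int n) \<otimes> c = c [^] (N + 1 + int (Suc n))"
      using c int_pow_mult[of c "N + 1 + int n" 1] by (simp add: algebra_simps)
    then show ?case using trans[OF Suc] good(1)[of "N + 1 + int n"] N0 by simp
  qed
  have down: "reachable D (c [^] (- N - 1 - int n)) (c [^] (- N - 1))" for n
  proof (induction n)
    case 0
    have "c [^] (- N - 1) \<in> verts D"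
      using good(1)[of "- N - 1"] N0 by (auto elim: reachable_in_vertsE)
    then show ?case by (simp add: reachable_def)
  next
    case (Suc n)
    have eq: "- N - 1 - int n = - N - 1 - int (Suc n) + 1" by simp
    have "c [^] (- N - 1 - int (Suc n)) \<otimes> c = c [^] (- N - 1 - int n)"
      by (subst eq) (rule int_pow_suc[OF c(1), symmetric])
    then show ?case using trans[OF _ Suc] good(1)[of "- N - 1 - int (Suc n)"] N0 by simp
  qed
  have far: "reachable D (c [^] (N + 1)) g \<or> reachable D (c [^] (- N - 1)) g"
    if "\<bar>k\<bar> > N" "g = c [^] k \<or> g = c [^] k \<otimes> a" for g and k :: int
  proof (cases "k > 0")
    case True
    then have "k = N + 1 + int (nat (k - N - 1))" using that by simp
    then have "reachable D (c [^] (N + 1)) (c [^] k)" using up by metis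
    then show ?thesis using that(2) trans good(2)[OF that(1)] by blast
  next
    case False
    then have "k = - N - 1 - int (nat (- k - N - 1))" using that by simp
    then have "reachable D (c [^] (- N - 1)) (c [^] k)" using down symD by metis
    then show ?thesis using that(2) trans good(2)[OF that(1)] by blast
  qed
  define component where "component p = {v. reachable D p v \<and> reachable D v p}" for p
  have "infinite_components_off (cayley_graph G S) F
      \<subseteq> {component (c [^] (N + 1)), component (c [^] (- N - 1))}"
  proof
    fix C assume "C \<in> infinite_components_off (cayley_graph G S) F"
    then have C: "C \<in> pre_digraph.sccs_verts D" "infinite C"
      by (auto simp: infinite_components_off_def D_def Y_def)
    let ?small = "(\<lambda>k. c [^] k) ` {- N..N} \<union> (\<lambda>k. c [^] k \<otimes> a) ` {- N..N}"
    \<comment> \<open>Only finitely many elements come from exponents up to N, so an infinite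
      component contains one beyond them, which is joined to one of the two rays.\<close>
    have "\<not> C \<subseteq> ?small" using C(2) finite_subset[of C ?small] by auto
    then obtain g where g: "g \<in> C" "g \<notin> ?small" by blast
    have "C \<subseteq> carrier G" using sccs_verts_subset_verts[OF C(1)] by (auto simp: D_def induce_subgraph_def)
    then obtain k :: int where k: "g = c [^] k \<or> g = c [^] k \<otimes> a" using virt g(1) by blast
    have "\<bar>k\<bar> > N"
    proof (rule ccontr)
      assume "\<not> \<bar>k\<bar> > N"
      then have "k \<in> {- N..N}" by auto
      then show False using k g(2) by blast
    qed
    from far[OF this k] obtain p where p: "p = c [^] (N + 1) \<or> p = c [^] (- N - 1)" "reachable D p g"
      by blast
    have "p \<in> C" using sccs_verts_unique[OF C(1) g(1)] p(2) symD by blast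
    then have "C = component p" using sccs_verts_unique[OF C(1)] by (simp add: component_def)
    then show "C \<in> {component (c [^] (N + 1)), component (c [^] (- N - 1))}" using p(1) by blast
  qed
  note sub = this
  have fin: "finite (infinite_components_off (cayley_graph G S) F)"
    by (rule finite_subset[OF sub]) simp
  have "card (infinite_components_off (cayley_graph G S) F)
      \<le> card {component (c [^] (N + 1)), component (c [^] (- N - 1))}"
    by (rule card_mono[OF _ sub]) simp
  also have "\<dots> \<le> 2" by (simp add: card_insert_if)
  finally have "card (infinite_components_off (cayley_graph G S) F) \<le> 2" .
  then have "enat (card (infinite_components_off (cayley_graph G S) F)) \<le> enat 2" by simp
  then show "ecard (infinite_components_off (cayley_graph G S) F) \<le> 2"
    using fin by (simp add: ecard_def numeral_eq_enat)
qed

text \<open>If some letter is not an involution, S consists of it and its inverse, and the group is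
  cyclic. Otherwise the group is generated by two involutions as a quotient of a dihedral group, and
  their product serves as the rotation c.\<close>

lemma generated_by_two_letters:
  assumes S: "generator_set G S" "card S \<le> 2"
  obtains c a where "c \<in> carrier G" "a \<in> carrier G"
    "\<And>g. g \<in> carrier G \<Longrightarrow> \<exists>k::int. g = c [^] k \<or> g = c [^] k \<otimes> a"
proof -
  have fin: "finite S" "S \<subseteq> carrier G" using S by (auto simp: generator_set_def)
  have invS: "inv s \<in> S" if "s \<in> S" for s using S(1) that unfolding generator_set_def by blast
  have closed: "\<exists>k::int. g = c [^] k \<or> g = c [^] k \<otimes> a"
    if ca: "c \<in> carrier G" "a \<in> carrier G" and g: "g \<in> carrier G"
      and step: "\<And>k s. s \<in> S \<Longrightarrow> \<exists>l::int. c [^] (k::int) \<otimes> s = c [^] l \<or> c [^] k \<otimes> s = c [^] l \<otimes> a"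
        "\<And>k s. s \<in> S \<Longrightarrow> \<exists>l::int. c [^] (k::int) \<otimes> a \<otimes> s = c [^] l \<or> c [^] k \<otimes> a \<otimes> s = c [^] l \<otimes> a"
    for c a g
  proof -
    obtain w where w: "w \<in> lists S" "wprod G w = g" using generator_set_wprod[OF S(1) g] by blast
    from w(1) have "\<exists>k::int. wprod G w = c [^] k \<or> wprod G w = c [^] k \<otimes> a"
    proof (induction w rule: rev_induct)
      case Nil
      show ?case by (rule exI[of _ 0]) simp
    next
      case (snoc s w)
      then have "s \<in> S" "set w \<subseteq> carrier G" "s \<in> carrier G" using fin by auto
      then have "wprod G (w @ [s]) = wprod G w \<otimes> s" by (simp add: wprod_append)
      moreover obtain k :: int where "wprod G w = c [^] k \<or> wprod G w = c [^] k \<otimes> a"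
        using snoc by auto
      ultimately show ?case using step[OF \<open>s \<in> S\<close>, of k] by auto
    qed
    then show ?thesis using w by simp
  qed
  show thesis
  proof (cases "\<exists>t\<in>S. inv t \<noteq> t")
    case True
    then obtain c where c: "c \<in> S" "inv c \<noteq> c" by blast
    have "card {c, inv c} = 2" using c by simp
    then have Sc: "S = {c, inv c}"
      using c invS fin S(2) by (intro card_seteq[symmetric]) auto
    have cc: "c \<in> carrier G" using c fin by blast
    have "\<exists>l::int. c [^] (k::int) \<otimes> s = c [^] l" if "s \<in> S" for k s
    proof -
      have "c [^] k \<otimes> c = c [^] (k + 1)" using int_pow_suc[OF cc] by simp
      moreover have "c [^] k \<otimes> inv c = c [^] (k - 1)"
        using int_pow_suc[OF cc, of "k - 1"] cc by (simp add: m_assoc)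
      ultimately show ?thesis using that Sc by auto
    qed
    then show thesis using that[of c \<one>] closed[of c \<one>] cc by simp
  next
    case False
    \<comment> \<open>Fewer than two letters are padded with the identity or by repetition.\<close>
    have "\<exists>a b. a \<in> carrier G \<and> b \<in> carrier G \<and> inv a = a \<and> inv b = b \<and> S \<subseteq> {a, b}"
    proof -
      consider "card S = 0" | "card S = 1" | "card S = 2" using S(2) by linarith
      then show ?thesis
      proof cases
        case 1
        then show ?thesis using fin by (intro exI[of _ \<one>]) auto
      next
        case 2
        then obtain x where "S = {x}" by (rule card_1_singletonE)
        then show ?thesis using fin False by (intro exI[of _ x]) auto
      next
        case 3
        then obtain x y where "S = {x, y}" by (auto simp: card_2_iff)
        then show ?thesis using fin False by (intro exI[of _ x] exI[of _ y]) auto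
      qed
    qed
    then obtain a b where ab: "a \<in> carrier G" "b \<in> carrier G" "inv a = a" "inv b = b" "S \<subseteq> {a, b}"
      by blast
    let ?c = "a \<otimes> b"
    have c: "?c \<in> carrier G" using ab by simp
    have sq: "a \<otimes> a = \<one>" "b \<otimes> b = \<one>" using r_inv[OF ab(1)] r_inv[OF ab(2)] ab(3,4) by simp_all
    have pb: "?c [^] (k::int) \<otimes> b = ?c [^] (k - 1) \<otimes> a" for k
    proof -
      have "?c [^] k \<otimes> b = ?c [^] (k - 1) \<otimes> (a \<otimes> (b \<otimes> b))"
        using int_pow_suc[OF c, of "k - 1"] c ab by (simp add: m_assoc)
      then show ?thesis using sq ab by simp
    qed
    have pa: "?c [^] (k::int) \<otimes> a \<otimes> a = ?c [^] k" "?c [^] k \<otimes> a \<otimes> b = ?c [^] (k + 1)" for k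
      using int_pow_suc[OF c, of k] c ab sq by (simp_all add: m_assoc)
    have "\<exists>k::int. g = ?c [^] k \<or> g = ?c [^] k \<otimes> a" if "g \<in> carrier G" for g
    proof (rule closed[OF c ab(1) that])
      fix k :: int and s assume "s \<in> S"
      then have s: "s = a \<or> s = b" using ab(5) by blast
      show "\<exists>l::int. ?c [^] k \<otimes> s = ?c [^] l \<or> ?c [^] k \<otimes> s = ?c [^] l \<otimes> a"
        using s pb by blast
      show "\<exists>l::int. ?c [^] k \<otimes> a \<otimes> s = ?c [^] l \<or> ?c [^] k \<otimes> a \<otimes> s = ?c [^] l \<otimes> a"
        using s pa by blast
    qed
    then show thesis using that c ab(1) by blast
  qed
qed

end

text \<open>The ends are counted in the Cayley graph of a chosen set S, while the small generator
  set T may be another one. So T only supplies c and a, and the bound of two ends is applied to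
  S.\<close>

lemma infinitely_many_ends_imp:
  assumes fg: "finitely_generated_group G" and ends: "group_ends G = \<infinity>"
  shows "\<exists>S. generator_set G S" and "infinite (carrier G)" and "3 \<le> min_generator_card G"
proof -
  interpret group G using fg by (simp add: finitely_generated_group_def)
  have "generate G (carrier G) = carrier G"
    using generate_incl[of "carrier G"] by (auto intro: generate.incl)
  then show ex: "\<exists>S. generator_set G S"
    using generator_set_within[OF fg, of "carrier G"] by auto
  define S where "S = (SOME S. generator_set G S)"
  have S: "generator_set G S" unfolding S_def using ex by (rule someI_ex)
  have e: "graph_ends (cayley_graph G S) = \<infinity>" using ends by (simp add: group_ends_def S_def)
  show inf: "infinite (carrier G)"
    using graph_ends_finite[of "cayley_graph G S"] e by auto
  show "3 \<le> min_generator_card G"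
  proof (rule ccontr)
    assume "\<not> ?thesis"
    moreover obtain T where "generator_set G T" "card T = min_generator_card G"
      using min_generator_card_attained[OF S] by blast
    ultimately have T: "generator_set G T" "card T \<le> 2" by auto
    obtain c a where "c \<in> carrier G" "a \<in> carrier G"
      "\<And>g. g \<in> carrier G \<Longrightarrow> \<exists>k::int. g = c [^]\<^bsub>G\<^esub> k \<or> g = c [^]\<^bsub>G\<^esub> k \<otimes>\<^bsub>G\<^esub> a"
      using generated_by_two_letters[OF T] by metis
    from graph_ends_le_two[OF S this(1,2) inf this(3)] e show False by simp
  qed
qed

section \<open>Amalgams and the final assembly\<close>

lemma golden_amalgam:
  assumes G: "group G" and data: "amalgam_data H K C i j" and iso: "\<psi> \<in> iso (amalgam H K C i j) G"
    and S: "generator_set G S" "S \<subseteq> \<psi> ` amalgam_factors H K C i j" "card S = 3"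
  shows "cayley_connective_constant G S \<ge> golden_mean"
proof -
  interpret amalgam_group H K C i j G \<psi>
    using G data iso
    by (simp add: amalgam_group_def amalgam_setup_def presented_group_def presented_group_axioms_def amalgam_def)
  show ?thesis
    using golden_reduced_pair[OF S(1,3) _ factors_proper] S(2) image_amalgam_factors by simp
qed

lemma amalgam_generator_set_within_factors:
  assumes fg: "finitely_generated_group G" and data: "amalgam_data H K C i j"
    and iso: "\<psi> \<in> iso (amalgam H K C i j) G"
  shows "\<exists>S\<subseteq>\<psi> ` amalgam_factors H K C i j. generator_set G S"
proof -
  interpret amalgam_group H K C i j G \<psi>
    using fg data iso
    by (simp add: amalgam_group_def amalgam_setup_def presented_group_def presented_group_axioms_def
        amalgam_def finitely_generated_group_def)
  show ?thesis
    unfolding image_amalgam_factors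
    by (rule generator_set_within[OF fg _ generate_factors]) (use carA carB AB_mult in auto)
qed

theorem theorem10p2:
  fixes \<Gamma> :: "('a, 'b) monoid_scheme" and m :: nat
  assumes "finitely_generated_group \<Gamma>"
    and "group_ends \<Gamma> = \<infinity>"
    and "m = min_generator_card \<Gamma>"
  shows "m \<ge> 3 \<and>
    (sqrt 3 > golden_mean \<and>
     (m \<ge> 4 \<longrightarrow>
       (\<forall>S. generator_set \<Gamma> S \<longrightarrow> cayley_connective_constant \<Gamma> S \<ge> sqrt 3))) \<and>
    (m = 3 \<longrightarrow>
      (\<forall>(X :: 'g set) R C1 C2 f.
        hnn_data X R C1 C2 f \<and> hnn_group X R C1 f \<cong> \<Gamma> \<longrightarrow>
        (\<forall>S. generator_set \<Gamma> S \<longrightarrow> cayley_connective_constant \<Gamma> S \<ge> golden_mean))) \<and>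
    (\<forall>(H :: ('h, 'p) monoid_scheme) (K :: ('k, 'q) monoid_scheme)
        (C :: ('c, 'r) monoid_scheme) i j \<psi> S.
      amalgam_data H K C i j \<and> \<psi> \<in> iso (amalgam H K C i j) \<Gamma> \<and>
      generator_set \<Gamma> S \<and> S \<subseteq> \<psi> ` amalgam_factors H K C i j \<and> card S = 3 \<longrightarrow>
      (\<exists>S'. minimal_generator_set \<Gamma> S' \<and> S' \<subseteq> \<psi> ` amalgam_factors H K C i j \<and> card S' = 3 \<and>
        cayley_connective_constant \<Gamma> S' \<ge> golden_mean)) \<and>
    (\<forall>(H :: ('h, 'p) monoid_scheme) (K :: ('k, 'q) monoid_scheme)
        (C :: ('c, 'r) monoid_scheme) i j.
      amalgam_data H K C i j \<and> amalgam H K C i j \<cong> \<Gamma> \<longrightarrow>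
      (\<exists>S. minimal_generator_set \<Gamma> S \<and> cayley_connective_constant \<Gamma> S \<ge> golden_mean))"
proof -
  interpret group \<Gamma> using assms(1) by (simp add: finitely_generated_group_def)
  have m3: "3 \<le> m" and inf: "infinite (carrier \<Gamma>)"
    using infinitely_many_ends_imp[OF assms(1,2)] assms(3) by auto
  have card_ge: "m \<le> card S" if "generator_set \<Gamma> S" for S
    using min_generator_card_le[OF that] assms(3) by simp
  have sqrt3: "cayley_connective_constant \<Gamma> S \<ge> sqrt 3" if "generator_set \<Gamma> S" "4 \<le> card S" for S
  proof -
    interpret infinite_cayley \<Gamma> S
      by unfold_locales (use that inf in auto)
    show ?thesis by (rule connective_constant_ge_sqrt3[OF that(2)])
  qed
  \<comment> \<open>Every generator set has at least three elements, and four or more give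
    \<open>sqrt 3\<close>; only size three calls for a special argument.\<close>
  have golden: "cayley_connective_constant \<Gamma> S \<ge> golden_mean"
    if "generator_set \<Gamma> S" "card S = 3 \<Longrightarrow> cayley_connective_constant \<Gamma> S \<ge> golden_mean" for S
  proof (cases "card S = 3")
    case False
    then have "4 \<le> card S" using card_ge[OF that(1)] m3 by linarith
    then show ?thesis using sqrt3[OF that(1)] golden_mean_bounds(2) by linarith
  qed (use that in blast)
  have a: "\<forall>S. generator_set \<Gamma> S \<longrightarrow> cayley_connective_constant \<Gamma> S \<ge> sqrt 3" if "m \<ge> 4"
    using sqrt3 card_ge that by (meson le_trans)
  have b: "cayley_connective_constant \<Gamma> S \<ge> golden_mean"
    if hnn: "hnn_group (X :: 'g set) R C1 f \<cong> \<Gamma>" and S: "generator_set \<Gamma> S" for X R C1 f S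
  proof (rule golden[OF S])
    obtain h :: "'a \<Rightarrow> int" and t where
      "\<And>x y. x \<in> carrier \<Gamma> \<Longrightarrow> y \<in> carrier \<Gamma> \<Longrightarrow> h (x \<otimes>\<^bsub>\<Gamma>\<^esub> y) = h x + h y"
      "t \<in> carrier \<Gamma>" "h t \<noteq> 0"
      using hnn_hom_int[OF is_group hnn] by metis
    then show "cayley_connective_constant \<Gamma> S \<ge> golden_mean" if "card S = 3"
      using golden_height[OF S that] by blast
  qed
  \<comment> \<open>S itself can be taken for S', because three is the least possible size and so S
    is minimal.\<close>
  have c: "minimal_generator_set \<Gamma> S \<and> cayley_connective_constant \<Gamma> S \<ge> golden_mean"
    if "amalgam_data (H :: ('h, 'p) monoid_scheme) (K :: ('k, 'q) monoid_scheme)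
        (C :: ('c, 'r) monoid_scheme) i j" "\<psi> \<in> iso (amalgam H K C i j) \<Gamma>"
      "generator_set \<Gamma> S" "S \<subseteq> \<psi> ` amalgam_factors H K C i j" "card S = 3" for H K C i j \<psi> S
  proof
    have "card S = min_generator_card \<Gamma>" using card_ge[OF that(3)] m3 that(5) assms(3) by simp
    then show "minimal_generator_set \<Gamma> S" by (rule minimal_generator_setI[OF that(3)])
    show "cayley_connective_constant \<Gamma> S \<ge> golden_mean" by (rule golden_amalgam[OF is_group that])
  qed
  have d: "\<exists>S. minimal_generator_set \<Gamma> S \<and> cayley_connective_constant \<Gamma> S \<ge> golden_mean"
    if data: "amalgam_data (H :: ('h, 'p) monoid_scheme) (K :: ('k, 'q) monoid_scheme)
        (C :: ('c, 'r) monoid_scheme) i j" and "amalgam H K C i j \<cong> \<Gamma>" for H K C i j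
  proof -
    obtain \<psi> where iso: "\<psi> \<in> iso (amalgam H K C i j) \<Gamma>"
      using \<open>amalgam H K C i j \<cong> \<Gamma>\<close> by (auto simp: is_iso_def)
    obtain S0 where S0: "S0 \<subseteq> \<psi> ` amalgam_factors H K C i j" "generator_set \<Gamma> S0"
      using amalgam_generator_set_within_factors[OF assms(1) data iso] by blast
    \<comment> \<open>Shrinking a set inside the two factors keeps it there, so that
      \<open>golden_amalgam\<close> applies if the minimal set has size three.\<close>
    obtain S where S: "S \<subseteq> S0" "minimal_generator_set \<Gamma> S"
      using minimal_generator_subset[OF S0(2)] by blast
    then have gen: "generator_set \<Gamma> S" by (simp add: minimal_generator_set_def)
    have "cayley_connective_constant \<Gamma> S \<ge> golden_mean"
      by (rule golden[OF gen golden_amalgam[OF is_group data iso gen subset_trans[OF S(1) S0(1)]]])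
    then show ?thesis using S by blast
  qed
  show ?thesis
  proof (intro conjI allI impI, goal_cases)
    case (4 X R C1 C2 f S)
    then show ?case using b by (elim conjE)
  next
    case (5 H K C i j \<psi> S)
    then show ?case using c[of H K C i j \<psi> S] by (intro exI[of _ S]) simp
  next
    case (6 H K C i j)
    then show ?case using d by (elim conjE)
  qed (use m3 golden_mean_bounds(2) a in simp_all)
qed

end
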